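(* Let $G=(V,E)$ be an undirected unweighted graph with $n$ nodes. For any integer $k\ge 1$ and any set of pairs $\mathcal{P}\subseteq V\times V$, there is a polynomial time algorithm that computes a $(1,4k)$ $\mathcal{P}$-spanner of $G$ of size $O\!\left(n^{1+1/(2k+1)}\left(\sqrt{(4k+5)|\mathcal{P}|}\right)^{k/(2k+1)}\right)$, i.e. a subgraph $H\subseteq G$ with that many edges such that $\delta_H(s,t)\le \delta_G(s,t)+4k$ for every $(s,t)\in\mathcal{P}$.
   Context: For a graph $X$ and nodes $u,v$, $\delta_X(u,v)$ denotes the shortest-path distance between $u$ and $v$ in $X$. For $\alpha\ge 1,\beta\ge 0$ and $\mathcal{P}\subseteq V\times V$, an $(\alpha,\beta)$ $\mathcal{P}$-spanner of $G$ is a subgraph $H\subseteq G$ (on the same node set) such that $\delta_H(s,t)\le \alpha\,\delta_G(s,t)+\beta$ for all $(s,t)\in\mathcal{P}$. The size of a spanner is its number of edges. The $O(\cdot)$ hides an absolute constant independent of $n$, $k$ and $\mathcal{P}$. *)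

theory Defs
  imports Complex_Main "HOL-Library.Extended_Real" "HOL-Computational_Algebra.Polynomial"
begin

section \<open>Graphs, distances and pairwise spanners\<close>

definition ugraph :: "'a set \<Rightarrow> 'a set set \<Rightarrow> bool" where
  "ugraph V E \<longleftrightarrow> finite V \<and> (\<forall>e\<in>E. e \<subseteq> V \<and> card e = 2)"

definition walk :: "'a set \<Rightarrow> 'a set set \<Rightarrow> 'a \<Rightarrow> 'a list \<Rightarrow> 'a \<Rightarrow> bool" where
  "walk V E u xs v \<longleftrightarrow>
     xs \<noteq> [] \<and> set xs \<subseteq> V \<and> hd xs = u \<and> last xs = v \<and> successively (\<lambda>x y. {x, y} \<in> E) xs"

text \<open>The infimum of the empty set is \<open>\<infinity>\<close>, the distance of nodes in different components.\<close>

definition gdist :: "'a set \<Rightarrow> 'a set set \<Rightarrow> 'a \<Rightarrow> 'a \<Rightarrow> enat" where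
  "gdist V E u v = (INF xs \<in> {xs. walk V E u xs v}. enat (length xs - 1))"

text \<open>A subgraph \<open>(V, F)\<close> of \<open>(V, E)\<close> on the same node set is given by its edge set \<open>F\<close>.\<close>

definition pairwise_spanner ::
    "real \<Rightarrow> real \<Rightarrow> ('a \<times> 'a) set \<Rightarrow> 'a set \<Rightarrow> 'a set set \<Rightarrow> 'a set set \<Rightarrow> bool" where
  "pairwise_spanner \<alpha> \<beta> P V E F \<longleftrightarrow>
     F \<subseteq> E \<and>
     (\<forall>(s, t) \<in> P. ereal_of_enat (gdist V F s t)
                    \<le> ereal \<alpha> * ereal_of_enat (gdist V E s t) + ereal \<beta>)"


section \<open>Random-access programs and their running time\<close>

text \<open>
  Every program variable is an unbounded two-dimensional array of natural numbers; a scalar is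
  the entry at \<open>(0, 0)\<close>. Arithmetic is restricted to addition and truncated subtraction.
  Multiplication is deliberately not primitive: each assignment then increases the bit length of
  the largest stored number by at most a constant depending on the program, so that charging one
  unit of time per assignment and per test is polynomially equivalent to Turing machine time.
\<close>

type_synonym vname = string
type_synonym store = "vname \<Rightarrow> nat \<Rightarrow> nat \<Rightarrow> nat"

datatype aexp = N nat | Entry vname aexp aexp | Plus aexp aexp | Minus aexp aexp

datatype bexp = Less aexp aexp | Not bexp | And bexp bexp

datatype com =
    Skip
  | Assign vname aexp aexp aexp
  | Seq com com
  | If bexp com com
  | While bexp com

fun aval :: "aexp \<Rightarrow> store \<Rightarrow> nat" where
  "aval (N m) s = m"
| "aval (Entry x a b) s = s x (aval a s) (aval b s)"
| "aval (Plus a b) s = aval a s + aval b s"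
| "aval (Minus a b) s = aval a s - aval b s"

fun bval :: "bexp \<Rightarrow> store \<Rightarrow> bool" where
  "bval (Less a b) s \<longleftrightarrow> aval a s < aval b s"
| "bval (Not b) s \<longleftrightarrow> \<not> bval b s"
| "bval (And b c) s \<longleftrightarrow> bval b s \<and> bval c s"

definition upd :: "store \<Rightarrow> vname \<Rightarrow> nat \<Rightarrow> nat \<Rightarrow> nat \<Rightarrow> store" where
  "upd s x i j m = s(x := (s x)(i := (s x i)(j := m)))"

text \<open>\<open>exec c s T t\<close>: started in store \<open>s\<close>, program \<open>c\<close> halts after \<open>T\<close> steps in store \<open>t\<close>.\<close>

inductive exec :: "com \<Rightarrow> store \<Rightarrow> nat \<Rightarrow> store \<Rightarrow> bool" where
  Skip: "exec Skip s 1 s"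
| Assign: "exec (Assign x a b e) s 1 (upd s x (aval a s) (aval b s) (aval e s))"
| Seq: "exec c s T s' \<Longrightarrow> exec d s' T' s'' \<Longrightarrow> exec (Seq c d) s (T + T') s''"
| IfTrue: "bval b s \<Longrightarrow> exec c s T s' \<Longrightarrow> exec (If b c d) s (Suc T) s'"
| IfFalse: "\<not> bval b s \<Longrightarrow> exec d s T s' \<Longrightarrow> exec (If b c d) s (Suc T) s'"
| WhileFalse: "\<not> bval b s \<Longrightarrow> exec (While b c) s 1 s"
| WhileTrue: "bval b s \<Longrightarrow> exec c s T s' \<Longrightarrow> exec (While b c) s' T' s'' \<Longrightarrow>
    exec (While b c) s (Suc (T + T')) s''"

lemma exec_deterministic:
  "exec c s T t \<Longrightarrow> exec c s T' t' \<Longrightarrow> T' = T \<and> t' = t"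
proof (induction arbitrary: T' t' rule: exec.induct)
  case (Skip s)
  then show ?case by (auto elim: exec.cases)
next
  case (Assign x a b e s)
  then show ?case by (auto elim: exec.cases)
next
  case (Seq c s T s' d T2 s'')
  from Seq.prems show ?case by cases (use Seq.IH in blast)
next
  case (IfTrue b s c T s' d)
  from IfTrue.prems show ?case by cases (use IfTrue in blast)+
next
  case (IfFalse b s d T s' c)
  from IfFalse.prems show ?case by cases (use IfFalse in blast)+
next
  case (WhileFalse b s c)
  from WhileFalse.prems show ?case by cases (use WhileFalse in auto)
next
  case (WhileTrue b s c T s' T2 s'')
  from WhileTrue.prems show ?case by cases (use WhileTrue in blast)+
qed


section \<open>Input and output format\<close>

text \<open>
  The nodes are presented to the program as the numbers \<open>0, \<dots>, n - 1\<close>, via an arbitrary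
  numbering \<open>\<nu>\<close> of \<open>V\<close>. The edge set and the set of pairs are presented as 0/1 matrices, and
  the edge set of the spanner is returned as one.
\<close>

definition input_store ::
    "(nat \<Rightarrow> 'a) \<Rightarrow> 'a set \<Rightarrow> 'a set set \<Rightarrow> ('a \<times> 'a) set \<Rightarrow> nat \<Rightarrow> store" where
  "input_store \<nu> V E P k = (\<lambda>x i j.
     if x = ''n'' \<and> i = 0 \<and> j = 0 then card V
     else if x = ''k'' \<and> i = 0 \<and> j = 0 then k
     else if x = ''E'' \<and> i < card V \<and> j < card V then of_bool ({\<nu> i, \<nu> j} \<in> E)
     else if x = ''P'' \<and> i < card V \<and> j < card V then of_bool ((\<nu> i, \<nu> j) \<in> P)
     else 0)"

definition outputs_edges :: "(nat \<Rightarrow> 'a) \<Rightarrow> 'a set \<Rightarrow> store \<Rightarrow> 'a set set \<Rightarrow> bool" where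
  "outputs_edges \<nu> V t F \<longleftrightarrow>
     (\<forall>i < card V. \<forall>j < card V. t ''H'' i j = of_bool ({\<nu> i, \<nu> j} \<in> F))"

end

theory Submission
  imports Defs "HOL-Analysis.Convex"
begin

text \<open>
  Write \<open>p = card P \<le> n\<^sup>2\<close>. The claimed bound is never below \<open>n p\<^bsup>1/4\<^esup>\<close>, and for \<open>k = 1\<close> it is
  at least \<open>n p\<^bsup>1/3\<^esup>\<close>; so it suffices to find an additive \<open>6\<close>-spanner of the first size
  and an additive \<open>4\<close>-spanner of the second. Put \<open>d = p\<^bsup>1/4\<^esup>\<close> and \<open>T = d\<^sup>2\<close> (\<open>d = p\<^bsup>1/3\<^esup>\<close> and
  \<open>T = d\<close> if \<open>k = 1\<close>).

  Every node keeps \<open>d\<close> of its edges. Both ends of a missing edge then have \<open>d\<close> kept neighbours, and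
  a node has kept edges to at most three nodes of a shortest path. Fix a shortest path for each pair
  and pick \<open>T\<close> centres greedily, minimising the number \<open>\<Phi>\<close> of missing edges that lie before the
  first or after the last path node adjacent to a centre. A random new centre is expected to lower \<open>\<Phi>\<close>
  by order \<open>d \<Phi>\<^sup>2 / (n p)\<close>, whence \<open>\<Phi> = O(n p / (d T)) = O(n d)\<close> at the end, and those edges are bought.

  It remains to join the centres. For \<open>k = 1\<close>, breadth-first trees cost \<open>n T\<close> edges. For \<open>k \<ge> 2\<close>, the path
  between two centres is bought only if their distance is still wrong by more than \<open>2\<close>; then for every node
  next to the path the distance to one of the two centres improves, which can happen
  at most three times per centre and node, so that \<open>O(n T / d)\<close> edges are bought. The detour through the
  centres costs at most \<open>4\<close>, plus \<open>2\<close> if \<open>k \<ge> 2\<close>.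
\<close>

section \<open>A language of loop programs\<close>

text \<open>Both choices of \<open>T\<close> come from balancing. Spending \<open>n d\<close> edges
  on the cut-off ends asks for \<open>n p / (d T) = n d\<close>, that is \<open>p = d^2 T\<close>.
  Linking the centres costs \<open>n T\<close> or \<open>n T / d\<close>; equating this with
  \<open>n d\<close> gives \<open>T = d\<close>, \<open>p = d^3\<close>, respectively
  \<open>T = d^2\<close>, \<open>p = d^4\<close>. As \<open>p \<le> n^2\<close>, one has
  \<open>sqrt p \<le> n\<close>, so the claimed size dominates \<open>n p^((k+1)/(4k+2))\<close>,
  whose exponent is 1/3 for \<open>k = 1\<close> and always above 1/4. The expected drop is
  quadratic because a centre next to a path cuts off everything beyond its position: a side with
  \<open>x\<close> missing edges loses order \<open>d x^2 / n\<close> on average, and Cauchy-Schwarz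
  over the pairs turns this into \<open>d \<Phi>^2 / (n p)\<close>. The best of the \<open>n\<close>
  candidates is no worse than the average, which removes the randomness. The running time is that of
  a concrete program, so every choice is fixed down to ties: next hops, kept edges and centres all
  prefer small node numbers, and the program is verified against exactly these sets.\<close>

text \<open>
  All loops range over the numbers below \<open>n\<close>, so that polynomial running time is automatic.
  \<open>Fill x e\<close> assigns all entries of the \<open>n \<times> n\<close> array \<open>x\<close> simultaneously; \<open>e\<close> sees the
  indices of the entry as \<open>Idx 0\<close> and \<open>Idx 1\<close>.
\<close>

datatype exp =
    Num nat
  | Idx nat
  | At vname exp exp
  | Add exp exp
  | Sub exp exp
  | IfLt exp exp exp exp
  | Total nat exp

datatype cmd =
    Fill vname exp
  | Then cmd cmd (infixr ";;" 60)
  | For nat cmd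

abbreviation size_of :: "store \<Rightarrow> nat" where
  "size_of s \<equiv> s ''n'' 0 0"

primrec eval :: "exp \<Rightarrow> (nat \<Rightarrow> nat) \<Rightarrow> store \<Rightarrow> nat" where
  "eval (Num c) \<rho> s = c"
| "eval (Idx m) \<rho> s = \<rho> m"
| "eval (At x a b) \<rho> s = s x (eval a \<rho> s) (eval b \<rho> s)"
| "eval (Add a b) \<rho> s = eval a \<rho> s + eval b \<rho> s"
| "eval (Sub a b) \<rho> s = eval a \<rho> s - eval b \<rho> s"
| "eval (IfLt a b c e) \<rho> s = (if eval a \<rho> s < eval b \<rho> s then eval c \<rho> s else eval e \<rho> s)"
| "eval (Total m e) \<rho> s = (\<Sum>i<size_of s. eval e (\<rho>(m := i)) s)"

primrec run :: "cmd \<Rightarrow> (nat \<Rightarrow> nat) \<Rightarrow> store \<Rightarrow> store" where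
  "run (Fill x e) \<rho> s =
     s(x := \<lambda>i j. if i < size_of s \<and> j < size_of s then eval e (\<rho>(0 := i, 1 := j)) s else s x i j)"
| "run (c ;; d) \<rho> s = run d \<rho> (run c \<rho> s)"
| "run (For m c) \<rho> s = fold (\<lambda>i. run c (\<rho>(m := i))) [0..<size_of s] s"

text \<open>Arrays owned by the translation: \<open>I\<close> holds the index variables,
  \<open>T\<close> the temporaries, and \<open>Y\<close> buffers simultaneous assignments.\<close>

definition reserved :: "vname set" where
  "reserved = {''I'', ''T'', ''Y''}"

primrec reads :: "exp \<Rightarrow> vname set" where
  "reads (Num c) = {}"
| "reads (Idx m) = {}"
| "reads (At x a b) = {x} \<union> reads a \<union> reads b"
| "reads (Add a b) = reads a \<union> reads b"
| "reads (Sub a b) = reads a \<union> reads b"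
| "reads (IfLt a b c e) = reads a \<union> reads b \<union> reads c \<union> reads e"
| "reads (Total m e) = reads e"

text \<open>Excluding writes to \<open>n\<close> as well makes all loop bounds, and hence the time
  bound, refer to one fixed size.\<close>

primrec admissible :: "cmd \<Rightarrow> bool" where
  "admissible (Fill x e) \<longleftrightarrow> x \<notin> insert ''n'' reserved \<and> reads e \<inter> reserved = {}"
| "admissible (c ;; d) \<longleftrightarrow> admissible c \<and> admissible d"
| "admissible (For m c) \<longleftrightarrow> admissible c"

section \<open>Translation to random-access programs\<close>

abbreviation "index m \<equiv> Entry ''I'' (N m) (N 0)"
abbreviation "temp d \<equiv> Entry ''T'' (N d) (N 0)"
abbreviation "set_index m \<equiv> Assign ''I'' (N m) (N 0)"
abbreviation "set_temp d \<equiv> Assign ''T'' (N d) (N 0)"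

definition loop :: "nat \<Rightarrow> nat \<Rightarrow> com \<Rightarrow> com" where
  "loop m d c =
     Seq (set_temp d (index m)) (Seq (set_index m (N 0))
     (Seq (While (Less (index m) (Entry ''n'' (N 0) (N 0)))
            (Seq c (set_index m (Plus (index m) (N 1)))))
          (set_index m (temp d))))"

text \<open>
  The value is left in cell \<open>d\<close> of the temporaries, and cells below \<open>d\<close> are preserved. A loop saves and
  restores its index variable, hence evaluation has no side effect on index variables.
\<close>

primrec compile_exp :: "exp \<Rightarrow> nat \<Rightarrow> com" where
  "compile_exp (Num c) d = set_temp d (N c)"
| "compile_exp (Idx m) d = set_temp d (index m)"
| "compile_exp (At x a b) d =
     Seq (compile_exp a d) (Seq (compile_exp b (d + 1)) (set_temp d (Entry x (temp d) (temp (d + 1)))))"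
| "compile_exp (Add a b) d =
     Seq (compile_exp a d) (Seq (compile_exp b (d + 1)) (set_temp d (Plus (temp d) (temp (d + 1)))))"
| "compile_exp (Sub a b) d =
     Seq (compile_exp a d) (Seq (compile_exp b (d + 1)) (set_temp d (Minus (temp d) (temp (d + 1)))))"
| "compile_exp (IfLt a b c e) d =
     Seq (compile_exp a d) (Seq (compile_exp b (d + 1))
       (If (Less (temp d) (temp (d + 1))) (compile_exp c d) (compile_exp e d)))"
| "compile_exp (Total m e) d =
     Seq (set_temp (d + 1) (N 0))
     (Seq (loop m d (Seq (compile_exp e (d + 2)) (set_temp (d + 1) (Plus (temp (d + 1)) (temp (d + 2))))))
          (set_temp d (temp (d + 1))))"

primrec cost_exp :: "exp \<Rightarrow> nat poly" where
  "cost_exp (Num c) = 1"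
| "cost_exp (Idx m) = 1"
| "cost_exp (At x a b) = cost_exp a + cost_exp b + 1"
| "cost_exp (Add a b) = cost_exp a + cost_exp b + 1"
| "cost_exp (Sub a b) = cost_exp a + cost_exp b + 1"
| "cost_exp (IfLt a b c e) = cost_exp a + cost_exp b + cost_exp c + cost_exp e + 1"
| "cost_exp (Total m e) = [:0, 1:] * (cost_exp e + 3) + 6"

text \<open>In \<open>Fill x e\<close> the expression may read \<open>x\<close> itself, so all
  values are collected in \<open>Y\<close> before any entry of \<open>x\<close> is
  overwritten.\<close>

primrec compile :: "cmd \<Rightarrow> nat \<Rightarrow> com" where
  "compile (Fill x e) d =
     Seq (loop 0 d (loop 1 (d + 1) (Seq (compile_exp e (d + 2)) (Assign ''Y'' (index 0) (index 1) (temp (d + 2))))))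
         (loop 0 d (loop 1 (d + 1) (Assign x (index 0) (index 1) (Entry ''Y'' (index 0) (index 1)))))"
| "compile (c1 ;; c2) d = Seq (compile c1 d) (compile c2 d)"
| "compile (For m c) d = loop m d (compile c (d + 1))"

text \<open>Each loop with body cost \<open>b\<close> contributes \<open>n (b + 2) + 4\<close>, the
  bound of \<open>runs_loop\<close>; the variable of the polynomial is \<open>n\<close>.\<close>

primrec cost :: "cmd \<Rightarrow> nat poly" where
  "cost (Fill x e) =
     ([:0, 1:] * (([:0, 1:] * (cost_exp e + 3) + 4) + 2) + 4) + ([:0, 1:] * (([:0, 1:] * 3 + 4) + 2) + 4)"
| "cost (c1 ;; c2) = cost c1 + cost c2"
| "cost (For m c) = [:0, 1:] * (cost c + 2) + 4"

section \<open>Correctness and running time of the translation\<close>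

definition runs :: "com \<Rightarrow> store \<Rightarrow> nat \<Rightarrow> (store \<Rightarrow> bool) \<Rightarrow> bool" where
  "runs c \<sigma> b Q \<longleftrightarrow> (\<exists>T \<sigma>'. exec c \<sigma> T \<sigma>' \<and> T \<le> b \<and> Q \<sigma>')"

lemma upd_same: "upd s x i j m x a b = (if a = i \<and> b = j then m else s x a b)"
  by (simp add: upd_def)

lemma upd_other: "y \<noteq> x \<Longrightarrow> upd s x i j m y = s y"
  by (simp add: upd_def)

lemma runs_mono: "runs c \<sigma> b Q \<Longrightarrow> b \<le> b' \<Longrightarrow> (\<And>\<sigma>'. Q \<sigma>' \<Longrightarrow> Q' \<sigma>') \<Longrightarrow> runs c \<sigma> b' Q'"
  unfolding runs_def by (meson order_trans)

lemma runs_Assign: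
  "Q (upd \<sigma> x (aval a \<sigma>) (aval b \<sigma>) (aval e \<sigma>)) \<Longrightarrow> runs (Assign x a b e) \<sigma> 1 Q"
  unfolding runs_def using exec.Assign by blast

lemma runs_Seq:
  assumes "runs c \<sigma> b R" and "\<And>\<sigma>'. R \<sigma>' \<Longrightarrow> runs d \<sigma>' b' Q"
  shows "runs (Seq c d) \<sigma> (b + b') Q"
  using assms unfolding runs_def by (meson add_mono exec.Seq)

lemma runs_If:
  assumes "bval t \<sigma> \<Longrightarrow> runs c \<sigma> b Q" and "\<not> bval t \<sigma> \<Longrightarrow> runs d \<sigma> b' Q"
  shows "runs (If t c d) \<sigma> (Suc (b + b')) Q"
proof (cases "bval t \<sigma>")
  case True
  with assms(1) obtain T \<sigma>' where "exec c \<sigma> T \<sigma>'" "T \<le> b" "Q \<sigma>'" unfolding runs_def by blast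
  with True show ?thesis unfolding runs_def
    by (intro exI[of _ "Suc T"] exI[of _ \<sigma>']) (auto intro: exec.IfTrue)
next
  case False
  with assms(2) obtain T \<sigma>' where "exec d \<sigma> T \<sigma>'" "T \<le> b'" "Q \<sigma>'" unfolding runs_def by blast
  with False show ?thesis unfolding runs_def
    by (intro exI[of _ "Suc T"] exI[of _ \<sigma>']) (auto intro: exec.IfFalse)
qed

lemma runs_While:
  assumes test: "\<And>i \<sigma>. i \<le> n \<Longrightarrow> J i \<sigma> \<Longrightarrow> bval t \<sigma> \<longleftrightarrow> i < n"
    and body: "\<And>i \<sigma>. i < n \<Longrightarrow> J i \<sigma> \<Longrightarrow> runs c \<sigma> b (J (Suc i))"
    and "i \<le> n" and "J i \<sigma>"
  shows "runs (While t c) \<sigma> (Suc ((n - i) * Suc b)) (J n)"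
  using assms(3,4)
proof (induction "n - i" arbitrary: i \<sigma>)
  case 0
  then have "i = n" by simp
  with 0 test[of i \<sigma>] show ?case
    unfolding runs_def by (metis exec.WhileFalse le_add1 less_irrefl plus_1_eq_Suc)
next
  case (Suc l)
  then have i: "i < n" and "l = n - Suc i" by simp_all
  obtain T \<sigma>1 where 1: "exec c \<sigma> T \<sigma>1" "T \<le> b" "J (Suc i) \<sigma>1"
    using body[OF i Suc.prems(2)] unfolding runs_def by blast
  obtain T' \<sigma>2 where 2: "exec (While t c) \<sigma>1 T' \<sigma>2" "T' \<le> Suc ((n - Suc i) * Suc b)" "J n \<sigma>2"
    using Suc.hyps(1)[of "Suc i" \<sigma>1] \<open>l = n - Suc i\<close> i 1(3) unfolding runs_def by (metis Suc_leI)
  have "exec (While t c) \<sigma> (Suc (T + T')) \<sigma>2"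
    using exec.WhileTrue[OF _ 1(1) 2(1)] test[OF Suc.prems] i by blast
  moreover have "n - i = Suc (n - Suc i)" using i by simp
  then have "Suc (T + T') \<le> Suc ((n - i) * Suc b)" using 1(2) 2(2) by simp
  ultimately show ?case using 2(3) unfolding runs_def by blast
qed

text \<open>A source state is a store \<open>s\<close> together with a valuation
  \<open>\<rho>\<close> of the index variables. Temporaries and buffer are left
  unconstrained.\<close>

definition sim :: "(nat \<Rightarrow> nat) \<Rightarrow> store \<Rightarrow> store \<Rightarrow> bool" where
  "sim \<rho> s \<sigma> \<longleftrightarrow> (\<forall>x. x \<notin> reserved \<longrightarrow> \<sigma> x = s x) \<and> (\<forall>m. \<sigma> ''I'' m 0 = \<rho> m)"

lemma sim_size: "sim \<rho> s \<sigma> \<Longrightarrow> size_of \<sigma> = size_of s"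
  by (simp add: sim_def reserved_def)

lemma sim_temp: "sim \<rho> s \<sigma> \<Longrightarrow> sim \<rho> s (upd \<sigma> ''T'' i j v)"
  by (auto simp: sim_def upd_def reserved_def)

lemma sim_Y: "sim \<rho> s \<sigma> \<Longrightarrow> sim \<rho> s (upd \<sigma> ''Y'' i j v)"
  by (auto simp: sim_def upd_def reserved_def)

lemma sim_index: "sim \<rho> s \<sigma> \<Longrightarrow> sim (\<rho>(m := v)) s (upd \<sigma> ''I'' m 0 v)"
  by (auto simp: sim_def upd_def reserved_def)

text \<open>\<open>st i\<close> is the source store after \<open>i\<close> rounds; \<open>J\<close>
  carries facts about temporaries and buffer and must survive writes to the index cell. Cell
  \<open>d\<close> stores the caller's value of index \<open>m\<close>, so the body has to preserve
  it. A round costs the body, the increment and the test; the final 4 are three assignments and the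
  failing test.\<close>

lemma runs_loop:
  assumes body: "\<And>i \<sigma>. i < n \<Longrightarrow> sim (\<rho>(m := i)) (st i) \<sigma> \<Longrightarrow> J i \<sigma> \<Longrightarrow>
      runs c \<sigma> b (\<lambda>\<sigma>'. sim (\<rho>(m := i)) (st (Suc i)) \<sigma>' \<and> \<sigma>' ''T'' d 0 = \<sigma> ''T'' d 0 \<and> J (Suc i) \<sigma>')"
    and J: "\<And>i \<sigma> v. J i \<sigma> \<Longrightarrow> J i (upd \<sigma> ''I'' m 0 v)"
    and size: "\<And>i. i \<le> n \<Longrightarrow> size_of (st i) = n"
    and start: "sim \<rho> (st 0) \<sigma>" "J 0 (upd \<sigma> ''T'' d 0 (\<rho> m))"
  shows "runs (loop m d c) \<sigma> (n * (b + 2) + 4) (\<lambda>\<sigma>'. sim \<rho> (st n) \<sigma>' \<and> J n \<sigma>')"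
proof -
  let ?K = "\<lambda>i \<sigma>. sim (\<rho>(m := i)) (st i) \<sigma> \<and> \<sigma> ''T'' d 0 = \<rho> m \<and> J i \<sigma>"
  have step: "runs (Seq c (set_index m (Plus (index m) (N 1)))) \<sigma> (b + 1) (?K (Suc i))"
    if "i < n" "?K i \<sigma>" for i \<sigma>
  proof (rule runs_Seq[where b' = 1, OF body])
    fix \<sigma>' assume *: "sim (\<rho>(m := i)) (st (Suc i)) \<sigma>' \<and> \<sigma>' ''T'' d 0 = \<sigma> ''T'' d 0 \<and> J (Suc i) \<sigma>'"
    then have "\<sigma>' ''I'' m 0 = i" by (simp add: sim_def)
    with * that show "runs (set_index m (Plus (index m) (N 1))) \<sigma>' 1 (?K (Suc i))"
      using sim_index[of "\<rho>(m := i)" "st (Suc i)" \<sigma>' m "Suc i"] J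
      by (intro runs_Assign) (auto simp: upd_same upd_other)
  qed (use that in auto)
  let ?s1 = "upd \<sigma> ''T'' d 0 (\<rho> m)"
  let ?s2 = "upd ?s1 ''I'' m 0 0"
  have K0: "?K 0 ?s2"
    using sim_index[OF sim_temp[OF start(1)]] J[OF start(2)] by (auto simp: upd_same upd_other)
  have while: "runs (While (Less (index m) (Entry ''n'' (N 0) (N 0)))
      (Seq c (set_index m (Plus (index m) (N 1))))) ?s2 (Suc ((n - 0) * Suc (b + 1))) (?K n)"
  proof (rule runs_While[where J = ?K])
    show "bval (Less (index m) (Entry ''n'' (N 0) (N 0))) \<sigma> \<longleftrightarrow> i < n" if "i \<le> n" "?K i \<sigma>" for i \<sigma>
      using that size[of i] sim_size[of "\<rho>(m := i)" "st i" \<sigma>] by (auto simp: sim_def)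
  qed (use step K0 in auto)
  have fin: "runs (set_index m (temp d)) \<sigma>' 1 (\<lambda>\<sigma>'. sim \<rho> (st n) \<sigma>' \<and> J n \<sigma>')"
    if "?K n \<sigma>'" for \<sigma>'
    using that sim_index[of "\<rho>(m := n)" "st n" \<sigma>' m "\<rho> m"] J by (intro runs_Assign) auto
  have a: "runs (set_temp d (index m)) \<sigma> 1 (\<lambda>\<sigma>'. \<sigma>' = ?s1)"
    using start(1) by (intro runs_Assign) (simp add: sim_def)
  have b: "runs (set_index m (N 0)) ?s1 1 (\<lambda>\<sigma>'. \<sigma>' = ?s2)"
    by (intro runs_Assign) simp
  have "runs (loop m d c) \<sigma> (1 + (1 + (Suc ((n - 0) * Suc (b + 1)) + 1))) (\<lambda>\<sigma>'. sim \<rho> (st n) \<sigma>' \<and> J n \<sigma>')"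
    unfolding loop_def
    by (rule runs_Seq[OF a], hypsubst, rule runs_Seq[OF b], hypsubst, rule runs_Seq[OF while], rule fin)
  then show ?thesis by (rule runs_mono) auto
qed

lemma runs_compile_exp:
  assumes "reads e \<inter> reserved = {}" and "sim \<rho> s \<sigma>"
  shows "runs (compile_exp e d) \<sigma> (poly (cost_exp e) (size_of s))
    (\<lambda>\<sigma>'. sim \<rho> s \<sigma>' \<and> \<sigma>' ''T'' d 0 = eval e \<rho> s \<and> (\<forall>j<d. \<sigma>' ''T'' j 0 = \<sigma> ''T'' j 0) \<and> \<sigma>' ''Y'' = \<sigma> ''Y'')"
  (is "runs _ _ _ (?Q e \<rho> d \<sigma>)")
  using assms
proof (induction e arbitrary: \<rho> \<sigma> d)
  case (Num c)
  have "runs (set_temp d (N c)) \<sigma> 1 (?Q (Num c) \<rho> d \<sigma>)"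
    using sim_temp[OF Num(2)] by (intro runs_Assign) (auto simp: upd_same upd_other)
  then show ?case by simp
next
  case (Idx m)
  have "runs (set_temp d (index m)) \<sigma> 1 (?Q (Idx m) \<rho> d \<sigma>)"
    using sim_temp[OF Idx(2)] Idx(2) by (intro runs_Assign) (auto simp: upd_same upd_other sim_def)
  then show ?case by simp
next
  case (At x a b)
  have 1: "runs (compile_exp a d) \<sigma> (poly (cost_exp a) (size_of s)) (?Q a \<rho> d \<sigma>)"
    by (rule At.IH(1)) (use At.prems in \<open>auto simp: Int_Un_distrib2\<close>)
  have 2: "runs (compile_exp b (d + 1)) \<sigma>1 (poly (cost_exp b) (size_of s)) (?Q b \<rho> (d + 1) \<sigma>1)"
    if "?Q a \<rho> d \<sigma> \<sigma>1" for \<sigma>1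
    by (rule At.IH(2)) (use At.prems that in \<open>auto simp: Int_Un_distrib2\<close>)
  have 3: "runs (set_temp d (Entry x (temp d) (temp (d + 1)))) \<sigma>2 1 (?Q (At x a b) \<rho> d \<sigma>)"
    if "?Q a \<rho> d \<sigma> \<sigma>1" "?Q b \<rho> (d + 1) \<sigma>1 \<sigma>2" for \<sigma>1 \<sigma>2
  proof -
    have "\<sigma>2 x = s x" using that(2) At.prems by (auto simp: sim_def)
    with that show ?thesis by (intro runs_Assign) (auto simp: sim_temp upd_same upd_other)
  qed
  have "runs (compile_exp (At x a b) d) \<sigma>
      (poly (cost_exp a) (size_of s) + (poly (cost_exp b) (size_of s) + 1)) (?Q (At x a b) \<rho> d \<sigma>)"
    unfolding compile_exp.simps
    by (rule runs_Seq[OF 1], rule runs_Seq[OF 2], assumption, rule 3)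
  then show ?case by (rule runs_mono) auto
next
  case (Add a b)
  have 1: "runs (compile_exp a d) \<sigma> (poly (cost_exp a) (size_of s)) (?Q a \<rho> d \<sigma>)"
    by (rule Add.IH(1)) (use Add.prems in \<open>auto simp: Int_Un_distrib2\<close>)
  have 2: "runs (compile_exp b (d + 1)) \<sigma>1 (poly (cost_exp b) (size_of s)) (?Q b \<rho> (d + 1) \<sigma>1)"
    if "?Q a \<rho> d \<sigma> \<sigma>1" for \<sigma>1
    by (rule Add.IH(2)) (use Add.prems that in \<open>auto simp: Int_Un_distrib2\<close>)
  have 3: "runs (set_temp d (Plus (temp d) (temp (d + 1)))) \<sigma>2 1 (?Q (Add a b) \<rho> d \<sigma>)"
    if "?Q a \<rho> d \<sigma> \<sigma>1" "?Q b \<rho> (d + 1) \<sigma>1 \<sigma>2" for \<sigma>1 \<sigma>2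
    using that by (intro runs_Assign) (auto simp: sim_temp upd_same upd_other)
  have "runs (compile_exp (Add a b) d) \<sigma>
      (poly (cost_exp a) (size_of s) + (poly (cost_exp b) (size_of s) + 1)) (?Q (Add a b) \<rho> d \<sigma>)"
    unfolding compile_exp.simps
    by (rule runs_Seq[OF 1], rule runs_Seq[OF 2], assumption, rule 3)
  then show ?case by (rule runs_mono) auto
next
  case (Sub a b)
  have 1: "runs (compile_exp a d) \<sigma> (poly (cost_exp a) (size_of s)) (?Q a \<rho> d \<sigma>)"
    by (rule Sub.IH(1)) (use Sub.prems in \<open>auto simp: Int_Un_distrib2\<close>)
  have 2: "runs (compile_exp b (d + 1)) \<sigma>1 (poly (cost_exp b) (size_of s)) (?Q b \<rho> (d + 1) \<sigma>1)"
    if "?Q a \<rho> d \<sigma> \<sigma>1" for \<sigma>1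
    by (rule Sub.IH(2)) (use Sub.prems that in \<open>auto simp: Int_Un_distrib2\<close>)
  have 3: "runs (set_temp d (Minus (temp d) (temp (d + 1)))) \<sigma>2 1 (?Q (Sub a b) \<rho> d \<sigma>)"
    if "?Q a \<rho> d \<sigma> \<sigma>1" "?Q b \<rho> (d + 1) \<sigma>1 \<sigma>2" for \<sigma>1 \<sigma>2
    using that by (intro runs_Assign) (auto simp: sim_temp upd_same upd_other)
  have "runs (compile_exp (Sub a b) d) \<sigma>
      (poly (cost_exp a) (size_of s) + (poly (cost_exp b) (size_of s) + 1)) (?Q (Sub a b) \<rho> d \<sigma>)"
    unfolding compile_exp.simps
    by (rule runs_Seq[OF 1], rule runs_Seq[OF 2], assumption, rule 3)
  then show ?case by (rule runs_mono) auto
next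
  case (IfLt a b c e)
  have 1: "runs (compile_exp a d) \<sigma> (poly (cost_exp a) (size_of s)) (?Q a \<rho> d \<sigma>)"
    by (rule IfLt.IH(1)) (use IfLt.prems in \<open>auto simp: Int_Un_distrib2\<close>)
  have 2: "runs (compile_exp b (d + 1)) \<sigma>1 (poly (cost_exp b) (size_of s)) (?Q b \<rho> (d + 1) \<sigma>1)"
    if "?Q a \<rho> d \<sigma> \<sigma>1" for \<sigma>1
    by (rule IfLt.IH(2)) (use IfLt.prems that in \<open>auto simp: Int_Un_distrib2\<close>)
  have 3: "runs (If (Less (temp d) (temp (d + 1))) (compile_exp c d) (compile_exp e d)) \<sigma>2
      (Suc (poly (cost_exp c) (size_of s) + poly (cost_exp e) (size_of s))) (?Q (IfLt a b c e) \<rho> d \<sigma>)"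
    if q: "?Q a \<rho> d \<sigma> \<sigma>1" "?Q b \<rho> (d + 1) \<sigma>1 \<sigma>2" for \<sigma>1 \<sigma>2
  proof (rule runs_If)
    assume t: "bval (Less (temp d) (temp (d + 1))) \<sigma>2"
    have "runs (compile_exp c d) \<sigma>2 (poly (cost_exp c) (size_of s)) (?Q c \<rho> d \<sigma>2)"
      by (rule IfLt.IH(3)) (use IfLt.prems q in \<open>auto simp: Int_Un_distrib2\<close>)
    then show "runs (compile_exp c d) \<sigma>2 (poly (cost_exp c) (size_of s)) (?Q (IfLt a b c e) \<rho> d \<sigma>)"
      by (rule runs_mono) (use q t in auto)
  next
    assume t: "\<not> bval (Less (temp d) (temp (d + 1))) \<sigma>2"
    have "runs (compile_exp e d) \<sigma>2 (poly (cost_exp e) (size_of s)) (?Q e \<rho> d \<sigma>2)"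
      by (rule IfLt.IH(4)) (use IfLt.prems q in \<open>auto simp: Int_Un_distrib2\<close>)
    then show "runs (compile_exp e d) \<sigma>2 (poly (cost_exp e) (size_of s)) (?Q (IfLt a b c e) \<rho> d \<sigma>)"
      by (rule runs_mono) (use q t in auto)
  qed
  have "runs (compile_exp (IfLt a b c e) d) \<sigma>
      (poly (cost_exp a) (size_of s) + (poly (cost_exp b) (size_of s) +
        Suc (poly (cost_exp c) (size_of s) + poly (cost_exp e) (size_of s)))) (?Q (IfLt a b c e) \<rho> d \<sigma>)"
    unfolding compile_exp.simps
    by (rule runs_Seq[OF 1], rule runs_Seq[OF 2], assumption, rule 3) auto
  then show ?case by (rule runs_mono) auto
next
  case (Total m e)
  let ?n = "size_of s" and ?b = "poly (cost_exp e) (size_of s)"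
  \<comment> \<open>Cell \<open>d\<close> keeps the saved index, \<open>d + 1\<close> the partial
    sum, and \<open>d + 2\<close> receives the summand.\<close>
  let ?J = "\<lambda>i \<sigma>'. \<sigma>' ''T'' (d + 1) 0 = (\<Sum>i<i. eval e (\<rho>(m := i)) s) \<and>
      (\<forall>j<d. \<sigma>' ''T'' j 0 = \<sigma> ''T'' j 0) \<and> \<sigma>' ''Y'' = \<sigma> ''Y''"
  let ?s0 = "upd \<sigma> ''T'' (d + 1) 0 0"
  have 1: "runs (set_temp (d + 1) (N 0)) \<sigma> 1 (\<lambda>\<sigma>'. \<sigma>' = ?s0)"
    by (intro runs_Assign) simp
  have 2: "runs (loop m d (Seq (compile_exp e (d + 2)) (set_temp (d + 1) (Plus (temp (d + 1)) (temp (d + 2))))))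
      ?s0 (?n * ((?b + 1) + 2) + 4) (\<lambda>\<sigma>'. sim \<rho> s \<sigma>' \<and> ?J ?n \<sigma>')"
  proof (rule runs_loop[where st = "\<lambda>_. s"])
    fix i \<sigma>1
    assume i: "i < ?n" "sim (\<rho>(m := i)) s \<sigma>1" "?J i \<sigma>1"
    show "runs (Seq (compile_exp e (d + 2)) (set_temp (d + 1) (Plus (temp (d + 1)) (temp (d + 2))))) \<sigma>1 (?b + 1)
       (\<lambda>\<sigma>'. sim (\<rho>(m := i)) s \<sigma>' \<and> \<sigma>' ''T'' d 0 = \<sigma>1 ''T'' d 0 \<and> ?J (Suc i) \<sigma>')"
    proof (rule runs_Seq[OF Total.IH[of "\<rho>(m := i)"]])
      fix \<sigma>2
      assume "sim (\<rho>(m := i)) s \<sigma>2 \<and> \<sigma>2 ''T'' (d + 2) 0 = eval e (\<rho>(m := i)) s \<and>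
        (\<forall>j<d + 2. \<sigma>2 ''T'' j 0 = \<sigma>1 ''T'' j 0) \<and> \<sigma>2 ''Y'' = \<sigma>1 ''Y''"
      then show "runs (set_temp (d + 1) (Plus (temp (d + 1)) (temp (d + 2)))) \<sigma>2 1
         (\<lambda>\<sigma>'. sim (\<rho>(m := i)) s \<sigma>' \<and> \<sigma>' ''T'' d 0 = \<sigma>1 ''T'' d 0 \<and> ?J (Suc i) \<sigma>')"
        using i by (intro runs_Assign) (auto simp: sim_temp upd_same upd_other)
    qed (use Total.prems i in \<open>auto simp: fun_upd_def\<close>)
  qed (use Total.prems in \<open>auto simp: sim_temp upd_same upd_other\<close>)
  have 3: "runs (set_temp d (temp (d + 1))) \<sigma>' 1 (?Q (Total m e) \<rho> d \<sigma>)"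
    if "sim \<rho> s \<sigma>' \<and> ?J ?n \<sigma>'" for \<sigma>'
    using that by (intro runs_Assign) (auto simp: sim_temp upd_same upd_other)
  have "runs (compile_exp (Total m e) d) \<sigma> (1 + ((?n * ((?b + 1) + 2) + 4) + 1)) (?Q (Total m e) \<rho> d \<sigma>)"
    unfolding compile_exp.simps
    by (rule runs_Seq[OF 1], hypsubst, rule runs_Seq[OF 2], rule 3)
  then show ?case by (rule runs_mono) (auto simp: algebra_simps)
qed

lemma size_of_run: "admissible c \<Longrightarrow> size_of (run c \<rho> s) = size_of s"
proof (induction c arbitrary: \<rho> s)
  case (For m c)
  have "size_of (fold (\<lambda>i. run c (\<rho>(m := i))) xs s) = size_of s" for xs
    using For by (induction xs arbitrary: s) auto
  then show ?case by simp
qed auto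

lemma runs_compile:
  assumes "admissible c" and "sim \<rho> s \<sigma>"
  shows "runs (compile c d) \<sigma> (poly (cost c) (size_of s))
    (\<lambda>\<sigma>'. sim \<rho> (run c \<rho> s) \<sigma>' \<and> (\<forall>j<d. \<sigma>' ''T'' j 0 = \<sigma> ''T'' j 0))"
  using assms
proof (induction c arbitrary: \<rho> s \<sigma> d)
  case (Fill x e)
  let ?n = "size_of s" and ?b = "poly (cost_exp e) (size_of s)"
  let ?v = "\<lambda>i j. eval e (\<rho>(0 := i, 1 := j)) s"
  let ?T = "\<lambda>\<sigma>'. \<forall>j<d. \<sigma>' ''T'' j 0 = \<sigma> ''T'' j 0"
  let ?J = "\<lambda>i \<sigma>'. ?T \<sigma>' \<and> (\<forall>i'<i. \<forall>j<?n. \<sigma>' ''Y'' i' j = ?v i' j)"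
  have 1: "runs (loop 0 d (loop 1 (d + 1) (Seq (compile_exp e (d + 2)) (Assign ''Y'' (index 0) (index 1) (temp (d + 2))))))
     \<sigma> (?n * ((?n * ((?b + 1) + 2) + 4) + 2) + 4) (\<lambda>\<sigma>'. sim \<rho> s \<sigma>' \<and> ?J ?n \<sigma>')"
  proof (rule runs_loop[where J = ?J and st = "\<lambda>_. s"])
    fix i \<sigma>1
    assume i: "i < ?n" "sim (\<rho>(0 := i)) s \<sigma>1" "?J i \<sigma>1"
    let ?J' = "\<lambda>j \<sigma>'. ?J i \<sigma>' \<and> \<sigma>' ''T'' d 0 = \<sigma>1 ''T'' d 0 \<and> (\<forall>j'<j. \<sigma>' ''Y'' i j' = ?v i j')"
    have "runs (loop 1 (d + 1) (Seq (compile_exp e (d + 2)) (Assign ''Y'' (index 0) (index 1) (temp (d + 2))))) \<sigma>1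
       (?n * ((?b + 1) + 2) + 4) (\<lambda>\<sigma>'. sim (\<rho>(0 := i)) s \<sigma>' \<and> ?J' ?n \<sigma>')"
    proof (rule runs_loop[where J = ?J' and st = "\<lambda>_. s"])
      fix j \<sigma>2
      assume j: "j < ?n" "sim (\<rho>(0 := i, 1 := j)) s \<sigma>2" "?J' j \<sigma>2"
      show "runs (Seq (compile_exp e (d + 2)) (Assign ''Y'' (index 0) (index 1) (temp (d + 2)))) \<sigma>2 (?b + 1)
         (\<lambda>\<sigma>'. sim (\<rho>(0 := i, 1 := j)) s \<sigma>' \<and> \<sigma>' ''T'' (d + 1) 0 = \<sigma>2 ''T'' (d + 1) 0 \<and> ?J' (Suc j) \<sigma>')"
      proof (rule runs_Seq[OF runs_compile_exp[where s = s and \<rho> = "\<rho>(0 := i, 1 := j)"]])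
        fix \<sigma>3
        assume *: "sim (\<rho>(0 := i, 1 := j)) s \<sigma>3 \<and> \<sigma>3 ''T'' (d + 2) 0 = ?v i j \<and>
           (\<forall>j<d + 2. \<sigma>3 ''T'' j 0 = \<sigma>2 ''T'' j 0) \<and> \<sigma>3 ''Y'' = \<sigma>2 ''Y''"
        then have "\<sigma>3 ''I'' 0 0 = i" "\<sigma>3 ''I'' 1 0 = j" by (auto simp: sim_def)
        note I = this
        show "runs (Assign ''Y'' (index 0) (index 1) (temp (d + 2))) \<sigma>3 1
         (\<lambda>\<sigma>'. sim (\<rho>(0 := i, 1 := j)) s \<sigma>' \<and> \<sigma>' ''T'' (d + 1) 0 = \<sigma>2 ''T'' (d + 1) 0 \<and> ?J' (Suc j) \<sigma>')"
          apply (rule runs_Assign)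
          unfolding aval.simps I
          using * j by (auto simp: sim_Y upd_same upd_other less_Suc_eq)
      qed (use Fill j in auto)
    qed (use i in \<open>auto simp: upd_same upd_other\<close>)
    then show "runs (loop 1 (d + 1) (Seq (compile_exp e (d + 2)) (Assign ''Y'' (index 0) (index 1) (temp (d + 2))))) \<sigma>1
       (?n * ((?b + 1) + 2) + 4)
       (\<lambda>\<sigma>'. sim (\<rho>(0 := i)) s \<sigma>' \<and> \<sigma>' ''T'' d 0 = \<sigma>1 ''T'' d 0 \<and> ?J (Suc i) \<sigma>')"
      by (rule runs_mono) (auto simp: less_Suc_eq)
  qed (use Fill in \<open>auto simp: upd_same upd_other\<close>)
  \<comment> \<open>Progress of the copying loop in row-major order; a finished row
    \<open>?p i ?n\<close> is the same store as \<open>?p (Suc i) 0\<close>.\<close>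
  let ?p = "\<lambda>i j. s(x := \<lambda>a b. if (a < i \<or> a = i \<and> b < j) \<and> a < ?n \<and> b < ?n then ?v a b else s x a b)"
  have x: "x \<noteq> ''n''" "x \<notin> reserved" using Fill by auto
  have 2: "runs (loop 0 d (loop 1 (d + 1) (Assign x (index 0) (index 1) (Entry ''Y'' (index 0) (index 1)))))
     \<sigma>1 (?n * ((?n * (1 + 2) + 4) + 2) + 4) (\<lambda>\<sigma>'. sim \<rho> (?p ?n 0) \<sigma>' \<and> ?J ?n \<sigma>')"
    if s1: "sim \<rho> s \<sigma>1 \<and> ?J ?n \<sigma>1" for \<sigma>1
  proof (rule runs_loop[where J = "\<lambda>_. ?J ?n" and st = "\<lambda>i. ?p i 0"])
    fix i \<sigma>2
    assume i: "i < ?n" "sim (\<rho>(0 := i)) (?p i 0) \<sigma>2" "?J ?n \<sigma>2"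
    have "runs (loop 1 (d + 1) (Assign x (index 0) (index 1) (Entry ''Y'' (index 0) (index 1)))) \<sigma>2 (?n * (1 + 2) + 4)
      (\<lambda>\<sigma>'. sim (\<rho>(0 := i)) (?p i ?n) \<sigma>' \<and> (?J ?n \<sigma>' \<and> \<sigma>' ''T'' d 0 = \<sigma>2 ''T'' d 0))"
    proof (rule runs_loop[where J = "\<lambda>_ \<sigma>'. ?J ?n \<sigma>' \<and> \<sigma>' ''T'' d 0 = \<sigma>2 ''T'' d 0" and st = "?p i"])
      fix j \<sigma>3
      assume j: "j < ?n" "sim (\<rho>(0 := i, 1 := j)) (?p i j) \<sigma>3" "?J ?n \<sigma>3 \<and> \<sigma>3 ''T'' d 0 = \<sigma>2 ''T'' d 0"
      then have I: "\<sigma>3 ''I'' 0 0 = i" "\<sigma>3 ''I'' 1 0 = j" by (auto simp: sim_def)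
      have "sim (\<rho>(0 := i, 1 := j)) (?p i (Suc j)) (upd \<sigma>3 x i j (?v i j))"
        unfolding sim_def
      proof (intro conjI allI impI)
        fix y assume "y \<notin> reserved"
        then have y: "\<sigma>3 y = ?p i j y" using j(2) by (simp add: sim_def)
        show "upd \<sigma>3 x i j (?v i j) y = ?p i (Suc j) y"
        proof (cases "y = x")
          case True
          show ?thesis using y i(1) j(1) unfolding True
            by (intro ext) (auto simp: upd_same less_Suc_eq)
        qed (use y in \<open>auto simp: upd_other\<close>)
      next
        fix l show "upd \<sigma>3 x i j (?v i j) ''I'' l 0 = (\<rho>(0 := i, 1 := j)) l"
        proof -
          have "\<sigma>3 ''I'' l 0 = (\<rho>(0 := i, 1 := j)) l" using j(2) unfolding sim_def by blast
          moreover have "''I'' \<noteq> x" using x(2) by (auto simp: reserved_def)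
          ultimately show ?thesis by (metis upd_other)
        qed
      qed
      then show "runs (Assign x (index 0) (index 1) (Entry ''Y'' (index 0) (index 1))) \<sigma>3 1
        (\<lambda>\<sigma>'. sim (\<rho>(0 := i, 1 := j)) (?p i (Suc j)) \<sigma>' \<and> \<sigma>' ''T'' (d + 1) 0 = \<sigma>3 ''T'' (d + 1) 0 \<and>
           (?J ?n \<sigma>' \<and> \<sigma>' ''T'' d 0 = \<sigma>2 ''T'' d 0))"
        apply (intro runs_Assign)
        unfolding aval.simps I
        using j i x by (auto simp: upd_same upd_other reserved_def)
    qed (use i x in \<open>auto simp: upd_same upd_other\<close>)
    moreover have "?p i ?n = ?p (Suc i) 0"
      by (rule ext)+ (auto simp: less_Suc_eq)
    ultimately show "runs (loop 1 (d + 1) (Assign x (index 0) (index 1) (Entry ''Y'' (index 0) (index 1)))) \<sigma>2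
       (?n * (1 + 2) + 4) (\<lambda>\<sigma>'. sim (\<rho>(0 := i)) (?p (Suc i) 0) \<sigma>' \<and> \<sigma>' ''T'' d 0 = \<sigma>2 ''T'' d 0 \<and> ?J ?n \<sigma>')"
      by (auto elim!: runs_mono)
  qed (use s1 x in \<open>auto simp: upd_same upd_other\<close>)
  have "runs (compile (Fill x e) d) \<sigma>
     ((?n * ((?n * ((?b + 1) + 2) + 4) + 2) + 4) + (?n * ((?n * (1 + 2) + 4) + 2) + 4)) (\<lambda>\<sigma>'. sim \<rho> (?p ?n 0) \<sigma>' \<and> ?J ?n \<sigma>')"
    unfolding compile.simps by (rule runs_Seq[OF 1 2])
  moreover have p: "?p ?n 0 = run (Fill x e) \<rho> s"
    by (rule ext)+ auto
  ultimately have "runs (compile (Fill x e) d) \<sigma>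
     ((?n * ((?n * ((?b + 1) + 2) + 4) + 2) + 4) + (?n * ((?n * (1 + 2) + 4) + 2) + 4))
     (\<lambda>\<sigma>'. sim \<rho> (run (Fill x e) \<rho> s) \<sigma>' \<and> ?J ?n \<sigma>')"
    by (simp only:)
  then show ?case by (rule runs_mono) (simp add: algebra_simps, blast)
next
  case (Then c1 c2)
  have "runs (compile (c1 ;; c2) d) \<sigma> (poly (cost c1) (size_of s) + poly (cost c2) (size_of s))
    (\<lambda>\<sigma>'. sim \<rho> (run c2 \<rho> (run c1 \<rho> s)) \<sigma>' \<and> (\<forall>j<d. \<sigma>' ''T'' j 0 = \<sigma> ''T'' j 0))"
    unfolding compile.simps
  proof (rule runs_Seq[OF Then.IH(1)[where s = s and \<rho> = \<rho>]])
    fix \<sigma>1 assume *: "sim \<rho> (run c1 \<rho> s) \<sigma>1 \<and> (\<forall>j<d. \<sigma>1 ''T'' j 0 = \<sigma> ''T'' j 0)"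
    have "runs (compile c2 d) \<sigma>1 (poly (cost c2) (size_of (run c1 \<rho> s)))
     (\<lambda>\<sigma>'. sim \<rho> (run c2 \<rho> (run c1 \<rho> s)) \<sigma>' \<and> (\<forall>j<d. \<sigma>' ''T'' j 0 = \<sigma>1 ''T'' j 0))"
      by (rule Then.IH(2)) (use Then.prems * in auto)
    then show "runs (compile c2 d) \<sigma>1 (poly (cost c2) (size_of s))
     (\<lambda>\<sigma>'. sim \<rho> (run c2 \<rho> (run c1 \<rho> s)) \<sigma>' \<and> (\<forall>j<d. \<sigma>' ''T'' j 0 = \<sigma> ''T'' j 0))"
      by (rule runs_mono) (use * Then.prems size_of_run in auto)
  qed (use Then.prems in auto)
  then show ?case by simp
next
  case (For m c)
  let ?st = "\<lambda>i. fold (\<lambda>i. run c (\<rho>(m := i))) [0..<i] s"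
  have size: "size_of (?st i) = size_of s" for i
    using size_of_run For.prems by (induction i) auto
  have "runs (loop m d (compile c (d + 1))) \<sigma> (size_of s * (poly (cost c) (size_of s) + 2) + 4)
     (\<lambda>\<sigma>'. sim \<rho> (?st (size_of s)) \<sigma>' \<and> (\<forall>j<d. \<sigma>' ''T'' j 0 = \<sigma> ''T'' j 0))"
  proof (rule runs_loop[where J = "\<lambda>_ \<sigma>'. \<forall>j<d. \<sigma>' ''T'' j 0 = \<sigma> ''T'' j 0" and st = ?st])
    fix i \<sigma>1 assume *: "sim (\<rho>(m := i)) (?st i) \<sigma>1" "\<forall>j<d. \<sigma>1 ''T'' j 0 = \<sigma> ''T'' j 0"
    have "runs (compile c (d + 1)) \<sigma>1 (poly (cost c) (size_of (?st i)))
      (\<lambda>\<sigma>'. sim (\<rho>(m := i)) (run c (\<rho>(m := i)) (?st i)) \<sigma>' \<and> (\<forall>j<d + 1. \<sigma>' ''T'' j 0 = \<sigma>1 ''T'' j 0))"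
      by (rule For.IH) (use For.prems * in \<open>auto simp: fun_upd_def\<close>)
    then show "runs (compile c (d + 1)) \<sigma>1 (poly (cost c) (size_of s))
      (\<lambda>\<sigma>'. sim (\<rho>(m := i)) (?st (Suc i)) \<sigma>' \<and> \<sigma>' ''T'' d 0 = \<sigma>1 ''T'' d 0 \<and> (\<forall>j<d. \<sigma>' ''T'' j 0 = \<sigma> ''T'' j 0))"
      by (rule runs_mono) (use * size in auto)
  qed (use For.prems size in \<open>auto simp: upd_same upd_other\<close>)
  then show ?case by (auto simp: algebra_simps)
qed

section \<open>Distances and light subgraphs\<close>

text \<open>Stretch is argued through \<open>near\<close> rather than through distances: it
  composes, is monotone in the relation, and needs no value for unreachable targets.\<close>

definition near :: "(nat \<times> nat) set \<Rightarrow> nat \<Rightarrow> nat \<Rightarrow> nat \<Rightarrow> bool" where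
  "near R m i j \<longleftrightarrow> (\<exists>l\<le>m. (i, j) \<in> R ^^ l)"

text \<open>Nodes are numbers below \<open>n\<close>; \<open>n\<close> itself stands for an infinite distance.\<close>

definition dst :: "nat \<Rightarrow> (nat \<times> nat) set \<Rightarrow> nat \<Rightarrow> nat \<Rightarrow> nat" where
  "dst n R i j = (if \<exists>m. (i, j) \<in> R ^^ m then LEAST m. (i, j) \<in> R ^^ m else n)"

lemma near_refl: "near R m i i"
  unfolding near_def by (intro exI[of _ 0]) auto

lemma near_zero: "near R 0 i j \<longleftrightarrow> i = j"
  unfolding near_def by auto

lemma near_edge: "(i, j) \<in> R \<Longrightarrow> near R 1 i j"
  unfolding near_def by (intro exI[of _ 1]) auto

lemma near_mono: "near R m i j \<Longrightarrow> m \<le> m' \<Longrightarrow> near R m' i j"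
  unfolding near_def by (meson order_trans)

lemma relpow_subset: "R \<subseteq> R' \<Longrightarrow> R ^^ m \<subseteq> R' ^^ m" for R R' :: "'b rel"
  by (induction m) auto

lemma near_subset: "near R m i j \<Longrightarrow> R \<subseteq> R' \<Longrightarrow> near R' m i j"
  unfolding near_def using relpow_subset by blast

lemma near_trans: "near R l i j \<Longrightarrow> near R m j k \<Longrightarrow> near R (l + m) i k"
  unfolding near_def by (meson add_mono relpow_trans)

lemma sym_relpow: "sym R \<Longrightarrow> sym (R ^^ m)"
proof (induction m)
  case (Suc m)
  then show ?case
    by (metis converse_relcomp relpow.simps(2) relpow_commute sym_conv_converse_eq)
qed (auto simp: sym_def)

lemma near_sym: "sym R \<Longrightarrow> near R m i j \<Longrightarrow> near R m j i"
  unfolding near_def using sym_relpow by (meson symD)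

lemma near_chain:
  assumes "\<And>b. a \<le> b \<Longrightarrow> b < c \<Longrightarrow> (f b, f (Suc b)) \<in> R" and "a \<le> c"
  shows "near R (c - a) (f a) (f c)"
  using assms
proof (induction "c - a" arbitrary: c)
  case 0
  then show ?case by (simp add: near_refl)
next
  case (Suc l)
  then obtain c' where c: "c = Suc c'" "a \<le> c'" by (cases c) auto
  have "near R (c' - a) (f a) (f c')" using Suc c by auto
  moreover have "near R 1 (f c') (f c)" using Suc.prems(1)[of c'] c by (auto intro: near_edge[simplified])
  ultimately show ?case using near_trans c by fastforce
qed

text \<open>A shortest walk repeats no node and so has fewer than \<open>n\<close> edges. This frees
  the value \<open>n\<close> to mean infinity.\<close>

lemma relpow_Least_less:
  assumes R: "R \<subseteq> {..<n} \<times> {..<n}" and i: "i < n" and m: "(i, j) \<in> R ^^ m"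
  shows "(LEAST m. (i, j) \<in> R ^^ m) < n"
proof -
  let ?m = "LEAST m. (i, j) \<in> R ^^ m"
  have "(i, j) \<in> R ^^ ?m" using m by (rule LeastI)
  then obtain f where f: "f 0 = i" "f ?m = j" "\<forall>l<?m. (f l, f (Suc l)) \<in> R"
    unfolding relpow_fun_conv by blast
  have walk: "(f a, f b) \<in> R ^^ (b - a)" if "a \<le> b" "b \<le> ?m" for a b
    unfolding relpow_fun_conv using that f(3)
    by (intro exI[of _ "\<lambda>l. f (a + l)"]) auto
  have "inj_on f {..?m}"
  proof (rule linorder_inj_onI)
    fix a b assume ab: "a < b" "a \<in> {..?m}" "b \<in> {..?m}"
    show "f a \<noteq> f b"
    proof
      assume eq: "f a = f b"
      have "(i, f a) \<in> R ^^ a" using walk[of 0 a] ab f(1) by auto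
      moreover have "(f a, j) \<in> R ^^ (?m - b)" using walk[of b ?m] ab f(2) eq by auto
      ultimately have "(i, j) \<in> R ^^ (a + (?m - b))" by (rule relpow_trans)
      then have "?m \<le> a + (?m - b)" by (rule Least_le)
      with ab show False by auto
    qed
  qed auto
  moreover have "f ` {..?m} \<subseteq> {..<n}"
  proof
    fix y assume "y \<in> f ` {..?m}"
    then obtain l where l: "l \<le> ?m" "y = f l" by auto
    show "y \<in> {..<n}"
    proof (cases l)
      case 0 with l f(1) i show ?thesis by simp
    next
      case (Suc l')
      with l have "(f l', y) \<in> R" using f(3) by auto
      with R show ?thesis by auto
    qed
  qed
  ultimately have "card {..?m} \<le> card {..<n}" by (metis card_inj_on_le finite_lessThan)
  then show ?thesis by simp
qed

lemma dst_le: "R \<subseteq> {..<n} \<times> {..<n} \<Longrightarrow> i < n \<Longrightarrow> dst n R i j \<le> n"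
  unfolding dst_def using relpow_Least_less[of R n i j] by (auto intro: less_imp_le)

text \<open>The conjunct \<open>dst n R i j < n\<close> excludes the infinite value, which would
  pass the first test as soon as \<open>n \<le> m\<close>.\<close>

lemma dst_le_iff:
  assumes "R \<subseteq> {..<n} \<times> {..<n}" and "i < n"
  shows "dst n R i j \<le> m \<and> dst n R i j < n \<longleftrightarrow> near R m i j"
proof
  assume *: "dst n R i j \<le> m \<and> dst n R i j < n"
  then have "\<exists>m. (i, j) \<in> R ^^ m" unfolding dst_def by (auto split: if_splits)
  then have "(i, j) \<in> R ^^ dst n R i j" unfolding dst_def by (auto intro: LeastI)
  with * show "near R m i j" unfolding near_def by blast
next
  assume "near R m i j"
  then obtain l where l: "l \<le> m" "(i, j) \<in> R ^^ l" unfolding near_def by blast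
  then have "dst n R i j = (LEAST m. (i, j) \<in> R ^^ m)" unfolding dst_def by auto
  with l show "dst n R i j \<le> m \<and> dst n R i j < n"
    using relpow_Least_less[OF assms l(2)] Least_le[of "\<lambda>m. (i, j) \<in> R ^^ m", OF l(2)] by linarith
qed

section \<open>Double counting and the decay recursion\<close>

lemma sum_card_swap:
  assumes "finite M" and "finite U" and "\<And>a. a \<in> M \<Longrightarrow> B a \<subseteq> U"
  shows "(\<Sum>a\<in>M. card (B a) * r a) = (\<Sum>c\<in>U. \<Sum>a\<in>{a \<in> M. c \<in> B a}. r a)"
proof -
  have "(\<Sum>a\<in>M. card (B a) * r a) = (\<Sum>a\<in>M. \<Sum>c\<in>U. if c \<in> B a then r a else 0)"
    by (intro sum.cong) (use assms in \<open>auto simp: sum.If_cases Int_absorb1\<close>)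
  also have "\<dots> = (\<Sum>c\<in>U. \<Sum>a\<in>M. if c \<in> B a then r a else 0)" by (rule sum.swap)
  also have "\<dots> = (\<Sum>c\<in>U. \<Sum>a\<in>{a \<in> M. c \<in> B a}. r a)"
    using assms(1) by (simp only: sum.inter_filter)
  finally show ?thesis .
qed

text \<open>
  \<open>M\<close> is the set of missing edges on one side of a path, \<open>B a\<close> the set of centres that hit it at \<open>a\<close>, and
  \<open>Q\<close> the order in which edges are cut off; hence the sum over \<open>M\<close> of the cut-off parts is quadratic.
\<close>

lemma total_gain:
  fixes K :: "'c \<Rightarrow> nat"
  assumes M: "finite M" and U: "finite U"
    and B: "\<And>a. a \<in> M \<Longrightarrow> B a \<subseteq> U" "\<And>a. a \<in> M \<Longrightarrow> d \<le> card (B a)"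
    and overlap: "\<And>c. card {a \<in> M. c \<in> B a} \<le> 3"
    and total: "\<And>a b. Q a b \<or> Q b a"
    and gain: "\<And>a c. a \<in> M \<Longrightarrow> c \<in> B a \<Longrightarrow> card {b \<in> M. Q a b} \<le> K c"
  shows "d * (card M)\<^sup>2 \<le> 6 * (\<Sum>c\<in>U. K c)"
proof -
  let ?r = "\<lambda>a. card {b \<in> M. Q a b}"
  have r: "?r a = (\<Sum>b\<in>M. if Q a b then 1 else 0)" for a
    using M by (simp add: sum.If_cases Int_def)
  have "(card M)\<^sup>2 = (\<Sum>a\<in>M. \<Sum>b\<in>M. 1)" by (simp add: power2_eq_square)
  \<comment> \<open>By totality of \<open>Q\<close> each ordered pair of missing edges is counted
    from at least one side. This costs a factor 2, and \<open>overlap\<close> the factor 3 of the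
    final 6.\<close>
  also have "\<dots> \<le> (\<Sum>a\<in>M. \<Sum>b\<in>M. (if Q a b then 1 else 0) + (if Q b a then 1 else 0))"
    by (intro sum_mono) (use total in auto)
  also have "\<dots> = (\<Sum>a\<in>M. ?r a) + (\<Sum>a\<in>M. \<Sum>b\<in>M. if Q b a then 1 else 0)"
    unfolding r by (simp only: sum.distrib)
  also have "(\<Sum>a\<in>M. \<Sum>b\<in>M. if Q b a then 1 else 0) = (\<Sum>a\<in>M. ?r a)"
    unfolding r by (rule sum.swap)
  finally have 1: "(card M)\<^sup>2 \<le> 2 * (\<Sum>a\<in>M. ?r a)" by simp
  have "d * (\<Sum>a\<in>M. ?r a) \<le> (\<Sum>a\<in>M. card (B a) * ?r a)"
    unfolding sum_distrib_left by (intro sum_mono mult_right_mono) (use B in auto)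
  also have "\<dots> = (\<Sum>c\<in>U. \<Sum>a\<in>{a \<in> M. c \<in> B a}. ?r a)"
    using M U B(1) by (rule sum_card_swap)
  also have "\<dots> \<le> (\<Sum>c\<in>U. 3 * K c)"
  proof (intro sum_mono)
    fix c assume "c \<in> U"
    have "(\<Sum>a\<in>{a \<in> M. c \<in> B a}. ?r a) \<le> card {a \<in> M. c \<in> B a} * K c"
      using sum_bounded_above[of "{a \<in> M. c \<in> B a}" ?r "K c"] gain by simp
    also have "\<dots> \<le> 3 * K c" using overlap by simp
    finally show "(\<Sum>a\<in>{a \<in> M. c \<in> B a}. ?r a) \<le> 3 * K c" .
  qed
  also have "\<dots> = 3 * (\<Sum>c\<in>U. K c)" by (simp add: sum_distrib_left)
  finally have 2: "d * (\<Sum>a\<in>M. ?r a) \<le> 3 * (\<Sum>c\<in>U. K c)" .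
  have "d * (card M)\<^sup>2 \<le> d * (2 * (\<Sum>a\<in>M. ?r a))" using 1 by (rule mult_left_mono) simp
  also have "\<dots> \<le> 6 * (\<Sum>c\<in>U. K c)" using 2 by simp
  finally show ?thesis .
qed

lemma card_le_3:
  fixes T :: "nat set"
  assumes "finite T" and "\<And>a b. a \<in> T \<Longrightarrow> b \<in> T \<Longrightarrow> a \<le> b \<Longrightarrow> b - a \<le> 2"
  shows "card T \<le> 3"
proof (cases "T = {}")
  case False
  have "T \<subseteq> {Min T..Min T + 2}"
  proof
    fix b assume "b \<in> T"
    moreover have "Min T \<le> b" using assms(1) \<open>b \<in> T\<close> by simp
    ultimately show "b \<in> {Min T..Min T + 2}"
      using assms(2)[of "Min T" b] False assms(1) by auto
  qed
  then have "card T \<le> card {Min T..Min T + 2}" by (intro card_mono) auto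
  then show ?thesis by simp
qed simp

text \<open>The recursion \<open>y \<le> x - d x\<^sup>2 / K\<close> decays like \<open>K / (d r)\<close> in the step number \<open>r\<close>.\<close>

lemma decay_step:
  fixes d r x y K :: nat
  assumes "d * x\<^sup>2 \<le> K * (x - y)" and "y \<le> x" and "d * r * x \<le> K"
  shows "d * Suc r * y \<le> K"
proof (cases "K = 0 \<or> d = 0")
  case True
  then show ?thesis using assms by (auto simp: power2_eq_square)
next
  case False
  then have K: "real K > 0" and d: "real d > 0" by auto
  \<comment> \<open>Scaling by \<open>d / K\<close> turns the recursion into
    \<open>v \<le> u - u^2\<close> and the induction hypothesis into
    \<open>r u \<le> 1\<close>.\<close>
  define u where "u = real d * real x / real K"
  define v where "v = real d * real y / real K"
  have "real (d * x\<^sup>2) \<le> real (K * (x - y))" using assms(1) by (rule of_nat_mono)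
  then have "real d * (real x)\<^sup>2 \<le> real K * (real x - real y)" using assms(2) by (simp add: of_nat_diff)
  then have "real d * (real d * (real x)\<^sup>2) / (real K)\<^sup>2 \<le> real d * (real K * (real x - real y)) / (real K)\<^sup>2"
    using d by (intro divide_right_mono mult_left_mono) auto
  then have 1: "u\<^sup>2 \<le> u - v"
    using K unfolding u_def v_def by (simp add: field_simps power2_eq_square)
  have "real (d * r * x) \<le> real K" using assms(3) by (rule of_nat_mono)
  then have 2: "real r * u \<le> 1" using K unfolding u_def by (simp add: field_simps)
  have u0: "u \<ge> 0" unfolding u_def by simp
  have "u \<le> 1"
  proof -
    have "v \<ge> 0" unfolding v_def by simp
    then have "u * u \<le> u * 1" using 1 by (simp add: power2_eq_square)
    then show ?thesis using u0 by (cases "u = 0") (auto simp: mult_le_cancel_left)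
  qed
  \<comment> \<open>Both factors are nonnegative; expanding the product leaves exactly
    \<open>(r + 1) (u - u^2) \<le> 1\<close>.\<close>
  then have "0 \<le> (1 - real r * u) * (1 - u) + u\<^sup>2" using 2 by simp
  also have "\<dots> = 1 - (real r + 1) * (u - u\<^sup>2)" by (simp add: algebra_simps power2_eq_square)
  finally have "(real r + 1) * (u - u\<^sup>2) \<le> 1" by simp
  moreover have "(real r + 1) * v \<le> (real r + 1) * (u - u\<^sup>2)" using 1 by (intro mult_left_mono) auto
  ultimately have "(real r + 1) * v \<le> 1" by linarith
  then have "real (d * Suc r * y) \<le> real K" using K unfolding v_def by (simp add: field_simps)
  then show ?thesis by (simp only: of_nat_le_iff)
qed

text \<open>
  \<open>A\<close> is the reflexive closure of the kept edges and \<open>X u v\<close> the next hop from \<open>u\<close> towards \<open>v\<close>. Next hops at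
  the target and towards unreachable targets stay put, so that no path needs a case distinction.
\<close>

locale light_graph =
  fixes n :: nat and R :: "(nat \<times> nat) set" and X :: "nat \<Rightarrow> nat \<Rightarrow> nat"
    and A :: "nat \<Rightarrow> nat \<Rightarrow> bool" and d :: nat
  assumes R_sub: "R \<subseteq> {..<n} \<times> {..<n}" and R_sym: "sym R"
    and next_self: "v < n \<Longrightarrow> X v v = v"
    and next_step: "u < n \<Longrightarrow> v < n \<Longrightarrow> u \<noteq> v \<Longrightarrow> dst n R u v < n \<Longrightarrow>
      (u, X u v) \<in> R \<and> Suc (dst n R (X u v) v) = dst n R u v"
    and next_unreachable: "u < n \<Longrightarrow> v < n \<Longrightarrow> dst n R u v = n \<Longrightarrow> X u v = u"
    and A_less: "A i j \<Longrightarrow> i < n \<and> j < n"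
    and A_refl: "i < n \<Longrightarrow> A i i"
    and A_sym: "A i j \<Longrightarrow> A j i"
    and A_sub: "A i j \<Longrightarrow> i \<noteq> j \<Longrightarrow> (i, j) \<in> R"
    and A_deg: "(i, j) \<in> R \<Longrightarrow> \<not> A i j \<Longrightarrow> d \<le> card {c. A i c}"
    and A_card: "card {(i, j). A i j \<and> i \<noteq> j} \<le> 2 * n * d"
begin

section \<open>Distances and canonical shortest paths\<close>

abbreviation "D \<equiv> dst n R"

lemma D_le: "i < n \<Longrightarrow> D i j \<le> n"
  using dst_le R_sub by blast

lemma near_D: "i < n \<Longrightarrow> D i j < n \<Longrightarrow> near R (D i j) i j"
  using dst_le_iff[OF R_sub] by blast

lemma D_leI: "i < n \<Longrightarrow> near R m i j \<Longrightarrow> D i j \<le> m"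
  using dst_le_iff[OF R_sub] by blast

lemma D_lessI: "i < n \<Longrightarrow> near R m i j \<Longrightarrow> D i j < n"
  using dst_le_iff[OF R_sub] by blast

lemma D_self: "i < n \<Longrightarrow> D i i = 0"
  using D_leI[OF _ near_refl[of R 0]] by simp

lemma D_eq_0: "i < n \<Longrightarrow> D i j = 0 \<Longrightarrow> i = j"
  using near_D[of i j] by (auto simp: near_zero)

text \<open>The inequality survives infinite summands because no distance exceeds
  \<open>n\<close>.\<close>

lemma D_triangle: "i < n \<Longrightarrow> j < n \<Longrightarrow> D i k \<le> D i j + D j k"
proof (cases "D i j < n \<and> D j k < n")
  case True
  assume "i < n" "j < n"
  with True show ?thesis by (intro D_leI near_trans[OF near_D near_D]) auto
next
  case False
  assume "i < n" "j < n"
  with False show ?thesis using D_le[of i k] by auto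
qed

lemma D_sym: "i < n \<Longrightarrow> j < n \<Longrightarrow> D i j = D j i"
proof -
  have "D j i \<le> D i j" if "i < n" "j < n" for i j
  proof (cases "D i j < n")
    case True
    then show ?thesis using that by (intro D_leI near_sym[OF R_sym near_D]) auto
  next
    case False
    then show ?thesis using D_le[OF that(2), of i] by simp
  qed
  then show "i < n \<Longrightarrow> j < n \<Longrightarrow> D i j = D j i" by (simp add: antisym)
qed

lemma A_D: "A i j \<Longrightarrow> D i j \<le> 1"
  using A_sub[of i j] A_less[of i j] near_edge near_refl[of R 1] D_leI by (cases "i = j") blast+

text \<open>Follows next hops from \<open>s\<close> towards \<open>t\<close>. The walk is defined
  for all \<open>a\<close>: it rests at \<open>t\<close> after arrival, and at \<open>s\<close> if
  \<open>t\<close> is unreachable.\<close>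

definition q :: "nat \<Rightarrow> nat \<Rightarrow> nat \<Rightarrow> nat" where
  "q s t a = ((\<lambda>u. X u t) ^^ a) s"

lemma q_0: "q s t 0 = s" and q_Suc: "q s t (Suc a) = X (q s t a) t"
  by (simp_all add: q_def)

context
  fixes s t :: nat
  assumes st: "s < n" "t < n"
begin

lemma q_unreachable: "D s t = n \<Longrightarrow> q s t a = s"
  by (induction a) (use st next_unreachable in \<open>auto simp: q_0 q_Suc\<close>)

context
  assumes reach: "D s t < n"
begin

lemma q_dist: "a \<le> D s t \<Longrightarrow> q s t a < n \<and> D (q s t a) t = D s t - a"
proof (induction a)
  case 0
  then show ?case using st by (simp add: q_0)
next
  case (Suc a)
  then have IH: "q s t a < n" "D (q s t a) t = D s t - a" by auto
  then have "q s t a \<noteq> t" using D_self Suc.prems by auto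
  then have "(q s t a, X (q s t a) t) \<in> R \<and> Suc (D (X (q s t a) t) t) = D (q s t a) t"
    using next_step IH st reach by auto
  then show ?case using IH R_sub by (auto simp: q_Suc)
qed

lemma q_edge: "a < D s t \<Longrightarrow> (q s t a, q s t (Suc a)) \<in> R"
proof -
  assume a: "a < D s t"
  then have IH: "q s t a < n" "D (q s t a) t = D s t - a" using q_dist[of a] by auto
  then have "q s t a \<noteq> t" using D_self a by auto
  then show ?thesis using next_step[of "q s t a" t] IH st reach by (auto simp: q_Suc)
qed

lemma q_end: "D s t \<le> a \<Longrightarrow> q s t a = t"
proof (induction a rule: dec_induct)
  case base
  then show ?case using q_dist[of "D s t"] D_eq_0 by auto
next
  case (step a)
  then show ?case using next_self st by (simp add: q_Suc)
qed

lemma q_less_aux: "q s t a < n"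
  using q_dist[of a] q_end[of a] st by (cases "a \<le> D s t") auto

text \<open>The walk itself gives the upper bound; a shorter connection would contradict the
  distances of both nodes to \<open>t\<close>.\<close>

lemma q_D: "a \<le> b \<Longrightarrow> b \<le> D s t \<Longrightarrow> D (q s t a) (q s t b) = b - a"
proof (rule antisym)
  assume ab: "a \<le> b" "b \<le> D s t"
  show "D (q s t a) (q s t b) \<le> b - a"
    using ab q_edge by (intro D_leI near_chain q_less_aux) auto
  have "D (q s t a) t \<le> D (q s t a) (q s t b) + D (q s t b) t"
    by (intro D_triangle q_less_aux)
  then show "b - a \<le> D (q s t a) (q s t b)" using ab q_dist[of a] q_dist[of b] by auto
qed

end

lemma q_less: "q s t a < n"
  using q_less_aux q_unreachable[of a] st D_le[of s t] by (cases "D s t = n") auto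

end

definition miss :: "nat \<Rightarrow> nat \<Rightarrow> nat \<Rightarrow> bool" where
  "miss s t a \<longleftrightarrow> \<not> A (q s t a) (q s t (Suc a))"

definition hit :: "nat set \<Rightarrow> nat \<Rightarrow> bool" where
  "hit S x \<longleftrightarrow> (\<exists>c\<in>S. A c x)"

text \<open>Position \<open>a\<close> denotes the edge from node \<open>a\<close> to node
  \<open>a + 1\<close> of the path. Its tail must be unhit, while its head may already be the first
  hit node.\<close>

definition fwd :: "nat \<Rightarrow> nat \<Rightarrow> nat set \<Rightarrow> nat set" where
  "fwd s t S = {a. a < n \<and> miss s t a \<and> (\<forall>b\<le>a. \<not> hit S (q s t b))}"

text \<open>The mirror image: all nodes from the head of the edge on are unhit. Positions below
  \<open>n\<close> cover the whole path, as a finite distance is less than \<open>n\<close>.\<close>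

definition bwd :: "nat \<Rightarrow> nat \<Rightarrow> nat set \<Rightarrow> nat set" where
  "bwd s t S = {a. a < n \<and> miss s t a \<and> (\<forall>b<n. a < b \<longrightarrow> \<not> hit S (q s t b))}"

lemma fwd_finite: "finite (fwd s t S)" and bwd_finite: "finite (bwd s t S)"
  by (auto simp: fwd_def bwd_def)

lemma fwd_antimono: "fwd s t (insert c S) \<subseteq> fwd s t S"
  and bwd_antimono: "bwd s t (insert c S) \<subseteq> bwd s t S"
  by (auto simp: fwd_def bwd_def hit_def)

context
  fixes s t :: nat
  assumes st: "s < n" "t < n"
begin

text \<open>A walk that rests, at an unreachable start or after arrival, takes steps that
  \<open>A\<close> contains by reflexivity, so a missing step is a genuine edge of a shortest
  path.\<close>

lemma miss_less: assumes "miss s t a" shows "a < D s t" and "D s t < n"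
proof -
  show reach: "D s t < n"
    using assms q_unreachable[OF st] A_refl st D_le[of s t] by (force simp: miss_def)
  show "a < D s t"
    using assms q_end[OF st reach, of a] q_end[OF st reach, of "Suc a"] A_refl st
    by (force simp: miss_def)
qed

lemma miss_finite: "finite {a. miss s t a}"
  by (rule finite_subset[of _ "{..<D s t}"]) (use miss_less in auto)

lemma miss_edge: "miss s t a \<Longrightarrow> (q s t a, q s t (Suc a)) \<in> R"
  using q_edge[OF st] miss_less by blast

lemma miss_deg: "miss s t a \<Longrightarrow> d \<le> card {c. A (q s t a) c}"
  using miss_edge A_deg unfolding miss_def by blast

lemma miss_deg_Suc: "miss s t a \<Longrightarrow> d \<le> card {c. A (q s t (Suc a)) c}"
  using miss_edge A_deg A_sym R_sym unfolding miss_def by (meson symD)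

text \<open>A common kept neighbour joins the two path nodes by at most two edges, and the path is
  shortest. Hence a node is adjacent to at most three consecutive path nodes.\<close>

lemma close_on_path:
  assumes "D s t < n" "a \<le> b" "b \<le> D s t" "A (q s t a) c" "A (q s t b) c"
  shows "b - a \<le> 2"
proof -
  have "D (q s t a) (q s t b) \<le> D (q s t a) c + D c (q s t b)"
    using assms A_less by (intro D_triangle) auto
  also have "\<dots> \<le> 1 + 1" using A_D assms A_sym by (intro add_mono) auto
  finally show ?thesis using q_D[OF st] assms by auto
qed

lemma miss_overlap: "card {a \<in> {a. miss s t a}. c \<in> {c. A (q s t a) c}} \<le> 3"
proof (rule card_le_3)
  show "finite {a \<in> {a. miss s t a}. c \<in> {c. A (q s t a) c}}" using miss_finite by auto
qed (use close_on_path miss_less in \<open>auto simp: less_imp_le\<close>)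

lemma miss_overlap_Suc: "card {a \<in> {a. miss s t a}. c \<in> {c. A (q s t (Suc a)) c}} \<le> 3"
proof (rule card_le_3)
  show "finite {a \<in> {a. miss s t a}. c \<in> {c. A (q s t (Suc a)) c}}" using miss_finite by auto
  fix a b
  assume "a \<in> {a \<in> {a. miss s t a}. c \<in> {c. A (q s t (Suc a)) c}}"
    "b \<in> {a \<in> {a. miss s t a}. c \<in> {c. A (q s t (Suc a)) c}}" "a \<le> b"
  then show "b - a \<le> 2" using close_on_path[of "Suc a" "Suc b" c] miss_less[of b] by auto
qed

text \<open>Each of the at least \<open>d\<close> kept neighbours of the tail of edge
  \<open>a\<close> would, as a centre, remove all forward edges from \<open>a\<close> on.\<close>

lemma fwd_gain: "d * (card (fwd s t S))\<^sup>2 \<le> 6 * (\<Sum>c<n. card (fwd s t S) - card (fwd s t (insert c S)))"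
proof (rule total_gain[where B = "\<lambda>a. {c. A (q s t a) c}" and Q = "(\<le>)"])
  fix c
  have "card {a \<in> fwd s t S. c \<in> {c. A (q s t a) c}} \<le> card {a \<in> {a. miss s t a}. c \<in> {c. A (q s t a) c}}"
    using miss_finite by (intro card_mono) (auto simp: fwd_def)
  then show "card {a \<in> fwd s t S. c \<in> {c. A (q s t a) c}} \<le> 3" using miss_overlap by (rule order_trans)
next
  fix a c
  assume a: "a \<in> fwd s t S" "c \<in> {c. A (q s t a) c}"
  have "card {b \<in> fwd s t S. a \<le> b} \<le> card (fwd s t S - fwd s t (insert c S))"
    using a A_sym by (intro card_mono) (auto simp: fwd_finite fwd_def hit_def)
  then show "card {b \<in> fwd s t S. a \<le> b} \<le> card (fwd s t S) - card (fwd s t (insert c S))"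
    by (simp add: card_Diff_subset fwd_finite fwd_antimono)
qed (use miss_deg A_less fwd_finite in \<open>auto simp: fwd_def\<close>)

text \<open>Here the heads matter, because \<open>bwd\<close> looks at the nodes after an edge: a
  centre next to the head of \<open>a\<close> removes all backward edges up to
  \<open>a\<close>.\<close>

lemma bwd_gain: "d * (card (bwd s t S))\<^sup>2 \<le> 6 * (\<Sum>c<n. card (bwd s t S) - card (bwd s t (insert c S)))"
proof (rule total_gain[where B = "\<lambda>a. {c. A (q s t (Suc a)) c}" and Q = "(\<ge>)"])
  fix c
  have "card {a \<in> bwd s t S. c \<in> {c. A (q s t (Suc a)) c}} \<le> card {a \<in> {a. miss s t a}. c \<in> {c. A (q s t (Suc a)) c}}"
    using miss_finite by (intro card_mono) (auto simp: bwd_def)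
  then show "card {a \<in> bwd s t S. c \<in> {c. A (q s t (Suc a)) c}} \<le> 3" using miss_overlap_Suc by (rule order_trans)
next
  fix a c
  assume a: "a \<in> bwd s t S" "c \<in> {c. A (q s t (Suc a)) c}"
  \<comment> \<open>The hit occurs at the head, so its position has to lie in the range that
    \<open>bwd\<close> inspects.\<close>
  have "Suc a < n" using a(1) miss_less[of a] by (auto simp: bwd_def)
  then have "card {b \<in> bwd s t S. b \<le> a} \<le> card (bwd s t S - bwd s t (insert c S))"
    using a A_sym by (intro card_mono) (auto simp: bwd_finite bwd_def hit_def less_Suc_eq_le)
  then show "card {b \<in> bwd s t S. b \<le> a} \<le> card (bwd s t S) - card (bwd s t (insert c S))"
    by (simp add: card_Diff_subset bwd_finite bwd_antimono)
qed (use miss_deg_Suc A_less bwd_finite in \<open>auto simp: bwd_def\<close>)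

end

section \<open>Greedy choice of the centres\<close>

definition Phi :: "(nat \<times> nat) set \<Rightarrow> nat set \<Rightarrow> nat" where
  "Phi P S = (\<Sum>(s, t)\<in>P. card (fwd s t S) + card (bwd s t S))"

lemma Phi_antimono: "Phi P (insert c S) \<le> Phi P S"
  unfolding Phi_def
  using card_mono[OF fwd_finite fwd_antimono] card_mono[OF bwd_finite bwd_antimono]
  by (intro sum_mono) (auto intro!: add_mono)

text \<open>Cauchy-Schwarz against the constant 1, after
  \<open>(x + y)^2 \<le> 2 (x^2 + y^2)\<close>.\<close>

lemma square_sum_le:
  fixes f g :: "'b \<Rightarrow> nat"
  shows "(\<Sum>i\<in>I. f i + g i)\<^sup>2 \<le> 2 * card I * (\<Sum>i\<in>I. (f i)\<^sup>2 + (g i)\<^sup>2)"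
proof -
  have "(\<Sum>i\<in>I. real (f i + g i) * 1)\<^sup>2 \<le> (\<Sum>i\<in>I. (real (f i + g i))\<^sup>2) * (\<Sum>i\<in>I. 1\<^sup>2)"
    by (rule Cauchy_Schwarz_ineq_sum)
  also have "(\<Sum>i\<in>I. (real (f i + g i))\<^sup>2) \<le> (\<Sum>i\<in>I. 2 * ((real (f i))\<^sup>2 + (real (g i))\<^sup>2))"
  proof (intro sum_mono)
    fix i
    have "0 \<le> (real (f i) - real (g i))\<^sup>2" by simp
    then show "(real (f i + g i))\<^sup>2 \<le> 2 * ((real (f i))\<^sup>2 + (real (g i))\<^sup>2)"
      by (simp add: power2_eq_square algebra_simps)
  qed
  finally have "real ((\<Sum>i\<in>I. f i + g i)\<^sup>2) \<le> real (2 * card I * (\<Sum>i\<in>I. (f i)\<^sup>2 + (g i)\<^sup>2))"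
    by (simp add: sum_distrib_left mult.commute mult.assoc mult_right_mono)
  then show ?thesis by (simp only: of_nat_le_iff)
qed

text \<open>The gains of all \<open>n\<close> candidates are summed over all pairs, and the best
  candidate gains at least the average. The constant 12 is the 2 of \<open>square_sum_le\<close>
  times the 6 of \<open>total_gain\<close>.\<close>

lemma Phi_gain:
  assumes P: "P \<subseteq> {..<n} \<times> {..<n}"
    and best: "\<And>c. c < n \<Longrightarrow> Phi P (insert c0 S) \<le> Phi P (insert c S)"
  shows "d * (Phi P S)\<^sup>2 \<le> 12 * card P * n * (Phi P S - Phi P (insert c0 S))"
proof -
  let ?f = "\<lambda>p S. card (fwd (fst p) (snd p) S)" and ?g = "\<lambda>p S. card (bwd (fst p) (snd p) S)"
  have fle: "?f p (insert c S) \<le> ?f p S" and gle: "?g p (insert c S) \<le> ?g p S" for p c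
    by (intro card_mono fwd_finite fwd_antimono bwd_finite bwd_antimono)+
  have Phi: "Phi P S = (\<Sum>p\<in>P. ?f p S + ?g p S)" for S
    unfolding Phi_def by (simp add: case_prod_unfold)
  have "d * (Phi P S)\<^sup>2 \<le> d * (2 * card P * (\<Sum>p\<in>P. (?f p S)\<^sup>2 + (?g p S)\<^sup>2))"
    unfolding Phi by (intro mult_left_mono square_sum_le) simp
  also have "\<dots> = 2 * card P * (\<Sum>p\<in>P. d * (?f p S)\<^sup>2 + d * (?g p S)\<^sup>2)"
    by (simp add: sum_distrib_left algebra_simps)
  also have "\<dots> \<le> 2 * card P * (\<Sum>p\<in>P. 6 * (\<Sum>c<n. ?f p S - ?f p (insert c S)) + 6 * (\<Sum>c<n. ?g p S - ?g p (insert c S)))"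
    using P by (intro mult_left_mono sum_mono add_mono fwd_gain bwd_gain) auto
  also have "\<dots> = 12 * card P * (\<Sum>p\<in>P. \<Sum>c<n. (?f p S - ?f p (insert c S)) + (?g p S - ?g p (insert c S)))"
    by (simp add: sum_distrib_left sum.distrib algebra_simps)
  also have "(\<Sum>p\<in>P. \<Sum>c<n. (?f p S - ?f p (insert c S)) + (?g p S - ?g p (insert c S)))
      = (\<Sum>c<n. \<Sum>p\<in>P. (?f p S - ?f p (insert c S)) + (?g p S - ?g p (insert c S)))"
    by (rule sum.swap)
  also have "\<dots> = (\<Sum>c<n. Phi P S - Phi P (insert c S))"
  proof (intro sum.cong refl)
    fix c
    \<comment> \<open>Truncated subtraction may be exchanged with the sums because every single term
      decreases.\<close>
    have "(\<Sum>p\<in>P. (?f p S - ?f p (insert c S)) + (?g p S - ?g p (insert c S)))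
       = (\<Sum>p\<in>P. (?f p S + ?g p S) - (?f p (insert c S) + ?g p (insert c S)))"
    proof (intro sum.cong refl)
      fix p
      have "a' \<le> a \<Longrightarrow> b' \<le> b \<Longrightarrow> (a - a') + (b - b') = (a + b) - (a' + b')" for a a' b b' :: nat
        by arith
      from this[OF fle gle] show "(?f p S - ?f p (insert c S)) + (?g p S - ?g p (insert c S))
        = (?f p S + ?g p S) - (?f p (insert c S) + ?g p (insert c S))" .
    qed
    also have "\<dots> = Phi P S - Phi P (insert c S)"
      unfolding Phi by (rule sum_subtractf_nat) (rule add_mono[OF fle gle])
    finally show "(\<Sum>p\<in>P. (?f p S - ?f p (insert c S)) + (?g p S - ?g p (insert c S))) = Phi P S - Phi P (insert c S)" .
  qed
  also have "12 * card P * \<dots> \<le> 12 * card P * (\<Sum>c<n. Phi P S - Phi P (insert c0 S))"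
    using best by (intro mult_left_mono sum_mono diff_le_mono2) auto
  finally show ?thesis by simp
qed

text \<open>Iterates \<open>decay_step\<close> with \<open>K = 12 * card P * n\<close>. A centre may
  be chosen again, so the number of rounds only bounds the number of centres from above.\<close>

lemma Phi_decay:
  assumes P: "P \<subseteq> {..<n} \<times> {..<n}" and "Ss 0 = {}"
    and step: "\<And>r. r < m \<Longrightarrow> \<exists>c0<n. Ss (Suc r) = insert c0 (Ss r) \<and>
      (\<forall>c<n. Phi P (insert c0 (Ss r)) \<le> Phi P (insert c (Ss r)))"
  shows "d * m * Phi P (Ss m) \<le> 12 * card P * n \<and> card (Ss m) \<le> m \<and> Ss m \<subseteq> {..<n}"
proof -
  have "r \<le> m \<Longrightarrow> d * r * Phi P (Ss r) \<le> 12 * card P * n \<and> card (Ss r) \<le> r \<and> Ss r \<subseteq> {..<n}" for r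
  proof (induction r)
    case 0
    then show ?case using assms(2) by simp
  next
    case (Suc r)
    then obtain c0 where c0: "c0 < n" "Ss (Suc r) = insert c0 (Ss r)"
      "\<And>c. c < n \<Longrightarrow> Phi P (insert c0 (Ss r)) \<le> Phi P (insert c (Ss r))"
      using step[of r] by auto
    have "d * Suc r * Phi P (insert c0 (Ss r)) \<le> 12 * card P * n"
      using Suc Phi_gain[OF P c0(3)] Phi_antimono by (intro decay_step) auto
    moreover have "card (insert c0 (Ss r)) \<le> Suc r"
      using Suc card_insert_le_m1[of "Suc r" "Ss r" c0] by auto
    ultimately show ?case using Suc c0 by auto
  qed
  then show ?thesis by simp
qed

section \<open>The edge sets that are bought\<close>

definition base :: "(nat \<times> nat) set" where
  "base = {(i, j). A i j \<and> i \<noteq> j}"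

text \<open>Graphs are symmetric relations here, so both orientations are included; this is the
  source of the factors 2 in the counts.\<close>

definition pedges :: "nat \<Rightarrow> nat \<Rightarrow> nat set \<Rightarrow> (nat \<times> nat) set" where
  "pedges s t M = (\<lambda>a. (q s t a, q s t (Suc a))) ` M \<union> (\<lambda>a. (q s t (Suc a), q s t a)) ` M"

definition bought :: "(nat \<times> nat) set \<Rightarrow> nat set \<Rightarrow> (nat \<times> nat) set" where
  "bought P S = base \<union> (\<Union>(s, t)\<in>P. pedges s t (fwd s t S \<union> bwd s t S))"

text \<open>The test uses distances in the current \<open>H\<close>, so later pairs profit from
  earlier purchases. Only missing edges are added, the others being in \<open>base\<close>. The path
  leads into \<open>c1\<close>, hence all its steps are next hops towards \<open>c1\<close>.\<close>

definition add_path :: "nat set \<Rightarrow> nat \<Rightarrow> nat \<Rightarrow> nat \<Rightarrow> (nat \<times> nat) set \<Rightarrow> (nat \<times> nat) set" where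
  "add_path S \<beta> c1 c2 H =
     (if c1 \<in> S \<and> c2 \<in> S \<and> \<not> near H (D c2 c1 + \<beta>) c2 c1 then H \<union> pedges c2 c1 {a. miss c2 c1 a} else H)"

definition connect :: "nat set \<Rightarrow> nat \<Rightarrow> (nat \<times> nat) set \<Rightarrow> (nat \<times> nat) set" where
  "connect S \<beta> = fold (\<lambda>c1. fold (\<lambda>c2. add_path S \<beta> c1 c2) [0..<n]) [0..<n]"

definition host :: "(nat \<times> nat) set \<Rightarrow> bool" where
  "host H \<longleftrightarrow> base \<subseteq> H \<and> H \<subseteq> R \<and> sym H"

lemma R_finite: "finite R"
  using R_sub finite_subset by blast

lemma host_finite: "host H \<Longrightarrow> finite H"
  unfolding host_def using R_finite finite_subset by blast

lemma host_base: "host base"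
  unfolding host_def using A_sub A_sym by (auto simp: base_def sym_def)

lemma pedges_sub: "s < n \<Longrightarrow> t < n \<Longrightarrow> M \<subseteq> {a. miss s t a} \<Longrightarrow> pedges s t M \<subseteq> R"
proof -
  assume "s < n" "t < n" "M \<subseteq> {a. miss s t a}"
  then have "(q s t a, q s t (Suc a)) \<in> R" if "a \<in> M" for a using that miss_edge by blast
  then show ?thesis using R_sym unfolding pedges_def by (auto dest: symD)
qed

lemma pedges_sym: "sym (pedges s t M)"
  unfolding pedges_def by (auto simp: sym_def)

lemma card_pedges: "finite M \<Longrightarrow> card (pedges s t M) \<le> 2 * card M"
  unfolding pedges_def
  using card_Un_le[of "(\<lambda>a. (q s t a, q s t (Suc a))) ` M" "(\<lambda>a. (q s t (Suc a), q s t a)) ` M"]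
    card_image_le[of M "\<lambda>a. (q s t a, q s t (Suc a))"] card_image_le[of M "\<lambda>a. (q s t (Suc a), q s t a)"]
  by linarith

lemma host_Un: "host H \<Longrightarrow> H' \<subseteq> R \<Longrightarrow> sym H' \<Longrightarrow> host (H \<union> H')"
  unfolding host_def by (auto simp: sym_Un)

lemma host_bought: assumes "P \<subseteq> {..<n} \<times> {..<n}" shows "host (bought P S)"
proof -
  have "(\<Union>(s, t)\<in>P. pedges s t (fwd s t S \<union> bwd s t S)) \<subseteq> R"
  proof clarify
    fix x y s t assume "(s, t) \<in> P" "(x, y) \<in> pedges s t (fwd s t S \<union> bwd s t S)"
    moreover have "fwd s t S \<union> bwd s t S \<subseteq> {a. miss s t a}" by (auto simp: fwd_def bwd_def)
    ultimately show "(x, y) \<in> R" using pedges_sub[of s t] assms by blast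
  qed
  moreover have "sym (\<Union>(s, t)\<in>P. pedges s t (fwd s t S \<union> bwd s t S))"
    by (intro sym_UNION ballI) (auto simp: pedges_sym split: prod.split)
  ultimately show ?thesis unfolding bought_def by (intro host_Un host_base)
qed

lemma card_bought: assumes "finite P" shows "card (bought P S) \<le> 2 * n * d + 2 * Phi P S"
proof -
  have "card (bought P S) \<le> card base + card (\<Union>(s, t)\<in>P. pedges s t (fwd s t S \<union> bwd s t S))"
    unfolding bought_def by (rule card_Un_le)
  also have "card (\<Union>(s, t)\<in>P. pedges s t (fwd s t S \<union> bwd s t S))
      \<le> (\<Sum>(s, t)\<in>P. card (pedges s t (fwd s t S \<union> bwd s t S)))"
    using card_UN_le[OF assms, of "\<lambda>(s, t). pedges s t (fwd s t S \<union> bwd s t S)"]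
    by (simp add: case_prod_unfold)
  also have "\<dots> \<le> (\<Sum>(s, t)\<in>P. 2 * (card (fwd s t S) + card (bwd s t S)))"
  proof (intro sum_mono, clarify)
    fix s t
    have "card (pedges s t (fwd s t S \<union> bwd s t S)) \<le> 2 * card (fwd s t S \<union> bwd s t S)"
      by (intro card_pedges) (simp add: fwd_finite bwd_finite)
    also have "\<dots> \<le> 2 * (card (fwd s t S) + card (bwd s t S))"
      by (intro mult_left_mono card_Un_le) simp
    finally show "card (pedges s t (fwd s t S \<union> bwd s t S)) \<le> 2 * (card (fwd s t S) + card (bwd s t S))" .
  qed
  also have "\<dots> = 2 * Phi P S"
    unfolding Phi_def sum_distrib_left by (simp add: case_prod_unfold)
  finally show ?thesis using A_card unfolding base_def by simp
qed

lemma near_light: assumes "host H" "A u v" shows "near H 1 u v"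
proof (cases "u = v")
  case False
  then have "(u, v) \<in> H" using assms unfolding host_def base_def by auto
  then show ?thesis by (rule near_edge)
qed (simp add: near_refl)

lemma near_path:
  assumes st: "s < n" "t < n" "D s t < n" and H: "host H" and "i \<le> j" "j \<le> D s t"
    and bought: "\<And>a. i \<le> a \<Longrightarrow> a < j \<Longrightarrow> miss s t a \<Longrightarrow> (q s t a, q s t (Suc a)) \<in> H"
  shows "near H (j - i) (q s t i) (q s t j)"
proof (rule near_chain)
  fix b assume b: "i \<le> b" "b < j"
  show "(q s t b, q s t (Suc b)) \<in> H"
  proof (cases "miss s t b")
    case False
    \<comment> \<open>Because \<open>A\<close> is reflexive, a kept step lies in \<open>base\<close>
      only if its ends differ; they have distance 1.\<close>
    have "D (q s t b) (q s t (Suc b)) = 1" using q_D[OF st, of b "Suc b"] b assms by auto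
    then have "q s t b \<noteq> q s t (Suc b)" using D_self q_less[OF st(1,2)] by (metis zero_neq_one)
    then show ?thesis using H False unfolding host_def base_def miss_def by auto
  qed (use b bought in auto)
qed (use assms in auto)

section \<open>Linking the centres: stretch and cost\<close>

lemma add_path_mono: "H \<subseteq> add_path S \<beta> c1 c2 H"
  by (auto simp: add_path_def)

lemma host_add_path: "host H \<Longrightarrow> c1 < n \<Longrightarrow> c2 < n \<Longrightarrow> host (add_path S \<beta> c1 c2 H)"
  unfolding add_path_def by (simp add: host_Un pedges_sym pedges_sub)

lemma near_path_full:
  assumes "host H" "s < n" "t < n" "D s t < n" "pedges s t {a. miss s t a} \<subseteq> H" "i \<le> j" "j \<le> D s t"
  shows "near H (j - i) (q s t i) (q s t j)"
proof (rule near_path[OF assms(2-4,1,6,7)])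
  fix a assume "miss s t a"
  then have "(q s t a, q s t (Suc a)) \<in> pedges s t {a. miss s t a}" by (simp add: pedges_def)
  with assms(5) show "(q s t a, q s t (Suc a)) \<in> H" by blast
qed

lemma near_add_path:
  assumes H: "host H" and c: "c1 < n" "c2 < n" "c1 \<in> S" "c2 \<in> S" "D c2 c1 < n"
  shows "near (add_path S \<beta> c1 c2 H) (D c2 c1 + \<beta>) c2 c1"
proof (cases "near H (D c2 c1 + \<beta>) c2 c1")
  case True
  then show ?thesis by (rule near_subset) (rule add_path_mono)
next
  case False
  have "near (add_path S \<beta> c1 c2 H) (D c2 c1 - 0) (q c2 c1 0) (q c2 c1 (D c2 c1))"
  proof (rule near_path_full[OF host_add_path[OF H c(1,2)] c(2,1,5)])
    show "pedges c2 c1 {a. miss c2 c1 a} \<subseteq> add_path S \<beta> c1 c2 H"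
      unfolding add_path_def using False c(3,4) by auto
  qed simp_all
  then have "near (add_path S \<beta> c1 c2 H) (D c2 c1) c2 c1"
    using q_end[OF c(2,1,5) order_refl] by (simp add: q_0)
  then show ?thesis by (rule near_mono) simp
qed

lemma host_connect:
  assumes "host H"
  shows "host (connect S \<beta> H)"
  unfolding connect_def
proof (rule fold_invariant[where P = host and Q = "\<lambda>c. c < n"])
  fix c1 H assume "c1 < n" "host H"
  then show "host (fold (add_path S \<beta> c1) [0..<n] H)"
    using host_add_path by (intro fold_invariant[where P = host and Q = "\<lambda>c. c < n"]) auto
qed (use assms in auto)

lemma fold_mono: "(\<And>x H. H \<subseteq> f x H) \<Longrightarrow> H \<subseteq> fold f xs H"
proof (induction xs arbitrary: H)
  case (Cons x xs)
  then show ?case using order_trans[OF Cons.prems Cons.IH] by simp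
qed simp

lemma connect_mono: "H \<subseteq> connect S \<beta> H"
  unfolding connect_def by (intro fold_mono add_path_mono)

text \<open>\<open>I\<close> provides the precondition until it is the turn of \<open>x\<close>,
  which establishes \<open>G\<close>; every later step preserves it.\<close>

lemma fold_establishes:
  assumes "x \<in> set xs" and "I s" and "\<And>x s. x \<in> set xs \<Longrightarrow> I s \<Longrightarrow> I (f x s)"
    and "\<And>s. I s \<Longrightarrow> G (f x s)" and "\<And>y s. G s \<Longrightarrow> G (f y s)"
  shows "G (fold f xs s)"
  using assms(1-3)
proof (induction xs arbitrary: s)
  case (Cons y ys)
  have keep: "G s \<Longrightarrow> G (fold f ys s)" for s
    by (rule fold_invariant[where Q = "\<lambda>_. True"]) (use assms(5) in auto)
  show ?case
  proof (cases "x = y")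
    case True
    then show ?thesis using Cons.prems assms(4) keep by simp
  next
    case False
    then show ?thesis using Cons by simp
  qed
qed simp

lemma near_connect:
  assumes H: "host H" and c: "c1 < n" "c2 < n" "c1 \<in> S" "c2 \<in> S" "D c2 c1 < n"
  shows "near (connect S \<beta> H) (D c2 c1 + \<beta>) c2 c1"
  unfolding connect_def
proof (rule fold_establishes[where x = c1 and I = host and G = "\<lambda>H. near H (D c2 c1 + \<beta>) c2 c1"])
  fix H assume host: "host H"
  show "near (fold (add_path S \<beta> c1) [0..<n] H) (D c2 c1 + \<beta>) c2 c1"
  proof (rule fold_establishes[where x = c2 and I = host and G = "\<lambda>H. near H (D c2 c1 + \<beta>) c2 c1"])
    show "near (add_path S \<beta> c1 c2 H) (D c2 c1 + \<beta>) c2 c1" if "host H" for H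
      using that c by (rule near_add_path)
    show "near (add_path S \<beta> c1 c H) (D c2 c1 + \<beta>) c2 c1" if "near H (D c2 c1 + \<beta>) c2 c1" for c H
      using that by (rule near_subset) (rule add_path_mono)
  qed (use host c host_add_path in auto)
next
  fix c H assume "c \<in> set [0..<n]" "host H"
  then show "host (fold (add_path S \<beta> c) [0..<n] H)"
    using host_add_path by (intro fold_invariant[where P = host and Q = "\<lambda>c. c < n"]) auto
next
  fix c H assume "near H (D c2 c1 + \<beta>) c2 c1"
  then show "near (fold (add_path S \<beta> c) [0..<n] H) (D c2 c1 + \<beta>) c2 c1"
    by (rule near_subset) (intro fold_mono add_path_mono)
qed (use H c in auto)

text \<open>With \<open>x\<close> and \<open>y\<close> the first and last hit positions and
  \<open>L\<close> the distance, the outer parts of the path are bought. Their centres have distance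
  at most \<open>y - x + 2\<close>, so the route has length at most
  \<open>x + 1 + (y - x + 2 + \<beta>) + 1 + (L - y)\<close>.\<close>

lemma spanner_stretch:
  assumes P: "P \<subseteq> {..<n} \<times> {..<n}" and S: "S \<subseteq> {..<n}" and st: "(s, t) \<in> P" "D s t < n"
  shows "near (connect S \<beta> (bought P S)) (D s t + 4 + \<beta>) s t"
proof -
  let ?H = "connect S \<beta> (bought P S)" and ?q = "q s t" and ?L = "D s t"
  have s: "s < n" and t: "t < n" using P st by auto
  have H: "host ?H" using P by (intro host_connect host_bought)
  have sub: "bought P S \<subseteq> ?H" by (rule connect_mono)
  have fwd: "(?q a, ?q (Suc a)) \<in> ?H" if "a \<in> fwd s t S" for a
  proof -
    have "(?q a, ?q (Suc a)) \<in> pedges s t (fwd s t S \<union> bwd s t S)" using that by (simp add: pedges_def)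
    with st(1) sub show ?thesis unfolding bought_def by blast
  qed
  have bwd: "(?q a, ?q (Suc a)) \<in> ?H" if "a \<in> bwd s t S" for a
  proof -
    have "(?q a, ?q (Suc a)) \<in> pedges s t (fwd s t S \<union> bwd s t S)" using that by (simp add: pedges_def)
    with st(1) sub show ?thesis unfolding bought_def by blast
  qed
  have q0: "?q 0 = s" by (rule q_0)
  have qL: "?q ?L = t" using q_end s t st(2) by simp
  show ?thesis
  proof (cases "\<exists>b\<le>?L. hit S (?q b)")
    case False
    \<comment> \<open>Without any hit node, every missing edge of the path belongs to
      \<open>fwd\<close> and has been bought.\<close>
    have "near ?H (?L - 0) (?q 0) (?q ?L)"
      by (intro near_path s t st H fwd) (use False st(2) in \<open>auto simp: fwd_def\<close>)
    then show ?thesis using q0 qL by (auto intro: near_mono)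
  next
    case True
    let ?B = "{b. b \<le> ?L \<and> hit S (?q b)}"
    have fin: "finite ?B" and ne: "?B \<noteq> {}" using True by auto
    define x y where "x = Min ?B" and "y = Max ?B"
    have x: "x \<in> ?B" and y: "y \<in> ?B" unfolding x_def y_def by (intro Min_in Max_in fin ne)+
    have xmin: "\<not> hit S (?q b)" if "b < x" for b
      using that x Min_le[OF fin, of b] unfolding x_def by fastforce
    have ymax: "\<not> hit S (?q b)" if "y < b" "b \<le> ?L" for b
      using that Max_ge[OF fin, of b] unfolding y_def by fastforce
    have xy: "x \<le> y" using x Max_ge[OF fin] y_def by blast
    have 1: "near ?H (x - 0) (?q 0) (?q x)"
      by (intro near_path s t st H fwd) (use x xmin st(2) in \<open>auto simp: fwd_def\<close>)
    have 2: "near ?H (?L - y) (?q y) (?q ?L)"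
    proof (intro near_path s t st H bwd)
      fix a assume a: "y \<le> a" "a < ?L" "miss s t a"
      \<comment> \<open>\<open>bwd\<close> also inspects positions beyond the end of the path. They
        repeat \<open>t\<close>, which is unhit since \<open>y < ?L\<close>.\<close>
      have "\<not> hit S (?q b)" if "a < b" for b
      proof (cases "b \<le> ?L")
        case True
        then show ?thesis using ymax a that by auto
      next
        case False
        then have "?q b = ?q ?L" using q_end[OF s t st(2)] qL by simp
        then show ?thesis using ymax[of ?L] a by simp
      qed
      then show "a \<in> bwd s t S" using a st(2) by (auto simp: bwd_def)
    qed (use y in auto)
    obtain c2 where c2: "c2 \<in> S" "A c2 (?q x)" using x unfolding hit_def by auto
    obtain c1 where c1: "c1 \<in> S" "A c1 (?q y)" using y unfolding hit_def by auto
    have near_R: "near R 1 u v" if "A u v" for u v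
      using near_subset[OF near_light[OF host_base that]] host_base unfolding host_def by blast
    have qn: "?q b < n" for b using q_less s t by blast
    have "near R (1 + (y - x)) c2 (?q y)"
    proof (rule near_trans)
      show "near R 1 c2 (?q x)" by (rule near_R[OF c2(2)])
      show "near R (y - x) (?q x) (?q y)"
        using near_D[OF qn, of x "?q y"] q_D[OF s t st(2), of x y] xy y st(2) by auto
    qed
    moreover have "near R 1 (?q y) c1" by (rule near_R[OF A_sym[OF c1(2)]])
    ultimately have c: "near R (1 + (y - x) + 1) c2 c1" by (rule near_trans)
    have cn: "c1 < n" "c2 < n" using c1 c2 S by auto
    have D: "D c2 c1 \<le> y - x + 2" "D c2 c1 < n" using D_leI[OF cn(2) c] D_lessI[OF cn(2) c] by auto
    have 3: "near ?H (D c2 c1 + \<beta>) c2 c1"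
      by (intro near_connect host_bought P cn c1 c2 D)
    note hop = near_light[OF H]
    have "near ?H (x - 0 + (1 + ((D c2 c1 + \<beta>) + (1 + (?L - y))))) s t"
      using near_trans[OF 1 near_trans[OF hop[OF A_sym[OF c2(2)]] near_trans[OF 3 near_trans[OF hop[OF c1(2)] 2]]]]
      unfolding q0 qL .
    then show ?thesis by (rule near_mono) (use D xy y in auto)
  qed
qed

text \<open>A potential: for every node and centre, the additive error of their distance in
  \<open>H\<close>, capped at 3. A pair that \<open>H\<close> does not connect contributes
  3.\<close>

definition Psi :: "nat set \<Rightarrow> (nat \<times> nat) set \<Rightarrow> nat" where
  "Psi S H = (\<Sum>u<n. \<Sum>c\<in>S. card {j. j < 3 \<and> \<not> near H (D c u + j) c u})"

lemma Psi_le: "Psi S H \<le> 3 * n * card S"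
proof -
  have "card {j. j < 3 \<and> \<not> near H (D c u + j) c u} \<le> 3" for c u
    using card_mono[of "{..<3}" "{j. j < 3 \<and> \<not> near H (D c u + j) c u}"] by auto
  then have "(\<Sum>c\<in>S. card {j. j < 3 \<and> \<not> near H (D c u + j) c u}) \<le> card S * 3" for u
    using sum_bounded_above[of S "\<lambda>c. card {j. j < 3 \<and> \<not> near H (D c u + j) c u}" 3] by simp
  then have "Psi S H \<le> n * (card S * 3)"
    unfolding Psi_def
    using sum_bounded_above[of "{..<n}" "\<lambda>u. \<Sum>c\<in>S. card {j. j < 3 \<and> \<not> near H (D c u + j) c u}" "card S * 3"]
    by simp
  then show ?thesis by (simp add: mult_ac)
qed

lemma Psi_drop:
  assumes "S \<subseteq> {..<n}" and "H \<subseteq> H'" and U: "U \<subseteq> {..<n}"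
    and drop: "\<And>u. u \<in> U \<Longrightarrow> \<exists>c\<in>S. \<exists>j<3. \<not> near H (D c u + j) c u \<and> near H' (D c u + j) c u"
  shows "Psi S H' + card U \<le> Psi S H"
proof -
  let ?N = "\<lambda>H c u. {j. j < 3 \<and> \<not> near H (D c u + j) c u}"
  let ?g = "\<lambda>H u. \<Sum>c\<in>S. card (?N H c u)"
  have S: "finite S" using assms(1) finite_subset by blast
  have sub: "?N H' c u \<subseteq> ?N H c u" for c u using assms(2) near_subset by blast
  have le: "card (?N H' c u) \<le> card (?N H c u)" for c u
    using sub by (intro card_mono) auto
  have "?g H' u + (if u \<in> U then 1 else 0) \<le> ?g H u" for u
  proof (cases "u \<in> U")
    case True
    then obtain c j where c: "c \<in> S" "j < 3" "\<not> near H (D c u + j) c u" "near H' (D c u + j) c u"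
      using drop by blast
    then have "card (?N H' c u) < card (?N H c u)"
      using sub by (intro psubset_card_mono) auto
    then have "?g H' u < ?g H u"
      using c(1) S le by (intro sum_strict_mono_ex1) auto
    then show ?thesis using True by simp
  qed (auto intro: sum_mono le)
  then have "(\<Sum>u<n. ?g H' u + (if u \<in> U then 1 else 0)) \<le> (\<Sum>u<n. ?g H u)"
    by (intro sum_mono)
  moreover have "(\<Sum>u<n. if u \<in> U then 1 else 0) = card U"
    using U by (simp add: sum.If_cases Int_absorb1)
  ultimately show ?thesis unfolding Psi_def by (simp add: sum.distrib)
qed

text \<open>A purchase with missing positions \<open>M\<close> adds at most \<open>2 |M|\<close>
  ordered pairs. The tails of these edges have at least \<open>d\<close> kept neighbours each, no
  node occurs more than three times, so at least \<open>d |M| / 3\<close> nodes lie next to the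
  path. Each lowers \<open>Psi\<close>, which therefore pays with weight
  \<open>2 * 3 = 6\<close>.\<close>

lemma add_path_potential:
  assumes H: "host H" and S: "S \<subseteq> {..<n}" and cn: "c1 < n" "c2 < n"
  shows "d * card (add_path S 2 c1 c2 H) + 6 * Psi S (add_path S 2 c1 c2 H) \<le> d * card H + 6 * Psi S H"
proof (cases "c1 \<in> S \<and> c2 \<in> S \<and> \<not> near H (D c2 c1 + 2) c2 c1")
  case False
  then have "add_path S 2 c1 c2 H = H" unfolding add_path_def by auto
  then show ?thesis by simp
next
  case True
  let ?M = "{a. miss c2 c1 a}" and ?q = "q c2 c1" and ?L = "D c2 c1" and ?H' = "add_path S 2 c1 c2 H"
  let ?U = "\<Union>a\<in>?M. {u. A (?q a) u}"
  have H': "?H' = H \<union> pedges c2 c1 ?M" using True unfolding add_path_def by auto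
  have hostH': "host ?H'" using H cn by (intro host_add_path)
  have M: "finite ?M" using miss_finite cn by blast
  have U: "?U \<subseteq> {..<n}" using A_less by auto
  have "card ?H' \<le> card H + 2 * card ?M"
    unfolding H' using card_Un_le[of H "pedges c2 c1 ?M"] card_pedges[OF M, of c2 c1] by linarith
  moreover have "d * card ?M \<le> 3 * card ?U"
  proof -
    have "d * card ?M = (\<Sum>a\<in>?M. d)" by simp
    also have "\<dots> \<le> (\<Sum>a\<in>?M. card {u. A (?q a) u} * 1)"
      using miss_deg[OF cn(2,1)] by (intro sum_mono) auto
    also have "\<dots> = (\<Sum>u\<in>?U. \<Sum>a\<in>{a \<in> ?M. u \<in> {u. A (?q a) u}}. 1)"
      using M finite_subset[OF U] by (intro sum_card_swap) auto
    also have "\<dots> \<le> (\<Sum>u\<in>?U. 3)"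
      using miss_overlap[OF cn(2,1)] by (intro sum_mono) simp
    finally show ?thesis by simp
  qed
  moreover have "Psi S ?H' + card ?U \<le> Psi S H"
  proof (rule Psi_drop[OF S add_path_mono U])
    fix u assume "u \<in> ?U"
    then obtain a where a: "miss c2 c1 a" "A (?q a) u" by blast
    have L: "?L < n" "a < ?L" using miss_less[OF cn(2,1) a(1)] by auto
    have un: "u < n" and qn: "?q a < n" using A_less a by auto
    have hop: "near ?H' 1 (?q a) u"
      using hostH' a(2) by (rule near_light)
    have symH: "sym H" and symH': "sym ?H'" using H hostH' unfolding host_def by auto
    have qL: "?q ?L = c1" using q_end cn L by simp
    have Dq: "D c2 (?q a) = a" "D (?q a) c1 = ?L - a"
      using q_D[OF cn(2,1) L(1), of 0 a] q_D[OF cn(2,1) L(1), of a ?L] L by (auto simp: q_0 qL)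
    have to2: "near ?H' (a - 0 + 1) c2 u"
      using near_trans[OF near_path_full[OF hostH' cn(2,1) L(1), of 0 a] hop] L H' by (auto simp: q_0)
    have to1: "near ?H' (?L - a + 1) c1 u"
    proof -
      have "near ?H' (?L - a) (?q a) (?q ?L)"
        using near_path_full[OF hostH' cn(2,1) L(1), of a ?L] L H' by auto
      then have "near ?H' (?L - a) c1 (?q a)" using near_sym[OF symH'] qL by simp
      then show ?thesis using hop by (rule near_trans)
    qed
    have Du: "D c u \<le> D c (?q a) + 1" "D c (?q a) \<le> D c u + 1" if "c < n" for c
      using D_triangle[OF that qn, of u] D_triangle[OF that un, of "?q a"] A_D[OF a(2)] A_D[OF A_sym[OF a(2)]] by auto
    \<comment> \<open>Stepping from \<open>?q a\<close> to its neighbour \<open>u\<close> changes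
      the distance to \<open>c\<close> by at most 1, so the improved error level is 0, 1 or 2. This
      is why \<open>Psi\<close> caps at 3.\<close>
    have drop: "\<exists>c\<in>S. \<exists>j<3. \<not> near H (D c u + j) c u \<and> near ?H' (D c u + j) c u"
      if "c \<in> S" "c < n" "\<not> near H (D c (?q a) + 1) c u" "near ?H' (D c (?q a) + 1) c u" for c
      using Du[OF that(2)] that
      by (intro bexI[of _ c] exI[of _ "D c (?q a) + 1 - D c u"]) auto
    \<comment> \<open>Two old connections of these lengths would meet in \<open>u\<close> and join
      the centres with error 2, and nothing would have been bought.\<close>
    have "\<not> (near H (a + 1) c2 u \<and> near H (?L - a + 1) c1 u)"
    proof
      assume "near H (a + 1) c2 u \<and> near H (?L - a + 1) c1 u"
      then have "near H ((a + 1) + (?L - a + 1)) c2 c1" using near_trans near_sym[OF symH] by blast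
      then show False using True L by simp
    qed
    then show "\<exists>c\<in>S. \<exists>j<3. \<not> near H (D c u + j) c u \<and> near ?H' (D c u + j) c u"
      using drop[of c2] drop[of c1] True cn to1 to2 Dq D_sym[OF cn(1) qn] by auto
  qed
  ultimately have "d * card ?H' \<le> d * (card H + 2 * card ?M)" "d * card ?M \<le> 3 * card ?U"
    "Psi S ?H' + card ?U \<le> Psi S H" by auto
  then show ?thesis by (simp add: algebra_simps)
qed

text \<open>The factor 18 is the weight 6 times the initial bound \<open>3 n |S|\<close> on the
  potential.\<close>

lemma connect_2_card:
  assumes H: "host H" and S: "S \<subseteq> {..<n}"
  shows "d * card (connect S 2 H) \<le> d * card H + 18 * n * card S"
proof -
  let ?I = "\<lambda>H'. host H' \<and> d * card H' + 6 * Psi S H' \<le> d * card H + 6 * Psi S H"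
  have "?I (connect S 2 H)"
    unfolding connect_def
  proof (rule fold_invariant[where P = ?I and Q = "\<lambda>c. c < n"])
    fix c1 H1 assume "c1 < n" "?I H1"
    then show "?I (fold (add_path S 2 c1) [0..<n] H1)"
      using add_path_potential[OF _ S] host_add_path order_trans
      by (intro fold_invariant[where P = ?I and Q = "\<lambda>c. c < n"]) (auto, blast)
  qed (use H in auto)
  then show ?thesis using Psi_le[of S H] by linarith
qed

text \<open>All paths into one centre run along the same next hops, which form a tree: at most
  \<open>n\<close> edges per centre, in two orientations.\<close>

lemma connect_tree_card:
  assumes S: "S \<subseteq> {..<n}" and H: "finite H"
  shows "card (connect S \<beta> H) \<le> card H + 2 * n * card S"
proof -
  let ?T = "(\<lambda>(v, c). (v, X v c)) ` ({..<n} \<times> S) \<union> (\<lambda>(v, c). (X v c, v)) ` ({..<n} \<times> S)"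
  have fin: "finite S" using S finite_subset by blast
  have T: "pedges c2 c1 M \<subseteq> ?T" if "c1 \<in> S" "c1 < n" "c2 < n" for c1 c2 M
    using that q_less[of c2 c1] unfolding pedges_def q_Suc by force
  have step: "add_path S \<beta> c1 c2 H' \<subseteq> H \<union> ?T" if "c1 < n" "c2 < n" "H' \<subseteq> H \<union> ?T" for c1 c2 H'
    using that T[of c1 c2 "{a. miss c2 c1 a}"] unfolding add_path_def by (simp split: if_split) blast
  have "connect S \<beta> H \<subseteq> H \<union> ?T"
    unfolding connect_def
    by (intro fold_invariant[where P = "\<lambda>H'. H' \<subseteq> H \<union> ?T" and Q = "\<lambda>c. c < n"] step) auto
  then have "card (connect S \<beta> H) \<le> card (H \<union> ?T)"
    using H fin by (intro card_mono) auto
  also have "\<dots> \<le> card H + (card ({..<n} \<times> S) + card ({..<n} \<times> S))"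
    using fin by (intro order_trans[OF card_Un_le] add_mono order_refl card_image_le) auto
  finally show ?thesis by (simp add: card_cartesian_product)
qed

end

section \<open>The program\<close>

primrec writes :: "cmd \<Rightarrow> vname set" where
  "writes (Fill x e) = {x}"
| "writes (c ;; d) = writes c \<union> writes d"
| "writes (For m c) = writes c"

lemma run_frame: "x \<notin> writes c \<Longrightarrow> run c \<rho> s x = s x"
proof (induction c arbitrary: \<rho> s)
  case (For m c)
  have "fold (\<lambda>i. run c (\<rho>(m := i))) xs s x = s x" for xs
    using For by (induction xs arbitrary: s) auto
  then show ?case by simp
qed auto

lemma run_For_invariant:
  assumes "size_of s = n" and "J 0 s"
    and "\<And>i s. i < n \<Longrightarrow> J i s \<Longrightarrow> J (Suc i) (run c (\<rho>(m := i)) s)"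
  shows "J n (run (For m c) \<rho> s)"
proof -
  have "i \<le> n \<Longrightarrow> J i (fold (\<lambda>i. run c (\<rho>(m := i))) [0..<i] s)" for i
    by (induction i) (use assms in auto)
  then show ?thesis using assms(1) by simp
qed

section \<open>Derived expressions\<close>

definition LtE :: "exp \<Rightarrow> exp \<Rightarrow> exp" where "LtE a b = IfLt a b (Num 1) (Num 0)"
definition LeE :: "exp \<Rightarrow> exp \<Rightarrow> exp" where "LeE a b = IfLt b a (Num 0) (Num 1)"
definition IfE :: "exp \<Rightarrow> exp \<Rightarrow> exp \<Rightarrow> exp" where "IfE p a b = IfLt (Num 0) p a b"
definition NotE :: "exp \<Rightarrow> exp" where "NotE p = IfE p (Num 0) (Num 1)"
definition AndE :: "exp \<Rightarrow> exp \<Rightarrow> exp" where "AndE p q = IfE p (IfE q (Num 1) (Num 0)) (Num 0)"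
definition OrE :: "exp \<Rightarrow> exp \<Rightarrow> exp" where "OrE p q = IfE p (Num 1) (IfE q (Num 1) (Num 0))"
definition EqE :: "exp \<Rightarrow> exp \<Rightarrow> exp" where "EqE a b = AndE (LeE a b) (LeE b a)"
definition ExE :: "nat \<Rightarrow> exp \<Rightarrow> exp" where "ExE m p = LtE (Num 0) (Total m p)"
definition AllE :: "nat \<Rightarrow> exp \<Rightarrow> exp" where "AllE m p = NotE (ExE m (NotE p))"

lemma sum_pos_iff: "0 < (\<Sum>i<n. f i) \<longleftrightarrow> (\<exists>i<n. 0 < f i)" for f :: "nat \<Rightarrow> nat"
  by (metis finite_lessThan gr0I less_numeral_extra(3) lessThan_iff sum_eq_0_iff)

lemma eval_sugar [simp]:
  "eval (LtE a b) \<rho> s = of_bool (eval a \<rho> s < eval b \<rho> s)"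
  "eval (LeE a b) \<rho> s = of_bool (eval a \<rho> s \<le> eval b \<rho> s)"
  "eval (EqE a b) \<rho> s = of_bool (eval a \<rho> s = eval b \<rho> s)"
  "eval (IfE p a b) \<rho> s = (if 0 < eval p \<rho> s then eval a \<rho> s else eval b \<rho> s)"
  "eval (NotE p) \<rho> s = of_bool (eval p \<rho> s = 0)"
  "eval (AndE p q) \<rho> s = of_bool (0 < eval p \<rho> s \<and> 0 < eval q \<rho> s)"
  "eval (OrE p q) \<rho> s = of_bool (0 < eval p \<rho> s \<or> 0 < eval q \<rho> s)"
  "eval (ExE m p) \<rho> s = of_bool (\<exists>i<size_of s. 0 < eval p (\<rho>(m := i)) s)"
  "eval (AllE m p) \<rho> s = of_bool (\<forall>i<size_of s. 0 < eval p (\<rho>(m := i)) s)"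
  by (auto simp: LtE_def LeE_def EqE_def IfE_def NotE_def AndE_def OrE_def ExE_def AllE_def sum_pos_iff
      split: if_splits)

lemma reads_sugar [simp]:
  "reads (LtE a b) = reads a \<union> reads b"
  "reads (LeE a b) = reads a \<union> reads b"
  "reads (EqE a b) = reads a \<union> reads b"
  "reads (IfE p a b) = reads p \<union> reads a \<union> reads b"
  "reads (NotE p) = reads p"
  "reads (AndE p q) = reads p \<union> reads q"
  "reads (OrE p q) = reads p \<union> reads q"
  "reads (ExE m p) = reads p"
  "reads (AllE m p) = reads p"
  by (auto simp: LtE_def LeE_def EqE_def IfE_def NotE_def AndE_def OrE_def ExE_def AllE_def)

section \<open>The commands of the algorithm\<close>

abbreviation "nE \<equiv> At ''n'' (Num 0) (Num 0)"
abbreviation "kE \<equiv> At ''k'' (Num 0) (Num 0)"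
abbreviation "dE \<equiv> At ''d'' (Num 0) (Num 0)"

text \<open>\<open>UptoE m a b\<close> is \<open>(a + 1) * b\<close> whenever \<open>a < n\<close>; multiplication is not primitive.\<close>

definition UptoE :: "nat \<Rightarrow> exp \<Rightarrow> exp \<Rightarrow> exp" where
  "UptoE m a b = Total m (IfE (LeE (Idx m) a) b (Num 0))"

text \<open>Finds the integer root of the number of pairs by counting all \<open>e < n\<close> whose
  successor has a third or fourth power within that number. Nested sums replace
  multiplication.\<close>

definition root_cmd :: cmd where
  "root_cmd = Fill ''d'' (Total 2 (LeE
     (IfE (LtE kE (Num 2))
       (UptoE 3 (Idx 2) (UptoE 4 (Idx 2) (UptoE 5 (Idx 2) (Num 1))))
       (UptoE 3 (Idx 2) (UptoE 4 (Idx 2) (UptoE 5 (Idx 2) (UptoE 6 (Idx 2) (Num 1))))))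
     (Total 3 (Total 4 (At ''P'' (Idx 3) (Idx 4))))))"

text \<open>A node keeps the edges to its \<open>d\<close> smallest neighbours, and an edge survives
  if one of its ends keeps it.\<close>

definition light_cmd :: cmd where
  "light_cmd = Fill ''A'' (OrE (EqE (Idx 0) (Idx 1)) (AndE (At ''E'' (Idx 0) (Idx 1)) (OrE
     (LtE (Total 2 (AndE (LtE (Idx 2) (Idx 1)) (At ''E'' (Idx 0) (Idx 2)))) dE)
     (LtE (Total 2 (AndE (LtE (Idx 2) (Idx 0)) (At ''E'' (Idx 1) (Idx 2)))) dE))))"

text \<open>Searches from all nodes in parallel; round \<open>r\<close> discovers distance
  \<open>r + 1\<close>, and \<open>n\<close> marks what has not been reached.\<close>

definition bfs_cmd :: "vname \<Rightarrow> vname \<Rightarrow> cmd" where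
  "bfs_cmd x y =
     Fill y (IfE (EqE (Idx 0) (Idx 1)) (Num 0) nE) ;;
     For 6 (Fill y (IfE (LeE (At y (Idx 0) (Idx 1)) (Idx 6)) (At y (Idx 0) (Idx 1))
       (IfE (ExE 7 (AndE (At x (Idx 0) (Idx 7)) (LeE (At y (Idx 7) (Idx 1)) (Idx 6))))
         (Add (Idx 6) (Num 1)) nE)))"

definition closerE :: "nat \<Rightarrow> exp" where
  "closerE m = AndE (At ''E'' (Idx 0) (Idx m)) (EqE (Add (At ''D'' (Idx m) (Idx 1)) (Num 1)) (At ''D'' (Idx 0) (Idx 1)))"

text \<open>A minimum expressed as a sum: the least suitable neighbour equals the number of
  \<open>w\<close> with no suitable neighbour up to \<open>w\<close>.\<close>

definition next_cmd :: cmd where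
  "next_cmd = Fill ''X'' (IfE (ExE 2 (closerE 2))
     (Total 2 (AllE 3 (NotE (AndE (LeE (Idx 3) (Idx 2)) (closerE 3))))) (Idx 0))"

text \<open>The path runs from node \<open>Idx 2\<close> to node \<open>Idx 3\<close>; position \<open>Idx 4\<close> is the edge from
  \<open>Q (Idx 4)\<close> to the next hop.\<close>

definition path_cmd :: cmd where
  "path_cmd = Fill ''Q'' (Idx 2) ;;
     For 6 (Fill ''Q'' (IfE (LtE (Idx 6) (Idx 0)) (At ''X'' (At ''Q'' (Idx 0) (Idx 1)) (Idx 3)) (At ''Q'' (Idx 0) (Idx 1))))"

definition headE :: exp where "headE = At ''Q'' (Idx 4) (Num 0)"
definition tailE :: exp where "tailE = At ''X'' headE (Idx 3)"
definition missE :: exp where "missE = NotE (At ''A'' headE tailE)"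
definition hitE :: exp where
  "hitE = ExE 7 (AndE (At ''S'' (Idx 7) (Num 0)) (At ''A'' (Idx 7) (At ''Q'' (Idx 5) (Num 0))))"
text \<open>\<open>Idx 0\<close> acts as an additional centre, so row \<open>c\<close> of the score
  array rates the candidate \<open>c\<close> and all candidates are rated at once.\<close>

definition hit'E :: exp where
  "hit'E = OrE (At ''A'' (Idx 0) (At ''Q'' (Idx 5) (Num 0))) hitE"
definition fwdE :: "exp \<Rightarrow> exp" where
  "fwdE h = AndE missE (AllE 5 (NotE (AndE (LeE (Idx 5) (Idx 4)) h)))"
definition bwdE :: "exp \<Rightarrow> exp" where
  "bwdE h = AndE missE (AllE 5 (NotE (AndE (LtE (Idx 4) (Idx 5)) h)))"
definition edgeE :: exp where
  "edgeE = OrE (AndE (EqE headE (Idx 0)) (EqE tailE (Idx 1))) (AndE (EqE headE (Idx 1)) (EqE tailE (Idx 0)))"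

definition score_cmd :: cmd where
  "score_cmd = Fill ''Z'' (Num 0) ;;
     For 2 (For 3 (path_cmd ;; Fill ''Z'' (Add (At ''Z'' (Idx 0) (Idx 1))
       (IfE (At ''P'' (Idx 2) (Idx 3)) (Add (Total 4 (fwdE hit'E)) (Total 4 (bwdE hit'E))) (Num 0)))))"

text \<open>The number \<open>T\<close> of centres, \<open>d\<close> or \<open>d^2\<close>, written
  as a sum.\<close>

definition stepsE :: exp where
  "stepsE = Total 2 (IfE (LtE (Idx 2) dE) (IfE (LtE kE (Num 2)) (Num 1) dE) (Num 0))"

abbreviation "ZE a \<equiv> At ''Z'' a (Num 0)"

text \<open>The surrounding loop always makes \<open>n\<close> rounds, so rounds from
  \<open>T\<close> on must leave the set alone. Ties go to the smallest number, whence exactly one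
  candidate qualifies.\<close>

definition choose_cmd :: cmd where
  "choose_cmd = Fill ''S'' (OrE (At ''S'' (Idx 0) (Idx 1)) (AndE (LtE (Idx 8) stepsE)
     (AllE 2 (IfE (LtE (Idx 2) (Idx 0)) (LtE (ZE (Idx 0)) (ZE (Idx 2))) (LeE (ZE (Idx 0)) (ZE (Idx 2)))))))"

definition buy_cmd :: cmd where
  "buy_cmd = Fill ''H'' (AndE (At ''A'' (Idx 0) (Idx 1)) (NotE (EqE (Idx 0) (Idx 1)))) ;;
     For 2 (For 3 (path_cmd ;; Fill ''H'' (OrE (At ''H'' (Idx 0) (Idx 1))
       (AndE (At ''P'' (Idx 2) (Idx 3)) (ExE 4 (AndE (OrE (fwdE hitE) (bwdE hitE)) edgeE))))))"

definition farE :: exp where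
  "farE = OrE (LtE (Add (At ''D'' (Idx 2) (Idx 3)) (IfE (LtE kE (Num 2)) (Num 0) (Num 2))) (At ''B'' (Idx 2) (Idx 3)))
     (LeE nE (At ''B'' (Idx 2) (Idx 3)))"

definition connect_cmd :: cmd where
  "connect_cmd = For 3 (For 2 (bfs_cmd ''H'' ''B'' ;; path_cmd ;; Fill ''H'' (OrE (At ''H'' (Idx 0) (Idx 1))
     (AndE (AndE (At ''S'' (Idx 3) (Num 0)) (At ''S'' (Idx 2) (Num 0))) (AndE farE (ExE 4 (AndE missE edgeE)))))))"

definition spanner_cmd :: cmd where
  "spanner_cmd = root_cmd ;; light_cmd ;; bfs_cmd ''E'' ''D'' ;; next_cmd ;;
     For 8 (score_cmd ;; choose_cmd) ;; buy_cmd ;; connect_cmd"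

lemmas cmd_defs = root_cmd_def light_cmd_def bfs_cmd_def next_cmd_def path_cmd_def score_cmd_def
  choose_cmd_def buy_cmd_def connect_cmd_def spanner_cmd_def

lemmas exp_defs = UptoE_def closerE_def headE_def tailE_def missE_def hitE_def hit'E_def fwdE_def bwdE_def
  edgeE_def stepsE_def farE_def

lemma admissible_spanner_cmd: "admissible spanner_cmd"
  by (simp add: cmd_defs exp_defs reserved_def)

section \<open>Preprocessing: distances, roots, kept edges, next hops\<close>

definition rel :: "nat \<Rightarrow> (nat \<Rightarrow> nat \<Rightarrow> nat) \<Rightarrow> (nat \<times> nat) set" where
  "rel n M = {(i, j). i < n \<and> j < n \<and> 0 < M i j}"

lemma near_Suc: "near R (Suc r) i j \<longleftrightarrow> i = j \<or> (\<exists>w. (i, w) \<in> R \<and> near R r w j)"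
proof
  assume "near R (Suc r) i j"
  then obtain l where l: "l \<le> Suc r" "(i, j) \<in> R ^^ l" unfolding near_def by blast
  show "i = j \<or> (\<exists>w. (i, w) \<in> R \<and> near R r w j)"
  proof (cases l)
    case 0
    with l show ?thesis by simp
  next
    case (Suc l')
    with l obtain w where "(i, w) \<in> R" "(w, j) \<in> R ^^ l'" by (metis relpow_Suc_D2)
    then show ?thesis using l Suc unfolding near_def by auto
  qed
next
  assume "i = j \<or> (\<exists>w. (i, w) \<in> R \<and> near R r w j)"
  then show "near R (Suc r) i j"
    using near_refl near_trans[OF near_edge] by fastforce
qed

lemma run_bfs:
  assumes size: "size_of s = n" and xy: "x \<noteq> y" "x \<noteq> ''n''" "y \<noteq> ''n''" and ij: "i < n" "j < n"
  shows "run (bfs_cmd x y) \<rho> s y i j = dst n (rel n (s x)) i j"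
proof -
  let ?R = "rel n (s x)"
  have R: "?R \<subseteq> {..<n} \<times> {..<n}" by (auto simp: rel_def)
  let ?J = "\<lambda>r s'. size_of s' = n \<and> s' x = s x \<and>
     (\<forall>i<n. \<forall>j<n. s' y i j = (if near ?R r i j then dst n ?R i j else n))"
  have "?J n (run (bfs_cmd x y) \<rho> s)"
    unfolding bfs_cmd_def run.simps(2)
  proof (rule run_For_invariant[where J = ?J])
    show "size_of (run (Fill y (IfE (EqE (Idx 0) (Idx 1)) (Num 0) nE)) \<rho> s) = n"
      using size xy by simp
    have "dst n ?R i i = 0" if "i < n" for i
      using dst_le_iff[OF R that, of i 0] near_refl by auto
    then show "?J 0 (run (Fill y (IfE (EqE (Idx 0) (Idx 1)) (Num 0) nE)) \<rho> s)"
      using size xy by (auto simp: near_zero)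
  next
    fix r s'
    assume r: "r < n" and J: "?J r s'"
    have le: "s' y i j \<le> r \<longleftrightarrow> near ?R r i j" if "i < n" "j < n" for i j
      using J that r dst_le_iff[OF R that(1), of j r] by auto
    have step: "(if s' y i j \<le> r then s' y i j else if \<exists>w<n. 0 < s x i w \<and> s' y w j \<le> r then r + 1 else n)
      = (if near ?R (Suc r) i j then dst n ?R i j else n)" (is "?l = ?r") if ij: "i < n" "j < n" for i j
    proof (cases "near ?R r i j")
      case True
      moreover have "s' y i j = dst n ?R i j" using J ij True by simp
      ultimately show ?thesis using le[OF ij] near_mono[OF True, of "Suc r"] by simp
    next
      case False
      then have "i \<noteq> j" using near_refl by auto
      then have ex: "(\<exists>w<n. 0 < s x i w \<and> s' y w j \<le> r) \<longleftrightarrow> near ?R (Suc r) i j"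
        using le ij unfolding near_Suc by (auto simp: rel_def)
      have "near ?R (Suc r) i j \<Longrightarrow> dst n ?R i j = Suc r"
        using False dst_le_iff[OF R ij(1), of j r] dst_le_iff[OF R ij(1), of j "Suc r"] by auto
      then show ?thesis using ex False le[OF ij] by auto
    qed
    show "?J (Suc r) (run (Fill y (IfE (LeE (At y (Idx 0) (Idx 1)) (Idx 6)) (At y (Idx 0) (Idx 1))
       (IfE (ExE 7 (AndE (At x (Idx 0) (Idx 7)) (LeE (At y (Idx 7) (Idx 1)) (Idx 6))))
         (Add (Idx 6) (Num 1)) nE))) (\<rho>(6 := r)) s')"
      using xy by (simp add: J[THEN conjunct1] J[THEN conjunct2, THEN conjunct1] step[symmetric] cong: if_cong split del: if_split)
  qed
  then have "run (bfs_cmd x y) \<rho> s y i j = (if near ?R n i j then dst n ?R i j else n)"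
    using ij by blast
  \<comment> \<open>Since finite distances are below \<open>n\<close>, the \<open>n\<close> rounds
    find all of them.\<close>
  then show ?thesis
    using dst_le_iff[OF R ij(1), of j n] dst_le[OF R ij(1), of j] by auto
qed

lemma sum_of_bool_card: "(\<Sum>i<n. of_bool (Q i)) = card {i. i < n \<and> Q i}" for n :: nat
proof -
  have "(\<Sum>i<n. of_bool (Q i)) = (\<Sum>i\<in>{i. i < n \<and> Q i}. 1 :: nat)"
    by (intro sum.mono_neutral_cong_right) auto
  then show ?thesis by simp
qed

lemma eval_UptoE:
  assumes b: "\<And>\<rho>. \<rho> 2 < size_of s \<Longrightarrow> eval b \<rho> s = Suc (\<rho> 2) ^ l" and "\<rho> 2 < size_of s" and "m \<noteq> 2"
  shows "eval (UptoE m (Idx 2) b) \<rho> s = Suc (\<rho> 2) ^ Suc l"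
proof -
  let ?n = "size_of s"
  have "eval (UptoE m (Idx 2) b) \<rho> s = (\<Sum>i<?n. if i \<le> \<rho> 2 then Suc (\<rho> 2) ^ l else 0)"
    unfolding UptoE_def using assms by (auto intro!: sum.cong)
  also have "\<dots> = (\<Sum>i\<in>{..\<rho> 2}. Suc (\<rho> 2) ^ l)"
    using assms(2) by (intro sum.mono_neutral_cong_right) auto
  finally show ?thesis by simp
qed

definition iroot :: "nat \<Rightarrow> nat \<Rightarrow> nat \<Rightarrow> nat" where
  "iroot n m p = card {e. e < n \<and> Suc e ^ m \<le> p}"

lemma down_closed_eq:
  fixes T :: "nat set"
  assumes "finite T" and "\<And>e e'. e \<in> T \<Longrightarrow> e' < e \<Longrightarrow> e' \<in> T"
  shows "T = {..<card T}"
proof (cases "T = {}")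
  case False
  have "T = {..<Suc (Max T)}"
  proof
    show "T \<subseteq> {..<Suc (Max T)}" using assms(1) by (auto simp: less_Suc_eq_le)
    show "{..<Suc (Max T)} \<subseteq> T"
      using assms(2)[OF Max_in[OF assms(1) False]] Max_in[OF assms(1) False] by (auto simp: less_Suc_eq)
  qed
  then show ?thesis by (metis card_lessThan)
qed simp

text \<open>Counting only \<open>e < n\<close> does not truncate the root: by
  \<open>p \<le> n^2\<close> and \<open>m \<ge> 2\<close>, the power of \<open>n + 1\<close> already
  exceeds \<open>p\<close>.\<close>

lemma iroot_bounds:
  assumes "p \<le> n ^ 2" and "m \<ge> 2"
  shows "iroot n m p ^ m \<le> p" and "p < Suc (iroot n m p) ^ m" and "iroot n m p \<le> n"
proof -
  let ?T = "{e. e < n \<and> Suc e ^ m \<le> p}" and ?r = "iroot n m p"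
  have T: "?T = {..<?r}"
    unfolding iroot_def
  proof (rule down_closed_eq)
    fix e e' assume e: "e \<in> ?T" "e' < e"
    then have "Suc e' ^ m \<le> Suc e ^ m" by (intro power_mono) auto
    with e show "e' \<in> ?T" by auto
  qed auto
  show "?r ^ m \<le> p"
  proof (cases ?r)
    case 0
    then show ?thesis using assms(2) by (simp add: power_0_left)
  next
    case (Suc r)
    then have "r \<in> ?T" using T by auto
    then show ?thesis using Suc by simp
  qed
  have "?T \<subseteq> {..<n}" by auto
  then show le: "?r \<le> n" unfolding T by simp
  show "p < Suc ?r ^ m"
  proof (cases "?r = n")
    case True
    have "p \<le> n ^ 2" by (rule assms(1))
    also have "\<dots> < Suc n ^ 2" by (intro power_strict_mono) auto
    also have "\<dots> \<le> Suc n ^ m" using assms(2) by (intro power_increasing) auto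
    finally show ?thesis using True by simp
  next
    case False
    have "?r \<notin> ?T" unfolding T by simp
    with False le show ?thesis by auto
  qed
qed

definition input :: "nat \<Rightarrow> nat \<Rightarrow> (nat \<times> nat) set \<Rightarrow> (nat \<times> nat) set \<Rightarrow> store \<Rightarrow> bool" where
  "input n k R P s \<longleftrightarrow> size_of s = n \<and> s ''k'' 0 0 = k \<and>
     (\<forall>i<n. \<forall>j<n. s ''E'' i j = of_bool ((i, j) \<in> R) \<and> s ''P'' i j = of_bool ((i, j) \<in> P))"

lemma input_run: "input n k R P s \<Longrightarrow> writes c \<inter> {''n'', ''k'', ''E'', ''P''} = {} \<Longrightarrow> input n k R P (run c \<rho> s)"
  unfolding input_def by (simp add: run_frame)

lemma sum_pairs:
  assumes "P \<subseteq> {..<n} \<times> {..<n}"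
  shows "(\<Sum>i<n::nat. \<Sum>j<n::nat. if (i, j) \<in> P then f i j else (0::nat)) = (\<Sum>(i, j)\<in>P. f i j)"
proof -
  have "(\<Sum>i<n. \<Sum>j<n. if (i, j) \<in> P then f i j else 0)
      = (\<Sum>p\<in>{..<n} \<times> {..<n}. if p \<in> P then (\<lambda>(i, j). f i j) p else 0)"
    by (simp add: sum.cartesian_product) (auto intro!: sum.cong)
  also have "\<dots> = (\<Sum>p\<in>P. (\<lambda>(i, j). f i j) p)"
    using assms by (intro sum.mono_neutral_cong_right) auto
  finally show ?thesis .
qed

lemma run_root:
  assumes s: "input n k R P s" and P: "P \<subseteq> {..<n} \<times> {..<n}" and ij: "i < n" "j < n"
  shows "run root_cmd \<rho> s ''d'' i j = iroot n (if k < 2 then 3 else 4) (card P)"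
proof -
  let ?cube = "UptoE 4 (Idx 2) (UptoE 5 (Idx 2) (Num 1))"
  let ?m = "if k < 2 then 3 else 4 :: nat"
  have n: "size_of s = n" and k: "s ''k'' 0 0 = k" using s by (auto simp: input_def)
  have l1: "\<rho> 2 < size_of s \<Longrightarrow> eval (UptoE 5 (Idx 2) (Num 1)) \<rho> s = Suc (\<rho> 2) ^ Suc 0" for \<rho>
    by (rule eval_UptoE) auto
  have l2: "\<rho> 2 < size_of s \<Longrightarrow> eval ?cube \<rho> s = Suc (\<rho> 2) ^ Suc (Suc 0)" for \<rho>
    by (rule eval_UptoE[OF l1]) auto
  have l3: "\<rho> 2 < size_of s \<Longrightarrow> eval (UptoE 3 (Idx 2) ?cube) \<rho> s = Suc (\<rho> 2) ^ Suc (Suc (Suc 0))" for \<rho>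
    by (rule eval_UptoE[OF l2]) auto
  have q1: "\<rho> 2 < size_of s \<Longrightarrow> eval (UptoE 6 (Idx 2) (Num 1)) \<rho> s = Suc (\<rho> 2) ^ Suc 0" for \<rho>
    by (rule eval_UptoE) auto
  have q2: "\<rho> 2 < size_of s \<Longrightarrow> eval (UptoE 5 (Idx 2) (UptoE 6 (Idx 2) (Num 1))) \<rho> s = Suc (\<rho> 2) ^ Suc (Suc 0)" for \<rho>
    by (rule eval_UptoE[OF q1]) auto
  have q3: "\<rho> 2 < size_of s \<Longrightarrow>
      eval (UptoE 4 (Idx 2) (UptoE 5 (Idx 2) (UptoE 6 (Idx 2) (Num 1)))) \<rho> s = Suc (\<rho> 2) ^ Suc (Suc (Suc 0))" for \<rho>
    by (rule eval_UptoE[OF q2]) auto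
  have q4: "\<rho> 2 < size_of s \<Longrightarrow>
      eval (UptoE 3 (Idx 2) (UptoE 4 (Idx 2) (UptoE 5 (Idx 2) (UptoE 6 (Idx 2) (Num 1))))) \<rho> s
        = Suc (\<rho> 2) ^ Suc (Suc (Suc (Suc 0)))" for \<rho>
    by (rule eval_UptoE[OF q3]) auto
  have cnt: "eval (Total 3 (Total 4 (At ''P'' (Idx 3) (Idx 4)))) \<rho> s = card P" for \<rho>
  proof -
    have "eval (Total 3 (Total 4 (At ''P'' (Idx 3) (Idx 4)))) \<rho> s = (\<Sum>i<n. \<Sum>j<n. if (i, j) \<in> P then 1 else 0)"
      using s by (auto simp: input_def of_bool_def intro!: sum.cong)
    then show ?thesis by (simp add: sum_pairs[OF P])
  qed
  have pow: "eval (IfE (LtE kE (Num 2)) (UptoE 3 (Idx 2) ?cube)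
       (UptoE 3 (Idx 2) (UptoE 4 (Idx 2) (UptoE 5 (Idx 2) (UptoE 6 (Idx 2) (Num 1)))))) \<rho> s = Suc (\<rho> 2) ^ ?m"
    if "\<rho> 2 < n" for \<rho>
    using l3[of \<rho>] q4[of \<rho>] k n that by (simp add: numeral_eq_Suc)
  show ?thesis
    unfolding root_cmd_def
    using ij n pow cnt by (simp add: sum_of_bool_card iroot_def cong: conj_cong)
qed

definition rank :: "(nat \<times> nat) set \<Rightarrow> nat \<Rightarrow> nat \<Rightarrow> nat" where
  "rank R i j = card {w. w < j \<and> (i, w) \<in> R}"

definition light :: "nat \<Rightarrow> nat \<Rightarrow> (nat \<times> nat) set \<Rightarrow> nat \<Rightarrow> nat \<Rightarrow> bool" where
  "light n d R i j \<longleftrightarrow> i < n \<and> j < n \<and> (i = j \<or> (i, j) \<in> R \<and> (rank R i j < d \<or> rank R j i < d))"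

definition closer :: "nat \<Rightarrow> (nat \<times> nat) set \<Rightarrow> nat \<Rightarrow> nat \<Rightarrow> nat \<Rightarrow> bool" where
  "closer n R u v w \<longleftrightarrow> (u, w) \<in> R \<and> Suc (dst n R w v) = dst n R u v"

definition hop :: "nat \<Rightarrow> (nat \<times> nat) set \<Rightarrow> nat \<Rightarrow> nat \<Rightarrow> nat" where
  "hop n R u v = (if \<exists>w. closer n R u v w then LEAST w. closer n R u v w else u)"

lemma run_light:
  assumes s: "input n k R P s" and d: "s ''d'' 0 0 = d" and R: "R \<subseteq> {..<n} \<times> {..<n}" and ij: "i < n" "j < n"
  shows "run light_cmd \<rho> s ''A'' i j = of_bool (light n d R i j)"
proof -
  have n: "size_of s = n" and E: "\<And>i j. i < n \<Longrightarrow> j < n \<Longrightarrow> s ''E'' i j = of_bool ((i, j) \<in> R)"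
    using s by (auto simp: input_def)
  have rank: "(\<Sum>w<n. of_bool (w < b \<and> 0 < s ''E'' a w)) = rank R a b" if "a < n" "b < n" for a b
    unfolding sum_of_bool_card rank_def using E that by (intro arg_cong[where f = card]) auto
  show ?thesis
    unfolding light_cmd_def using ij n d E rank by (simp add: light_def)
qed

lemma light_rank_inj:
  assumes "R \<subseteq> {..<n} \<times> {..<n}"
  shows "inj_on (rank R i) {w. (i, w) \<in> R}"
proof (rule linorder_inj_onI)
  fix w w' assume w: "w < w'" "w \<in> {w. (i, w) \<in> R}"
  have "rank R i w < rank R i w'"
    unfolding rank_def using w by (intro psubset_card_mono) auto
  then show "rank R i w \<noteq> rank R i w'" by simp
qed auto

lemma light_graph_light:
  assumes R: "R \<subseteq> {..<n} \<times> {..<n}" and sym: "sym R"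
  shows "light_graph n R (hop n R) (light n d R) d"
proof
  have least: "closer n R u v (hop n R u v)" if "closer n R u v w" for u v w
  proof -
    have "closer n R u v (LEAST w. closer n R u v w)" using that by (rule LeastI)
    then show ?thesis using that unfolding hop_def by auto
  qed
  fix u v assume u: "u < n" and v: "v < n"
  {
    assume uv: "u \<noteq> v" "dst n R u v < n"
    have "near R (dst n R u v) u v" using dst_le_iff[OF R u] uv by blast
    moreover obtain m where m: "dst n R u v = Suc m"
      using dst_le_iff[OF R u, of v 0] uv by (cases "dst n R u v") (auto simp: near_zero)
    ultimately obtain w where w: "(u, w) \<in> R" "near R m w v" using uv(1) near_Suc[of R m u v] by auto
    have wn: "w < n" using w R by auto
    have "dst n R w v \<le> m" "dst n R w v < n" using dst_le_iff[OF R wn] w(2) by blast+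
    moreover have "near R (Suc (dst n R w v)) u v"
      using dst_le_iff[OF R wn, of v "dst n R w v"] calculation w(1) unfolding near_Suc by blast
    then have "Suc m \<le> Suc (dst n R w v)" using dst_le_iff[OF R u, of v "Suc (dst n R w v)"] m by simp
    ultimately have "closer n R u v w" using w m unfolding closer_def by simp
    then show "(u, hop n R u v) \<in> R \<and> Suc (dst n R (hop n R u v) v) = dst n R u v"
      using least closer_def by blast
  }
  assume far: "dst n R u v = n"
  have "\<not> closer n R u v w" for w
  proof
    assume w: "closer n R u v w"
    then have wn: "w < n" using R by (auto simp: closer_def)
    have "dst n R w v < n" using w far by (simp add: closer_def)
    then have "near R (dst n R w v) w v" using dst_le_iff[OF R wn] by blast
    then have "near R (Suc (dst n R w v)) u v" using w unfolding near_Suc closer_def by blast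
    then show False using dst_le_iff[OF R u, of v "Suc (dst n R w v)"] far by simp
  qed
  then show "hop n R u v = u" by (simp add: hop_def)
next
  fix v assume v: "v < n"
  have "dst n R v v = 0" using dst_le_iff[OF R v, of v 0] near_refl by auto
  then show "hop n R v v = v" by (simp add: hop_def closer_def)
next
  fix i j assume ij: "(i, j) \<in> R" "\<not> light n d R i j"
  let ?L = "{w. (i, w) \<in> R \<and> rank R i w < d}" and ?N = "{w. w < j \<and> (i, w) \<in> R}"
  have fin: "finite {w. (i, w) \<in> R}" by (rule finite_subset[of _ "{..<n}"]) (use R in auto)
  have rank: "d \<le> card ?N" using ij R by (auto simp: light_def rank_def)
  have "d \<le> card ?L"
  proof (rule ccontr)
    assume small: "\<not> d \<le> card ?L"
    then have "\<not> ?N \<subseteq> ?L" using rank card_mono[of ?L ?N] fin by fastforce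
    then obtain w1 where w1: "(i, w1) \<in> R \<and> \<not> rank R i w1 < d" by blast
    \<comment> \<open>The least neighbour of rank at least \<open>d\<close> has at least
      \<open>d\<close> smaller neighbours, and all of those have rank below
      \<open>d\<close>.\<close>
    define w where "w = (LEAST w. (i, w) \<in> R \<and> \<not> rank R i w < d)"
    have w: "(i, w) \<in> R \<and> \<not> rank R i w < d" unfolding w_def using w1 by (rule LeastI)
    have "{w'. w' < w \<and> (i, w') \<in> R} \<subseteq> ?L" unfolding w_def using not_less_Least by blast
    then have "rank R i w \<le> card ?L" unfolding rank_def using fin by (intro card_mono) auto
    with w small show False by simp
  qed
  also have "card ?L \<le> card {c. light n d R i c}"
    using R by (intro card_mono finite_subset[of "{c. light n d R i c}" "{..<n}"]) (auto simp: light_def)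
  finally show "d \<le> card {c. light n d R i c}" .
next
  let ?L = "\<lambda>i. {w. (i, w) \<in> R \<and> rank R i w < d}"
  have L: "card (?L i) \<le> d" for i
  proof -
    \<comment> \<open>Distinct neighbours have distinct ranks, so at most \<open>d\<close> of them
      have a rank below \<open>d\<close>.\<close>
    have "inj_on (rank R i) (?L i)" using light_rank_inj[OF R] by (rule inj_on_subset) auto
    then have "card (?L i) \<le> card {..<d}" by (rule card_inj_on_le) auto
    then show ?thesis by simp
  qed
  have fin: "finite (?L i)" for i by (rule finite_subset[of _ "{..<n}"]) (use R in auto)
  have S: "card (Sigma {..<n} ?L) \<le> n * d"
  proof -
    have "card (Sigma {..<n} ?L) = (\<Sum>i<n. card (?L i))" using fin by (simp add: card_SigmaI)
    also have "\<dots> \<le> (\<Sum>i<n. d)" using L by (rule sum_mono)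
    finally show ?thesis by simp
  qed
  have finS: "finite (Sigma {..<n} ?L)" using fin by auto
  \<comment> \<open>An edge kept on account of its second end is the swap of one kept on account of
    its first.\<close>
  have "{(i, j). light n d R i j \<and> i \<noteq> j} \<subseteq> Sigma {..<n} ?L \<union> prod.swap ` Sigma {..<n} ?L"
    using sym by (auto simp: light_def image_iff dest: symD)
  then have "card {(i, j). light n d R i j \<and> i \<noteq> j} \<le> card (Sigma {..<n} ?L \<union> prod.swap ` Sigma {..<n} ?L)"
    using finS by (intro card_mono) auto
  also have "\<dots> \<le> card (Sigma {..<n} ?L) + card (Sigma {..<n} ?L)"
    using finS by (intro order_trans[OF card_Un_le] add_mono card_image_le) auto
  finally show "card {(i, j). light n d R i j \<and> i \<noteq> j} \<le> 2 * n * d" using S by simp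
qed (use R sym in \<open>auto simp: light_def dest: symD\<close>)

lemma run_next:
  assumes s: "input n k R P s" and R: "R \<subseteq> {..<n} \<times> {..<n}"
    and D: "\<And>i j. i < n \<Longrightarrow> j < n \<Longrightarrow> s ''D'' i j = dst n R i j" and ij: "i < n" "j < n"
  shows "run next_cmd \<rho> s ''X'' i j = hop n R i j"
proof -
  have n: "size_of s = n" and E: "\<And>i j. i < n \<Longrightarrow> j < n \<Longrightarrow> s ''E'' i j = of_bool ((i, j) \<in> R)"
    using s by (auto simp: input_def)
  have c2: "eval (closerE 2) \<rho> s = of_bool (closer n R i j (\<rho> 2))" if "\<rho> 0 = i" "\<rho> 1 = j" "\<rho> 2 < n" for \<rho>
    using that ij E D by (simp add: closerE_def closer_def)
  have c3: "eval (closerE 3) \<rho> s = of_bool (closer n R i j (\<rho> 3))" if "\<rho> 0 = i" "\<rho> 1 = j" "\<rho> 3 < n" for \<rho>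
    using that ij E D by (simp add: closerE_def closer_def)
  have less: "w < n" if "closer n R i j w" for w using that R by (auto simp: closer_def)
  let ?w = "LEAST w. closer n R i j w"
  have "card {w. w < n \<and> (\<forall>w'<n. w' \<le> w \<longrightarrow> \<not> closer n R i j w')} = ?w" if "\<exists>w. closer n R i j w"
  proof -
    have c: "closer n R i j ?w" using that by (rule LeastI_ex)
    have "{w. w < n \<and> (\<forall>w'<n. w' \<le> w \<longrightarrow> \<not> closer n R i j w')} = {..<?w}"
    proof (intro set_eqI iffI)
      fix w assume "w \<in> {w. w < n \<and> (\<forall>w'<n. w' \<le> w \<longrightarrow> \<not> closer n R i j w')}"
      then show "w \<in> {..<?w}" using c less[OF c] by (auto simp: not_le[symmetric])
    next
      fix w assume "w \<in> {..<?w}"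
      then show "w \<in> {w. w < n \<and> (\<forall>w'<n. w' \<le> w \<longrightarrow> \<not> closer n R i j w')}"
        using less[OF c] not_less_Least[of _ "closer n R i j"] by fastforce
    qed
    then show ?thesis by simp
  qed
  moreover have "(\<exists>w<n. closer n R i j w) \<longleftrightarrow> (\<exists>w. closer n R i j w)" using less by blast
  ultimately show ?thesis
    unfolding next_cmd_def using ij n c2 c3
    by (simp add: sum_of_bool_card hop_def imp_conjL cong: conj_cong)
qed

text \<open>The least minimiser is the only index that beats all smaller ones strictly and loses to
  none; this is the test made by \<open>choose_cmd\<close>.\<close>

lemma argmin_exists:
  fixes f :: "nat \<Rightarrow> nat"
  assumes "n > 0"
  shows "\<exists>c0<n. (\<forall>c<n. f c0 \<le> f c) \<and>
    (\<forall>c<n. (\<forall>c'<n. if c' < c then f c < f c' else f c \<le> f c') \<longleftrightarrow> c = c0)"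
proof -
  let ?Q = "\<lambda>c. c < n \<and> (\<forall>c'<n. f c \<le> f c')"
  have ex: "\<exists>c. ?Q c"
  proof -
    obtain c where "c \<in> {..<n}" "\<forall>c'\<in>{..<n}. f c \<le> f c'"
      using assms by (metis finite_lessThan lessThan_empty_iff ex_min_if_finite not_less image_iff
          arg_min_if_finite(1) arg_min_least less_numeral_extra(3))
    then show ?thesis by auto
  qed
  define c0 where "c0 = (LEAST c. ?Q c)"
  have c0: "?Q c0" unfolding c0_def using ex by (rule LeastI_ex)
  have less: "f c0 < f c" if "c < c0" for c
  proof -
    have "\<not> ?Q c" using that not_less_Least unfolding c0_def by blast
    moreover have "c < n" using that c0 by simp
    ultimately obtain c' where "c' < n" "f c' < f c" by (auto simp: not_le)
    then show ?thesis using c0 by (meson le_less_trans)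
  qed
  have "(\<forall>c'<n. if c' < c then f c < f c' else f c \<le> f c') \<longleftrightarrow> c = c0" if "c < n" for c
  proof
    assume c: "\<forall>c'<n. if c' < c then f c < f c' else f c \<le> f c'"
    show "c = c0"
    proof (rule linorder_cases[of c c0])
      assume "c < c0"
      then have "f c0 < f c" by (rule less)
      moreover have "f c \<le> f c0" using c c0 \<open>c < c0\<close> by (metis less_asym)
      ultimately show ?thesis by simp
    next
      assume "c0 < c"
      then have "f c < f c0" using c c0 by auto
      moreover have "f c0 \<le> f c" using c0 that by blast
      ultimately show ?thesis by simp
    qed
  next
    assume "c = c0"
    then show "\<forall>c'<n. if c' < c then f c < f c' else f c \<le> f c'" using c0 less by auto
  qed
  then show ?thesis using c0 by blast
qed

lemma writes_path: "writes path_cmd = {''Q''}"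
  by (simp add: path_cmd_def)

lemma writes_bfs: "writes (bfs_cmd x y) = {y}"
  by (simp add: bfs_cmd_def)

section \<open>The commands compute the sets analysed above\<close>

context light_graph
begin

definition loaded :: "nat \<Rightarrow> (nat \<times> nat) set \<Rightarrow> store \<Rightarrow> bool" where
  "loaded k P s \<longleftrightarrow> size_of s = n \<and> s ''k'' 0 0 = k \<and> s ''d'' 0 0 = d \<and>
     (\<forall>i<n. \<forall>j<n. s ''P'' i j = of_bool ((i, j) \<in> P) \<and> s ''A'' i j = of_bool (A i j) \<and>
        s ''X'' i j = X i j \<and> s ''D'' i j = D i j)"

lemma loaded_run:
  "loaded k P s \<Longrightarrow> writes c \<inter> {''n'', ''k'', ''d'', ''P'', ''A'', ''X'', ''D''} = {} \<Longrightarrow> loaded k P (run c \<rho> s)"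
  unfolding loaded_def by (simp add: run_frame)

text \<open>\<open>Fill\<close> writes whole arrays, so a set is repeated in every column; the
  program reads column 0.\<close>

definition holds_set :: "vname \<Rightarrow> nat set \<Rightarrow> store \<Rightarrow> bool" where
  "holds_set x S s \<longleftrightarrow> S \<subseteq> {..<n} \<and> (\<forall>c<n. \<forall>j<n. s x c j = of_bool (c \<in> S))"

definition holds_rel :: "vname \<Rightarrow> (nat \<times> nat) set \<Rightarrow> store \<Rightarrow> bool" where
  "holds_rel x H s \<longleftrightarrow> (\<forall>i<n. \<forall>j<n. s x i j = of_bool ((i, j) \<in> H))"

definition holds_path :: "nat \<Rightarrow> nat \<Rightarrow> store \<Rightarrow> bool" where
  "holds_path u t s \<longleftrightarrow> (\<forall>a<n. s ''Q'' a 0 = q u t a)"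

lemma run_path:
  assumes s: "loaded k P s" and ut: "u < n" "t < n" and \<rho>: "\<rho> 2 = u" "\<rho> 3 = t"
  shows "holds_path u t (run path_cmd \<rho> s)"
proof -
  \<comment> \<open>Round \<open>r\<close> advances only the positions beyond \<open>r\<close>, so
    position \<open>a\<close> stops after \<open>a\<close> hops.\<close>
  let ?J = "\<lambda>r s'. loaded k P s' \<and> (\<forall>a<n. \<forall>j<n. s' ''Q'' a j = q u t (min r a))"
  have "?J n (run path_cmd \<rho> s)"
    unfolding path_cmd_def run.simps(2)
  proof (rule run_For_invariant[where J = ?J])
    have n: "size_of s = n" using s by (simp add: loaded_def)
    then show "size_of (run (Fill ''Q'' (Idx 2)) \<rho> s) = n" by simp
    show "?J 0 (run (Fill ''Q'' (Idx 2)) \<rho> s)"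
      using loaded_run[OF s, of "Fill ''Q'' (Idx 2)" \<rho>] n \<rho> by (simp add: q_0)
  next
    fix r s' assume r: "r < n" and J: "?J r s'"
    let ?c = "Fill ''Q'' (IfE (LtE (Idx 6) (Idx 0)) (At ''X'' (At ''Q'' (Idx 0) (Idx 1)) (Idx 3)) (At ''Q'' (Idx 0) (Idx 1)))"
    have n: "size_of s' = n" and X: "\<And>i j. i < n \<Longrightarrow> j < n \<Longrightarrow> s' ''X'' i j = X i j"
      using J by (auto simp: loaded_def)
    have "(if r < a then X (q u t (min r a)) t else q u t (min r a)) = q u t (min (Suc r) a)" for a
      by (auto simp: min_def q_Suc)
    then have "\<forall>a<n. \<forall>j<n. run ?c (\<rho>(6 := r)) s' ''Q'' a j = q u t (min (Suc r) a)"
      using J n X q_less[OF ut] ut \<rho> by (simp cong: if_cong)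
    then show "?J (Suc r) (run ?c (\<rho>(6 := r)) s')"
      using J loaded_run[of k P s' ?c "\<rho>(6 := r)"] by simp
  qed
  then show ?thesis using ut unfolding holds_path_def by (auto simp: min_absorb2 less_imp_le)
qed

context
  fixes k P s u t S
  assumes s: "loaded k P s" and path: "holds_path u t s" and S: "holds_set ''S'' S s" and ut: "u < n" "t < n"
begin

private lemma n: "size_of s = n" and n0: "0 < n"
  using s ut by (auto simp: loaded_def)

private lemma A: "i < n \<Longrightarrow> j < n \<Longrightarrow> s ''A'' i j = of_bool (A i j)"
  and X: "i < n \<Longrightarrow> j < n \<Longrightarrow> s ''X'' i j = X i j"
  using s by (auto simp: loaded_def)

private lemma Q: "a < n \<Longrightarrow> s ''Q'' a 0 = q u t a"
  using path by (simp add: holds_path_def)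

lemma eval_head: "\<rho> 4 < n \<Longrightarrow> eval headE \<rho> s = q u t (\<rho> 4)"
  by (simp add: headE_def Q)

lemma eval_tail: "\<rho> 4 < n \<Longrightarrow> \<rho> 3 = t \<Longrightarrow> eval tailE \<rho> s = q u t (Suc (\<rho> 4))"
  using q_less[OF ut] ut by (simp add: tailE_def eval_head X q_Suc)

lemma eval_miss: "\<rho> 4 < n \<Longrightarrow> \<rho> 3 = t \<Longrightarrow> eval missE \<rho> s = of_bool (miss u t (\<rho> 4))"
  using q_less[OF ut] by (simp add: missE_def eval_head eval_tail A miss_def)

lemma eval_edge:
  "\<rho> 4 < n \<Longrightarrow> \<rho> 3 = t \<Longrightarrow> eval edgeE \<rho> s =
     of_bool ((\<rho> 0, \<rho> 1) \<in> {(q u t (\<rho> 4), q u t (Suc (\<rho> 4))), (q u t (Suc (\<rho> 4)), q u t (\<rho> 4))})"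
  by (auto simp: edgeE_def eval_head eval_tail)

lemma eval_hit: "\<rho> 5 < n \<Longrightarrow> eval hitE \<rho> s = of_bool (hit S (q u t (\<rho> 5)))"
  using q_less[OF ut] S n0 n by (auto simp: hitE_def Q A hit_def holds_set_def)

lemma eval_hit': "\<rho> 5 < n \<Longrightarrow> \<rho> 0 < n \<Longrightarrow> eval hit'E \<rho> s = of_bool (hit (insert (\<rho> 0) S) (q u t (\<rho> 5)))"
  using q_less[OF ut] by (auto simp: hit'E_def eval_hit Q A hit_def)

lemma eval_fwd:
  assumes "\<And>b. b < n \<Longrightarrow> eval h (\<rho>(5 := b)) s = of_bool (hit S' (q u t b))" and "\<rho> 4 < n" "\<rho> 3 = t"
  shows "eval (fwdE h) \<rho> s = of_bool (\<rho> 4 \<in> fwd u t S')"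
proof -
  have "(\<forall>b<n. b \<le> \<rho> 4 \<longrightarrow> \<not> hit S' (q u t b)) \<longleftrightarrow> (\<forall>b\<le>\<rho> 4. \<not> hit S' (q u t b))"
    using assms(2) le_less_trans by blast
  then show ?thesis using assms by (auto simp: fwdE_def eval_miss fwd_def n)
qed

lemma eval_bwd:
  assumes "\<And>b. b < n \<Longrightarrow> eval h (\<rho>(5 := b)) s = of_bool (hit S' (q u t b))" and "\<rho> 4 < n" "\<rho> 3 = t"
  shows "eval (bwdE h) \<rho> s = of_bool (\<rho> 4 \<in> bwd u t S')"
  using assms by (auto simp: bwdE_def eval_miss bwd_def n)

lemma eval_score:
  assumes "\<rho> 0 < n" "\<rho> 3 = t"
  shows "eval (Total 4 (fwdE hit'E)) \<rho> s = card (fwd u t (insert (\<rho> 0) S))"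
    and "eval (Total 4 (bwdE hit'E)) \<rho> s = card (bwd u t (insert (\<rho> 0) S))"
proof -
  have "eval (fwdE hit'E) (\<rho>(4 := a)) s = of_bool (a \<in> fwd u t (insert (\<rho> 0) S))" if "a < n" for a
    using eval_fwd[of hit'E "\<rho>(4 := a)" "insert (\<rho> 0) S"] eval_hit' assms that by simp
  then have "eval (Total 4 (fwdE hit'E)) \<rho> s = card {a. a < n \<and> a \<in> fwd u t (insert (\<rho> 0) S)}"
    by (simp add: n sum_of_bool_card)
  also have "{a. a < n \<and> a \<in> fwd u t (insert (\<rho> 0) S)} = fwd u t (insert (\<rho> 0) S)" by (auto simp: fwd_def)
  finally show "eval (Total 4 (fwdE hit'E)) \<rho> s = card (fwd u t (insert (\<rho> 0) S))" .
  have "eval (bwdE hit'E) (\<rho>(4 := a)) s = of_bool (a \<in> bwd u t (insert (\<rho> 0) S))" if "a < n" for a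
    using eval_bwd[of hit'E "\<rho>(4 := a)" "insert (\<rho> 0) S"] eval_hit' assms that by simp
  then have "eval (Total 4 (bwdE hit'E)) \<rho> s = card {a. a < n \<and> a \<in> bwd u t (insert (\<rho> 0) S)}"
    by (simp add: n sum_of_bool_card)
  also have "{a. a < n \<and> a \<in> bwd u t (insert (\<rho> 0) S)} = bwd u t (insert (\<rho> 0) S)" by (auto simp: bwd_def)
  finally show "eval (Total 4 (bwdE hit'E)) \<rho> s = card (bwd u t (insert (\<rho> 0) S))" .
qed

lemma eval_outer_edge:
  assumes "\<rho> 3 = t"
  shows "eval (ExE 4 (AndE (OrE (fwdE hitE) (bwdE hitE)) edgeE)) \<rho> s
     = of_bool ((\<rho> 0, \<rho> 1) \<in> pedges u t (fwd u t S \<union> bwd u t S))"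
proof -
  have f: "eval (fwdE hitE) (\<rho>(4 := a)) s = of_bool (a \<in> fwd u t S)" if "a < n" for a
    using eval_fwd[of hitE "\<rho>(4 := a)" S] eval_hit assms that by simp
  have b: "eval (bwdE hitE) (\<rho>(4 := a)) s = of_bool (a \<in> bwd u t S)" if "a < n" for a
    using eval_bwd[of hitE "\<rho>(4 := a)" S] eval_hit assms that by simp
  have e: "eval edgeE (\<rho>(4 := a)) s =
     of_bool ((\<rho> 0, \<rho> 1) \<in> {(q u t a, q u t (Suc a)), (q u t (Suc a), q u t a)})" if "a < n" for a
    using eval_edge[of "\<rho>(4 := a)"] assms that by simp
  have "(\<exists>a<n. (a \<in> fwd u t S \<or> a \<in> bwd u t S) \<and>
      (\<rho> 0, \<rho> 1) \<in> {(q u t a, q u t (Suc a)), (q u t (Suc a), q u t a)})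
     \<longleftrightarrow> (\<rho> 0, \<rho> 1) \<in> pedges u t (fwd u t S \<union> bwd u t S)"
    unfolding pedges_def by (auto simp: fwd_def bwd_def image_iff)
  moreover have "eval (ExE 4 (AndE (OrE (fwdE hitE) (bwdE hitE)) edgeE)) \<rho> s = of_bool (\<exists>a<n.
      (a \<in> fwd u t S \<or> a \<in> bwd u t S) \<and> (\<rho> 0, \<rho> 1) \<in> {(q u t a, q u t (Suc a)), (q u t (Suc a), q u t a)})"
    unfolding eval_sugar n
    by (intro arg_cong[where f = of_bool] ex_cong1 conj_cong refl) (auto simp: f b e)
  ultimately show ?thesis by (simp only:)
qed

lemma eval_missing_edge:
  assumes "\<rho> 3 = t"
  shows "eval (ExE 4 (AndE missE edgeE)) \<rho> s = of_bool ((\<rho> 0, \<rho> 1) \<in> pedges u t {a. miss u t a})"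
proof -
  have m: "eval missE (\<rho>(4 := a)) s = of_bool (miss u t a)" if "a < n" for a
    using eval_miss[of "\<rho>(4 := a)"] assms that by simp
  have e: "eval edgeE (\<rho>(4 := a)) s =
     of_bool ((\<rho> 0, \<rho> 1) \<in> {(q u t a, q u t (Suc a)), (q u t (Suc a), q u t a)})" if "a < n" for a
    using eval_edge[of "\<rho>(4 := a)"] assms that by simp
  have "a < n" if "miss u t a" for a using miss_less[OF ut that] by simp
  then have "(\<exists>a<n. miss u t a \<and> (\<rho> 0, \<rho> 1) \<in> {(q u t a, q u t (Suc a)), (q u t (Suc a), q u t a)})
     \<longleftrightarrow> (\<rho> 0, \<rho> 1) \<in> pedges u t {a. miss u t a}"
    unfolding pedges_def by (auto simp: image_iff)
  moreover have "eval (ExE 4 (AndE missE edgeE)) \<rho> s = of_bool (\<exists>a<n.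
      miss u t a \<and> (\<rho> 0, \<rho> 1) \<in> {(q u t a, q u t (Suc a)), (q u t (Suc a), q u t a)})"
    unfolding eval_sugar n
    by (intro arg_cong[where f = of_bool] ex_cong1 conj_cong refl) (auto simp: m e)
  ultimately show ?thesis by (simp only:)
qed

end

lemma run_score:
  assumes s: "loaded k P s" and S: "holds_set ''S'' S s" and P: "P \<subseteq> {..<n} \<times> {..<n}" and ci: "c < n" "i < n"
  shows "run score_cmd \<rho> s ''Z'' c i = Phi P (insert c S)"
proof -
  define f where "f u t c = (if (u, t) \<in> P then card (fwd u t (insert c S)) + card (bwd u t (insert c S)) else 0)" for u t c
  let ?I = "\<lambda>s'. loaded k P s' \<and> holds_set ''S'' S s'"
  let ?J = "\<lambda>u s'. ?I s' \<and> (\<forall>c<n. \<forall>i<n. s' ''Z'' c i = (\<Sum>u<u. \<Sum>t<n. f u t c))"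
  let ?body = "path_cmd ;; Fill ''Z'' (Add (At ''Z'' (Idx 0) (Idx 1))
       (IfE (At ''P'' (Idx 2) (Idx 3)) (Add (Total 4 (fwdE hit'E)) (Total 4 (bwdE hit'E))) (Num 0)))"
  have I: "?I (run c' \<rho> s')" if "?I s'" "writes c' \<subseteq> {''Q'', ''Z''}" for c' \<rho> s'
  proof -
    have "''S'' \<notin> writes c'" "writes c' \<inter> {''n'', ''k'', ''d'', ''P'', ''A'', ''X'', ''D''} = {}"
      using that(2) by auto
    then show ?thesis using that(1) loaded_run[of k P s' c' \<rho>] run_frame[of "''S''" c' \<rho> s']
      by (simp add: holds_set_def)
  qed
  have "?J n (run score_cmd \<rho> s)"
    unfolding score_cmd_def run.simps(2)
  proof (rule run_For_invariant[where J = ?J])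
    have n: "size_of s = n" using s by (simp add: loaded_def)
    then show "size_of (run (Fill ''Z'' (Num 0)) \<rho> s) = n" by simp
    show "?J 0 (run (Fill ''Z'' (Num 0)) \<rho> s)"
      using I[of s "Fill ''Z'' (Num 0)" \<rho>] s S n by simp
  next
    fix u s1 assume u: "u < n" and J: "?J u s1"
    let ?J' = "\<lambda>t s'. ?I s' \<and> (\<forall>c<n. \<forall>i<n. s' ''Z'' c i = (\<Sum>u<u. \<Sum>t<n. f u t c) + (\<Sum>t<t. f u t c))"
    have "?J' n (run (For 3 ?body) (\<rho>(2 := u)) s1)"
    proof (rule run_For_invariant[where J = ?J'])
      show "size_of s1 = n" using J by (simp add: loaded_def)
      show "?J' 0 s1" using J by simp
    next
      fix t s2 assume t: "t < n" and J': "?J' t s2"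
      let ?\<rho> = "\<rho>(2 := u, 3 := t)"
      let ?s3 = "run path_cmd ?\<rho> s2"
      have s3: "loaded k P ?s3" "holds_set ''S'' S ?s3" using I[of s2 path_cmd ?\<rho>] J' by (auto simp: writes_path)
      have path: "holds_path u t ?s3" using J' u t by (intro run_path) auto
      have Z: "?s3 ''Z'' = s2 ''Z''" by (rule run_frame) (simp add: writes_path)
      have n3: "size_of ?s3 = n" and P3: "?s3 ''P'' u t = of_bool ((u, t) \<in> P)"
        using s3(1) u t by (auto simp: loaded_def)
      have score: "eval (Total 4 (fwdE hit'E)) (?\<rho>(0 := c, 1 := i)) ?s3 = card (fwd u t (insert c S))"
        "eval (Total 4 (bwdE hit'E)) (?\<rho>(0 := c, 1 := i)) ?s3 = card (bwd u t (insert c S))"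
        if "c < n" for c i
        using eval_score[OF s3(1) path s3(2) u t, of "?\<rho>(0 := c, 1 := i)"] that by simp_all
      have "run ?body ?\<rho> s2 ''Z'' c i = s2 ''Z'' c i + f u t c" if "c < n" "i < n" for c i
        using that n3 P3 Z score[OF that(1), of i] by (simp add: f_def del: eval.simps(7))
      then show "?J' (Suc t) (run ?body ?\<rho> s2)"
        using I[of s2 ?body ?\<rho>] J' by (simp add: writes_path del: run.simps)
    qed
    then show "?J (Suc u) (run (For 3 ?body) (\<rho>(2 := u)) s1)" by (simp del: run.simps)
  qed
  then have "run score_cmd \<rho> s ''Z'' c i = (\<Sum>u<n. \<Sum>t<n. f u t c)" using ci by blast
  then show ?thesis unfolding f_def Phi_def sum_pairs[OF P] .
qed

lemma run_choose:
  assumes s: "loaded k P s" and S: "holds_set ''S'' S s" and P: "P \<subseteq> {..<n} \<times> {..<n}" and n: "0 < n" and d: "d \<le> n"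
  shows "\<exists>c0<n. (\<forall>c<n. Phi P (insert c0 S) \<le> Phi P (insert c S)) \<and>
     holds_set ''S'' (if \<rho> 8 < d * (if k < 2 then 1 else d) then insert c0 S else S) (run (score_cmd ;; choose_cmd) \<rho> s)"
proof -
  let ?s1 = "run score_cmd \<rho> s"
  have w: "writes score_cmd = {''Z'', ''Q''}" by (auto simp: score_cmd_def writes_path)
  have s1: "loaded k P ?s1" using s w by (intro loaded_run) auto
  have S1: "?s1 ''S'' = s ''S''" by (rule run_frame) (simp add: w)
  have n1: "size_of ?s1 = n" "?s1 ''k'' 0 0 = k" "?s1 ''d'' 0 0 = d" using s1 by (auto simp: loaded_def)
  have Z: "?s1 ''Z'' c 0 = Phi P (insert c S)" if "c < n" for c using run_score[OF s S P that n] .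
  obtain c0 where c0: "c0 < n" "\<forall>c<n. Phi P (insert c0 S) \<le> Phi P (insert c S)"
    "\<And>c. c < n \<Longrightarrow> (\<forall>c'<n. if c' < c then Phi P (insert c S) < Phi P (insert c' S)
        else Phi P (insert c S) \<le> Phi P (insert c' S)) \<longleftrightarrow> c = c0"
    using argmin_exists[OF n, of "\<lambda>c. Phi P (insert c S)"] by blast
  have steps: "eval stepsE \<rho>' ?s1 = d * (if k < 2 then 1 else d)" for \<rho>'
  proof -
    have "eval stepsE \<rho>' ?s1 = (\<Sum>i<n. if i < d then (if k < 2 then 1 else d) else 0)"
      unfolding stepsE_def using n1 by (auto intro!: sum.cong)
    also have "\<dots> = (\<Sum>i<d. if k < 2 then 1 else d)"
      using d by (intro sum.mono_neutral_cong_right) auto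
    finally show ?thesis by simp
  qed
  have best: "(\<forall>c'<n. 0 < (if c' < c then of_bool (Phi P (insert c S) < Phi P (insert c' S))
        else (of_bool (Phi P (insert c S) \<le> Phi P (insert c' S)) :: nat))) \<longleftrightarrow> c = c0" if "c < n" for c
    unfolding c0(3)[OF that, symmetric] by (auto split: if_splits)
  have "run choose_cmd \<rho> ?s1 ''S'' c i = of_bool (c \<in> S \<or> \<rho> 8 < d * (if k < 2 then 1 else d) \<and> c = c0)"
    if ci: "c < n" "i < n" for c i
  proof -
    have "s ''S'' c i = of_bool (c \<in> S)" using S ci by (simp add: holds_set_def)
    moreover have "eval (AllE 2 (IfE (LtE (Idx 2) (Idx 0)) (LtE (ZE (Idx 0)) (ZE (Idx 2))) (LeE (ZE (Idx 0)) (ZE (Idx 2)))))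
        (\<rho>(0 := c, 1 := i)) ?s1 = of_bool (c = c0)"
      using best[OF ci(1)] Z ci n1 by (simp cong: if_cong)
    ultimately show ?thesis
      unfolding choose_cmd_def using ci n1 S1 steps by (simp del: eval_sugar(9))
  qed
  moreover have "S \<subseteq> {..<n}" using S by (simp add: holds_set_def)
  ultimately have "holds_set ''S'' (if \<rho> 8 < d * (if k < 2 then 1 else d) then insert c0 S else S) (run choose_cmd \<rho> ?s1)"
    using c0(1) unfolding holds_set_def by auto
  then show ?thesis using c0(1,2) by auto
qed

lemma run_greedy:
  assumes s: "loaded k P s" and S: "holds_set ''S'' {} s" and P: "P \<subseteq> {..<n} \<times> {..<n}" and n: "0 < n" and d: "d \<le> n"
    and T: "d * (if k < 2 then 1 else d) \<le> n"
  obtains Ss where "Ss 0 = {}"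
    and "\<And>r. r < d * (if k < 2 then 1 else d) \<Longrightarrow> \<exists>c0<n. Ss (Suc r) = insert c0 (Ss r) \<and>
      (\<forall>c<n. Phi P (insert c0 (Ss r)) \<le> Phi P (insert c (Ss r)))"
    and "holds_set ''S'' (Ss (d * (if k < 2 then 1 else d))) (run (For 8 (score_cmd ;; choose_cmd)) \<rho> s)"
proof -
  define T0 where "T0 = d * (if k < 2 then 1 else d)"
  let ?step = "\<lambda>Ss r. \<exists>c0<n. Ss (Suc r) = insert c0 (Ss r) \<and>
      (\<forall>c<n. Phi P (insert c0 (Ss r)) \<le> Phi P (insert c (Ss r)))"
  \<comment> \<open>The minimum expresses that the set is frozen once \<open>T0\<close> rounds are
    over.\<close>
  let ?J = "\<lambda>r s'. loaded k P s' \<and> (\<exists>Ss. Ss 0 = {} \<and> (\<forall>i < min r T0. ?step Ss i) \<and> holds_set ''S'' (Ss (min r T0)) s')"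
  have w: "writes (score_cmd ;; choose_cmd) = {''Z'', ''Q'', ''S''}"
    by (auto simp: score_cmd_def writes_path choose_cmd_def)
  have "?J n (run (For 8 (score_cmd ;; choose_cmd)) \<rho> s)"
  proof (rule run_For_invariant[where J = ?J])
    show "size_of s = n" using s by (simp add: loaded_def)
    show "?J 0 s" using s S by (auto intro!: exI[of _ "\<lambda>_. {}"])
  next
    fix r s1 assume r: "r < n" and J: "?J r s1"
    then obtain Ss where Ss: "Ss 0 = {}" "\<forall>i < min r T0. ?step Ss i" "holds_set ''S'' (Ss (min r T0)) s1" by blast
    have s1: "loaded k P s1" using J by blast
    have l: "loaded k P (run (score_cmd ;; choose_cmd) (\<rho>(8 := r)) s1)"
      using s1 w by (intro loaded_run) auto
    obtain c0 where c0: "c0 < n" "\<forall>c<n. Phi P (insert c0 (Ss (min r T0))) \<le> Phi P (insert c (Ss (min r T0)))"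
      "holds_set ''S'' (if r < T0 then insert c0 (Ss (min r T0)) else Ss (min r T0)) (run (score_cmd ;; choose_cmd) (\<rho>(8 := r)) s1)"
      using run_choose[OF s1 Ss(3) P n d, of "\<rho>(8 := r)", folded T0_def] by (auto simp del: run.simps)
    show "?J (Suc r) (run (score_cmd ;; choose_cmd) (\<rho>(8 := r)) s1)"
    proof (cases "r < T0")
      case True
      let ?Ss = "Ss(Suc r := insert c0 (Ss r))"
      have "?step ?Ss i" if "i < Suc r" for i
      proof (cases "i = r")
        case True
        then show ?thesis using c0 \<open>r < T0\<close> by (auto simp: min_def)
      next
        case False
        then have "i < min r T0" using that True by simp
        then show ?thesis using Ss(2) False that by auto
      qed
      moreover have "holds_set ''S'' (?Ss (min (Suc r) T0)) (run (score_cmd ;; choose_cmd) (\<rho>(8 := r)) s1)"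
        using c0(3) True by (simp add: min_absorb1 del: run.simps)
      ultimately show ?thesis using l Ss(1) by (auto intro!: exI[of _ ?Ss] simp del: run.simps)
    next
      case False
      then have "min (Suc r) T0 = min r T0" by simp
      then show ?thesis using l Ss c0(3) False by (auto intro!: exI[of _ Ss] simp del: run.simps)
    qed
  qed
  then obtain Ss where "Ss 0 = {}" "\<forall>i < min n T0. ?step Ss i"
    "holds_set ''S'' (Ss (min n T0)) (run (For 8 (score_cmd ;; choose_cmd)) \<rho> s)" by blast
  then show thesis using that[of Ss, folded T0_def] T[folded T0_def] by (simp add: min_absorb2 del: run.simps)
qed

lemma run_buy:
  assumes s: "loaded k P s" and S: "holds_set ''S'' S s" and P: "P \<subseteq> {..<n} \<times> {..<n}"
  shows "holds_rel ''H'' (bought P S) (run buy_cmd \<rho> s)"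
proof -
  let ?I = "\<lambda>s'. loaded k P s' \<and> holds_set ''S'' S s'"
  \<comment> \<open>The pairs treated so far, in the lexicographic order of the two loops.\<close>
  let ?P = "\<lambda>u t. {(u', t'). (u', t') \<in> P \<and> (u' < u \<or> u' = u \<and> t' < t)}"
  let ?J = "\<lambda>u s'. ?I s' \<and> holds_rel ''H'' (bought (?P u 0) S) s'"
  let ?body = "path_cmd ;; Fill ''H'' (OrE (At ''H'' (Idx 0) (Idx 1))
       (AndE (At ''P'' (Idx 2) (Idx 3)) (ExE 4 (AndE (OrE (fwdE hitE) (bwdE hitE)) edgeE))))"
  let ?init = "Fill ''H'' (AndE (At ''A'' (Idx 0) (Idx 1)) (NotE (EqE (Idx 0) (Idx 1))))"
  have I: "?I (run c' \<rho> s')" if "?I s'" "writes c' \<subseteq> {''Q'', ''H''}" for c' \<rho> s'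
  proof -
    have "''S'' \<notin> writes c'" "writes c' \<inter> {''n'', ''k'', ''d'', ''P'', ''A'', ''X'', ''D''} = {}"
      using that(2) by auto
    then show ?thesis using that(1) loaded_run[of k P s' c' \<rho>] run_frame[of "''S''" c' \<rho> s']
      by (simp add: holds_set_def)
  qed
  have "?J n (run buy_cmd \<rho> s)"
    unfolding buy_cmd_def run.simps(2)
  proof (rule run_For_invariant[where J = ?J])
    have n: "size_of s = n" and A: "\<And>i j. i < n \<Longrightarrow> j < n \<Longrightarrow> s ''A'' i j = of_bool (A i j)"
      using s by (auto simp: loaded_def)
    then show "size_of (run ?init \<rho> s) = n" by simp
    have "bought (?P 0 0) S = base" by (auto simp: bought_def)
    moreover have "holds_rel ''H'' base (run ?init \<rho> s)"
      using n A by (simp add: holds_rel_def base_def)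
    ultimately show "?J 0 (run ?init \<rho> s)" using I[of s ?init \<rho>] s S by simp
  next
    fix u s1 assume u: "u < n" and J: "?J u s1"
    let ?J' = "\<lambda>t s'. ?I s' \<and> holds_rel ''H'' (bought (?P u t) S) s'"
    have "?J' n (run (For 3 ?body) (\<rho>(2 := u)) s1)"
    proof (rule run_For_invariant[where J = ?J'])
      show "size_of s1 = n" using J by (simp add: loaded_def)
      show "?J' 0 s1" using J by simp
    next
      fix t s2 assume t: "t < n" and J': "?J' t s2"
      let ?\<rho> = "\<rho>(2 := u, 3 := t)"
      let ?s3 = "run path_cmd ?\<rho> s2"
      have s3: "loaded k P ?s3" "holds_set ''S'' S ?s3" using I[of s2 path_cmd ?\<rho>] J' by (auto simp: writes_path)
      have path: "holds_path u t ?s3" using J' u t by (intro run_path) auto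
      have H: "?s3 ''H'' = s2 ''H''" by (rule run_frame) (simp add: writes_path)
      have n3: "size_of ?s3 = n" and P3: "?s3 ''P'' u t = of_bool ((u, t) \<in> P)"
        using s3(1) u t by (auto simp: loaded_def)
      have edge: "eval (ExE 4 (AndE (OrE (fwdE hitE) (bwdE hitE)) edgeE)) (?\<rho>(0 := i, 1 := j)) ?s3
          = of_bool ((i, j) \<in> pedges u t (fwd u t S \<union> bwd u t S))" for i j
        using eval_outer_edge[OF s3(1) path s3(2) u t, of "?\<rho>(0 := i, 1 := j)"] by simp
      have set: "(i, j) \<in> bought (?P u (Suc t)) S \<longleftrightarrow> (i, j) \<in> bought (?P u t) S \<or>
          (u, t) \<in> P \<and> (i, j) \<in> pedges u t (fwd u t S \<union> bwd u t S)" for i j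
        unfolding bought_def by (auto simp: less_Suc_eq)
      have "run ?body ?\<rho> s2 ''H'' i j = of_bool ((i, j) \<in> bought (?P u (Suc t)) S)" if "i < n" "j < n" for i j
      proof -
        have "s2 ''H'' i j = of_bool ((i, j) \<in> bought (?P u t) S)" using J' that by (simp add: holds_rel_def)
        then show ?thesis using that n3 P3 H edge[of i j] by (simp add: set del: eval_sugar(8))
      qed
      then show "?J' (Suc t) (run ?body ?\<rho> s2)"
        using I[of s2 ?body ?\<rho>] J' by (simp add: writes_path holds_rel_def del: run.simps)
    qed
    moreover have "?P u n = ?P (Suc u) 0" using P by (auto simp: less_Suc_eq)
    ultimately show "?J (Suc u) (run (For 3 ?body) (\<rho>(2 := u)) s1)" by (simp del: run.simps)
  qed
  moreover have "?P n 0 = P" using P by auto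
  ultimately show ?thesis by simp
qed

lemma run_connect:
  assumes s: "loaded k P s" and S: "holds_set ''S'' S s" and H: "holds_rel ''H'' H s" "host H"
  shows "holds_rel ''H'' (connect S (if k < 2 then 0 else 2) H) (run connect_cmd \<rho> s)"
proof -
  let ?\<beta> = "if k < 2 then 0 else 2 :: nat"
  let ?G = "\<lambda>c1. fold (\<lambda>c1. fold (add_path S ?\<beta> c1) [0..<n]) [0..<c1] H"
  let ?G' = "\<lambda>c1 c2. fold (add_path S ?\<beta> c1) [0..<c2] (?G c1)"
  let ?I = "\<lambda>s'. loaded k P s' \<and> holds_set ''S'' S s'"
  let ?J = "\<lambda>c1 s'. ?I s' \<and> host (?G c1) \<and> holds_rel ''H'' (?G c1) s'"
  let ?body = "bfs_cmd ''H'' ''B'' ;; path_cmd ;; Fill ''H'' (OrE (At ''H'' (Idx 0) (Idx 1))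
     (AndE (AndE (At ''S'' (Idx 3) (Num 0)) (At ''S'' (Idx 2) (Num 0))) (AndE farE (ExE 4 (AndE missE edgeE)))))"
  have I: "?I (run c' \<rho> s')" if "?I s'" "writes c' \<subseteq> {''Q'', ''H'', ''B''}" for c' \<rho> s'
  proof -
    have "''S'' \<notin> writes c'" "writes c' \<inter> {''n'', ''k'', ''d'', ''P'', ''A'', ''X'', ''D''} = {}"
      using that(2) by auto
    then show ?thesis using that(1) loaded_run[of k P s' c' \<rho>] run_frame[of "''S''" c' \<rho> s']
      by (simp add: holds_set_def)
  qed
  have "?J n (run connect_cmd \<rho> s)"
    unfolding connect_cmd_def
  proof (rule run_For_invariant[where J = ?J])
    show "size_of s = n" using s by (simp add: loaded_def)
    show "?J 0 s" using s S H by simp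
  next
    fix c1 s1 assume c1: "c1 < n" and J: "?J c1 s1"
    let ?J' = "\<lambda>c2 s'. ?I s' \<and> host (?G' c1 c2) \<and> holds_rel ''H'' (?G' c1 c2) s'"
    have "?J' n (run (For 2 ?body) (\<rho>(3 := c1)) s1)"
    proof (rule run_For_invariant[where J = ?J'])
      show "size_of s1 = n" using J by (simp add: loaded_def)
      show "?J' 0 s1" using J by simp
    next
      fix c2 s2 assume c2: "c2 < n" and J': "?J' c2 s2"
      let ?\<rho> = "\<rho>(3 := c1, 2 := c2)" and ?H = "?G' c1 c2"
      let ?s3 = "run (bfs_cmd ''H'' ''B'') ?\<rho> s2"
      let ?s4 = "run path_cmd ?\<rho> ?s3"
      have host: "host ?H" and H2: "holds_rel ''H'' ?H s2" and n2: "size_of s2 = n" using J' by (auto simp: loaded_def)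
      have sub: "?H \<subseteq> {..<n} \<times> {..<n}" using host R_sub unfolding host_def by blast
      \<comment> \<open>The search is repeated for every pair of centres, because
        \<open>add_path\<close> measures distances in the graph bought so far.\<close>
      have "rel n (s2 ''H'') = ?H" using H2 sub unfolding rel_def holds_rel_def by auto
      then have "?s3 ''B'' c2 c1 = dst n ?H c2 c1"
        using run_bfs[of s2 n "''H''" "''B''" c2 c1 ?\<rho>] n2 c1 c2 by simp
      moreover have "?s4 ''B'' = ?s3 ''B''" by (rule run_frame) (simp add: writes_path)
      ultimately have B: "?s4 ''B'' c2 c1 = dst n ?H c2 c1" by simp
      have I3: "?I ?s3" using I[of s2 "bfs_cmd ''H'' ''B''" ?\<rho>] J' by (auto simp: writes_bfs)
      have s4: "loaded k P ?s4" "holds_set ''S'' S ?s4" using I[of ?s3 path_cmd ?\<rho>] I3 by (auto simp: writes_path)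
      have path: "holds_path c2 c1 ?s4" using I3 c1 c2 by (intro run_path) auto
      have "?s4 ''H'' = ?s3 ''H''" "?s3 ''H'' = s2 ''H''"
        by (rule run_frame; simp add: writes_path writes_bfs)+
      then have H4: "?s4 ''H'' = s2 ''H''" by simp
      have n4: "size_of ?s4 = n" "?s4 ''k'' 0 0 = k" and D4: "?s4 ''D'' c2 c1 = D c2 c1"
        using s4(1) c1 c2 by (auto simp: loaded_def)
      have S4: "?s4 ''S'' c 0 = of_bool (c \<in> S)" if "c < n" for c
        using s4(2) that by (simp add: holds_set_def)
      have edge: "eval (ExE 4 (AndE missE edgeE)) (?\<rho>(0 := i, 1 := j)) ?s4
          = of_bool ((i, j) \<in> pedges c2 c1 {a. miss c2 c1 a})" for i j
        using eval_missing_edge[OF s4(1) path s4(2) c2 c1, of "?\<rho>(0 := i, 1 := j)"] by simp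
      have far: "eval farE (?\<rho>(0 := i, 1 := j)) ?s4 = of_bool (\<not> near ?H (D c2 c1 + ?\<beta>) c2 c1)" for i j
      proof -
        have "eval farE (?\<rho>(0 := i, 1 := j)) ?s4 =
            of_bool (?s4 ''D'' c2 c1 + (if ?s4 ''k'' 0 0 < 2 then 0 else 2) < ?s4 ''B'' c2 c1 \<or> size_of ?s4 \<le> ?s4 ''B'' c2 c1)"
          by (simp add: farE_def)
        also have "\<dots> = of_bool (\<not> (dst n ?H c2 c1 \<le> D c2 c1 + ?\<beta> \<and> dst n ?H c2 c1 < n))"
          unfolding n4 D4 B by (intro arg_cong[where f = of_bool]) linarith
        finally show ?thesis unfolding dst_le_iff[OF sub c2] .
      qed
      have "run ?body ?\<rho> s2 ''H'' i j = of_bool ((i, j) \<in> add_path S ?\<beta> c1 c2 ?H)" if "i < n" "j < n" for i j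
      proof -
        have "s2 ''H'' i j = of_bool ((i, j) \<in> ?H)" using H2 that by (simp add: holds_rel_def)
        moreover have "run ?body ?\<rho> s2 ''H'' i j = of_bool (0 < ?s4 ''H'' i j \<or>
            (0 < ?s4 ''S'' c1 0 \<and> 0 < ?s4 ''S'' c2 0) \<and> 0 < eval farE (?\<rho>(0 := i, 1 := j)) ?s4 \<and>
            0 < eval (ExE 4 (AndE missE edgeE)) (?\<rho>(0 := i, 1 := j)) ?s4)"
          using that n4(1) by (simp del: eval_sugar(8))
        ultimately show ?thesis
          unfolding H4 S4[OF c1] S4[OF c2] far edge add_path_def by auto
      qed
      then show "?J' (Suc c2) (run ?body ?\<rho> s2)"
        using I[of s2 ?body ?\<rho>] J' host_add_path[OF host c1 c2]
        by (simp add: writes_path writes_bfs holds_rel_def del: run.simps)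
    qed
    then show "?J (Suc c1) (run (For 2 ?body) (\<rho>(3 := c1)) s1)" by (simp del: run.simps)
  qed
  then show ?thesis unfolding connect_def by simp
qed

end

section \<open>Size and stretch\<close>

text \<open>In units of \<open>n d\<close>, for \<open>k \<ge> 2\<close>: 2 for kept edges,
  \<open>2 * 192\<close> for the outer parts with \<open>192 = 12 * 2^4\<close>, and 18 for the
  links, in total 404. For \<open>k = 1\<close> it is \<open>2 + 2 * 96 + 2\<close> with
  \<open>96 = 12 * 2^3\<close>.\<close>

lemma spanner_size:
  fixes n k :: nat and R P :: "(nat \<times> nat) set"
  defines "m \<equiv> if k < 2 then 3 else 4" and "\<beta> \<equiv> if k < 2 then 0 else 2"
  defines "d \<equiv> iroot n m (card P)"
  assumes G: "light_graph n R X A d" and P: "P \<subseteq> {..<n} \<times> {..<n}" and S: "S \<subseteq> {..<n}"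
    and cardS: "card S \<le> d * (if k < 2 then 1 else d)"
    and Phi: "d * (d * (if k < 2 then 1 else d)) * light_graph.Phi n X A P S \<le> 12 * card P * n"
  shows "card (light_graph.connect n R X A S \<beta> (light_graph.bought n X A P S)) \<le> 404 * (n * d)"
proof -
  interpret light_graph n R X A d by (rule G)
  let ?H = "connect S \<beta> (bought P S)"
  have finP: "finite P" using P finite_subset by blast
  have p: "card P \<le> n ^ 2" using card_mono[OF _ P] by (simp add: power2_eq_square)
  have up: "card P < Suc d ^ m" unfolding d_def by (rule iroot_bounds[OF p]) (simp add: m_def)
  have b: "card (bought P S) \<le> 2 * n * d + 2 * Phi P S" by (rule card_bought[OF finP])
  have host: "host (bought P S)" by (rule host_bought[OF P])
  have tree: "card ?H \<le> card (bought P S) + 2 * n * card S"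
    by (intro connect_tree_card S host_finite host)
  show ?thesis
  proof (cases "d = 0")
    case True
    then have "P = {}" using up finP by simp
    moreover have "card S = 0" using cardS True by simp
    ultimately show ?thesis using tree b True by (simp add: Phi_def)
  next
    case False
    \<comment> \<open>Rounding the root down loses at most the factor \<open>2^m\<close>, since
      \<open>d \<ge> 1\<close>.\<close>
    then have "Suc d ^ m \<le> (2 * d) ^ m" by (intro power_mono) auto
    then have up2: "card P \<le> 2 ^ m * d ^ m" using up by (simp add: power_mult_distrib)
    show ?thesis
    proof (cases "k < 2")
      case True
      have "d ^ 2 * Phi P S \<le> 12 * card P * n" using Phi True by (simp add: power2_eq_square mult.assoc)
      also have "\<dots> \<le> 12 * (2 ^ m * d ^ m) * n" using up2 by (intro mult_mono) auto
      also have "\<dots> = d ^ 2 * (96 * (n * d))" using True by (simp add: m_def power2_eq_square power3_eq_cube)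
      finally have "Phi P S \<le> 96 * (n * d)" using False by simp
      moreover have "2 * n * card S \<le> 2 * n * d" using cardS True by simp
      ultimately show ?thesis using tree b unfolding mult.assoc by linarith
    next
      case k: False
      have "d ^ 3 * Phi P S \<le> 12 * card P * n" using Phi k by (simp add: power3_eq_cube mult.assoc)
      also have "\<dots> \<le> 12 * (2 ^ m * d ^ m) * n" using up2 by (intro mult_mono) auto
      also have "\<dots> = d ^ 3 * (192 * (n * d))" using k by (simp add: m_def power3_eq_cube power4_eq_xxxx)
      finally have Phi192: "Phi P S \<le> 192 * (n * d)" using False by simp
      have "d * card ?H \<le> d * card (bought P S) + 18 * n * card S"
        using connect_2_card[OF host S] k by (simp add: \<beta>_def)
      also have "\<dots> \<le> d * card (bought P S) + 18 * n * (d * d)"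
        using cardS k by (intro add_mono mult_mono) auto
      also have "\<dots> = d * (card (bought P S) + 18 * (n * d))" by (simp add: algebra_simps)
      finally have "card ?H \<le> card (bought P S) + 18 * (n * d)" using False by simp
      then show ?thesis using b Phi192 unfolding mult.assoc by linarith
    qed
  qed
qed

lemma run_spanner:
  fixes n k :: nat and R P :: "(nat \<times> nat) set"
  assumes s: "input n k R P s" and S0: "s ''S'' = (\<lambda>_ _. 0)"
    and R: "R \<subseteq> {..<n} \<times> {..<n}" "sym R" and P: "P \<subseteq> {..<n} \<times> {..<n}" and npos: "0 < n"
  obtains H where "H \<subseteq> R" "sym H"
    and "\<And>i j. i < n \<Longrightarrow> j < n \<Longrightarrow> run spanner_cmd \<rho> s ''H'' i j = of_bool ((i, j) \<in> H)"
    and "card H \<le> 404 * (n * iroot n (if k < 2 then 3 else 4) (card P))"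
    and "\<And>u v m. (u, v) \<in> P \<Longrightarrow> near R m u v \<Longrightarrow> near H (m + 4 + (if k < 2 then 0 else 2)) u v"
proof -
  let ?m = "if k < 2 then 3 else 4 :: nat" and ?\<beta> = "if k < 2 then 0 else 2 :: nat"
  define d where "d = iroot n ?m (card P)"
  let ?T = "d * (if k < 2 then 1 else d)"
  define s1 where "s1 = run root_cmd \<rho> s"
  define s2 where "s2 = run light_cmd \<rho> s1"
  define s3 where "s3 = run (bfs_cmd ''E'' ''D'') \<rho> s2"
  define s4 where "s4 = run next_cmd \<rho> s3"
  define s5 where "s5 = run (For 8 (score_cmd ;; choose_cmd)) \<rho> s4"
  define s6 where "s6 = run buy_cmd \<rho> s5"
  have run: "run spanner_cmd \<rho> s = run connect_cmd \<rho> s6"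
    unfolding spanner_cmd_def s6_def s5_def s4_def s3_def s2_def s1_def by (simp del: run.simps(1,3))
  note w = root_cmd_def light_cmd_def next_cmd_def score_cmd_def choose_cmd_def buy_cmd_def path_cmd_def bfs_cmd_def
  have wr: "writes root_cmd = {''d''}" "writes light_cmd = {''A''}" "writes (bfs_cmd x y) = {y}"
    "writes next_cmd = {''X''}" for x y by (simp_all add: w)
  have i1: "input n k R P s1" unfolding s1_def using s by (rule input_run) (simp add: w)
  have i2: "input n k R P s2" unfolding s2_def using i1 by (rule input_run) (simp add: w)
  have i3: "input n k R P s3" unfolding s3_def using i2 by (rule input_run) (simp add: w)
  have i4: "input n k R P s4" unfolding s4_def using i3 by (rule input_run) (simp add: w)
  have d1: "s1 ''d'' 0 0 = d" unfolding s1_def d_def using run_root[OF s P npos npos] .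
  have A2: "s2 ''A'' i j = of_bool (light n d R i j)" if "i < n" "j < n" for i j
    unfolding s2_def using run_light[OF i1 d1 R(1) that] .
  have rel: "rel n (s2 ''E'') = R" using i2 R(1) unfolding input_def rel_def by auto
  have D3: "s3 ''D'' i j = dst n R i j" if "i < n" "j < n" for i j
    unfolding s3_def using run_bfs[of s2 n "''E''" "''D''" i j \<rho>] i2 that rel by (simp add: input_def)
  have X4: "s4 ''X'' i j = hop n R i j" if "i < n" "j < n" for i j
    unfolding s4_def using run_next[OF i3 R(1) D3 that] .
  have d4: "s4 ''d'' = s1 ''d''" "s4 ''A'' = s2 ''A''" "s4 ''D'' = s3 ''D''" "s4 ''S'' = s ''S''"
    unfolding s4_def s3_def s2_def s1_def by (simp_all add: run_frame wr)
  interpret light_graph n R "hop n R" "light n d R" d using light_graph_light[OF R] .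
  have l4: "loaded k P s4" using i4 d4 d1 A2 D3 X4 unfolding loaded_def input_def by simp
  have S4: "holds_set ''S'' {} s4" using d4(4) S0 by (simp add: holds_set_def)
  have p: "card P \<le> n ^ 2" using card_mono[OF _ P] by (simp add: power2_eq_square)
  have root: "d ^ ?m \<le> card P" "d \<le> n" unfolding d_def by (rule iroot_bounds[OF p]; simp)+
  \<comment> \<open>The greedy loop offers only \<open>n\<close> rounds. For
    \<open>k \<ge> 2\<close>, \<open>d^4 \<le> card P \<le> n^2\<close> yields
    \<open>d^2 \<le> n\<close>.\<close>
  have T: "?T \<le> n"
  proof (cases "k < 2")
    case False
    then have "(d * d) ^ 2 \<le> n ^ 2" using root p by (simp add: power4_eq_xxxx power2_eq_square mult.assoc)
    then have "d * d \<le> n" by (rule power2_le_imp_le) simp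
    then show ?thesis using False by simp
  qed (use root in simp)
  obtain Ss where Ss: "Ss 0 = {}"
    "\<And>r. r < ?T \<Longrightarrow> \<exists>c0<n. Ss (Suc r) = insert c0 (Ss r) \<and>
      (\<forall>c<n. Phi P (insert c0 (Ss r)) \<le> Phi P (insert c (Ss r)))"
    "holds_set ''S'' (Ss ?T) s5"
    using run_greedy[OF l4 S4 P npos root(2) T, of \<rho>] unfolding s5_def by blast
  define S where "S = Ss ?T"
  have S: "d * ?T * Phi P S \<le> 12 * card P * n" "card S \<le> ?T" "S \<subseteq> {..<n}"
    using Phi_decay[where m = ?T, OF P Ss(1,2)] unfolding S_def by auto
  have S5: "holds_set ''S'' S s5" using Ss(3) unfolding S_def .
  have l5: "loaded k P s5" unfolding s5_def using l4 by (rule loaded_run) (auto simp: w)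
  have l6: "loaded k P s6" unfolding s6_def using l5 by (rule loaded_run) (auto simp: w)
  have "s6 ''S'' = s5 ''S''" unfolding s6_def by (rule run_frame) (simp add: w)
  then have S6: "holds_set ''S'' S s6" using S5 by (simp add: holds_set_def)
  have H6: "holds_rel ''H'' (bought P S) s6" unfolding s6_def by (rule run_buy[OF l5 S5 P])
  have host: "host (bought P S)" by (rule host_bought[OF P])
  let ?H = "connect S ?\<beta> (bought P S)"
  have fin: "holds_rel ''H'' ?H (run spanner_cmd \<rho> s)" unfolding run by (rule run_connect[OF l6 S6 H6 host])
  show thesis
  proof
    have "host ?H" by (rule host_connect[OF host])
    then show "?H \<subseteq> R" "sym ?H" unfolding host_def by auto
    show "run spanner_cmd \<rho> s ''H'' i j = of_bool ((i, j) \<in> ?H)" if "i < n" "j < n" for i j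
      using fin that unfolding holds_rel_def by blast
    show "card ?H \<le> 404 * (n * iroot n ?m (card P))"
      using spanner_size[of n R "hop n R" "light n d R" k P S] light_graph_axioms P S unfolding d_def by blast
    show "near ?H (m + 4 + ?\<beta>) u v" if uv: "(u, v) \<in> P" "near R m u v" for u v m
    proof -
      have u: "u < n" using uv P by auto
      have "near ?H (D u v + 4 + ?\<beta>) u v"
        by (rule spanner_stretch[OF P S(3) uv(1) D_lessI[OF u uv(2)]])
      then show ?thesis by (rule near_mono) (use D_leI[OF u uv(2)] in simp)
    qed
  qed
qed

lemma root_size_bound:
  fixes n k p d :: nat
  assumes k: "k \<ge> 1" and p: "p \<le> n ^ 2" and d: "d ^ (if k < 2 then 3 else 4) \<le> p"
  shows "real (n * d) \<le> real n powr (1 + 1 / (2 * real k + 1)) *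
    sqrt ((4 * real k + 5) * real p) powr (real k / (2 * real k + 1))"
proof (cases "d = 0 \<or> n = 0")
  case True
  then show ?thesis by auto
next
  case False
  let ?m = "if k < 2 then 3 else 4 :: nat"
  have d1: "1 \<le> d" and n1: "1 \<le> n" using False by auto
  have "1 \<le> d ^ ?m" using d1 by simp
  then have p1: "1 \<le> p" using d by linarith
  let ?K = "2 * real k + 1"
  have K: "?K > 0" by simp
  have "real d = (real d powr real ?m) powr (1 / real ?m)"
    using d1 by (simp add: powr_powr)
  also have "\<dots> \<le> real p powr (1 / real ?m)"
  proof (rule powr_mono2)
    have "real (d ^ ?m) \<le> real p" using d by (rule of_nat_mono)
    then show "real d powr real ?m \<le> real p" using d1 by (simp add: powr_realpow)
  qed auto
  also have "\<dots> \<le> real p powr ((real k + 1) / (2 * ?K))"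
  proof (rule powr_mono)
    show "1 / real ?m \<le> (real k + 1) / (2 * ?K)"
      using k by (auto simp: field_simps)
    show "1 \<le> real p" using p1 by simp
  qed
  \<comment> \<open>The exponent is split in the proportion \<open>1 : k\<close>; the first factor
    is absorbed by \<open>n\<close>, the second by the square root of the claimed bound.\<close>
  also have "\<dots> = (real p powr (1 / 2)) powr (1 / ?K) * (real p powr (1 / 2)) powr (real k / ?K)"
    using K by (simp add: powr_powr powr_add[symmetric] field_simps)
  also have "\<dots> \<le> real n powr (1 / ?K) * sqrt ((4 * real k + 5) * real p) powr (real k / ?K)"
  proof (intro mult_mono powr_mono2)
    have "sqrt (real p) \<le> sqrt ((real n)\<^sup>2)"
      using p by (intro real_sqrt_le_mono) (metis of_nat_mono of_nat_power)
    then show "real p powr (1 / 2) \<le> real n" by (simp add: powr_half_sqrt)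
    have "1 * real p \<le> (4 * real k + 5) * real p" by (intro mult_right_mono) auto
    then show "real p powr (1 / 2) \<le> sqrt ((4 * real k + 5) * real p)"
      by (simp add: powr_half_sqrt)
  qed auto
  finally have "real n * real d \<le> real n * (real n powr (1 / ?K) * sqrt ((4 * real k + 5) * real p) powr (real k / ?K))"
    by (intro mult_left_mono) auto
  also have "\<dots> = real n powr (1 + 1 / ?K) * sqrt ((4 * real k + 5) * real p) powr (real k / ?K)"
    using n1 by (simp add: powr_add)
  finally show ?thesis by simp
qed

section \<open>Transfer to the given graph\<close>

lemma walk_relpow:
  assumes "successively (\<lambda>x y. {x, y} \<in> E) xs" and "xs \<noteq> []" and "set xs \<subseteq> V"
    and \<nu>: "bij_betw \<nu> {..<n} V"
    and "i < n" "j < n" "\<nu> i = hd xs" "\<nu> j = last xs"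
  shows "(i, j) \<in> {(i, j). i < n \<and> j < n \<and> {\<nu> i, \<nu> j} \<in> E} ^^ (length xs - 1)"
  using assms(1-3,5-)
proof (induction xs arbitrary: i rule: induct_list012)
  case (2 x)
  then have "i = j" using \<nu> by (auto simp: bij_betw_def inj_on_def)
  then show ?case by simp
next
  case (3 x y zs)
  obtain w where w: "w < n" "\<nu> w = y" using 3 \<nu> by (auto simp: bij_betw_def)
  have "(w, j) \<in> {(i, j). i < n \<and> j < n \<and> {\<nu> i, \<nu> j} \<in> E} ^^ (length (y # zs) - 1)"
    using 3 w by (intro 3(2)) auto
  moreover have "(i, w) \<in> {(i, j). i < n \<and> j < n \<and> {\<nu> i, \<nu> j} \<in> E}" using 3 w by auto
  ultimately have "(i, j) \<in> {(i, j). i < n \<and> j < n \<and> {\<nu> i, \<nu> j} \<in> E} ^^ Suc (length (y # zs) - 1)"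
    by (intro relpow_Suc_I2)
  then show ?case by simp
qed simp

lemma relpow_walk:
  assumes ij: "(i, j) \<in> H ^^ m" and i: "\<nu> i \<in> V"
    and H: "\<And>a b. (a, b) \<in> H \<Longrightarrow> \<nu> a \<in> V \<and> \<nu> b \<in> V \<and> {\<nu> a, \<nu> b} \<in> F"
  shows "\<exists>xs. walk V F (\<nu> i) xs (\<nu> j) \<and> length xs = Suc m"
proof -
  obtain f where f: "f 0 = i" "f m = j" "\<forall>l<m. (f l, f (Suc l)) \<in> H"
    using ij unfolding relpow_fun_conv by blast
  let ?xs = "map (\<lambda>l. \<nu> (f l)) [0..<Suc m]"
  have "\<nu> (f l) \<in> V" if "l \<le> m" for l
  proof (cases l)
    case 0
    then show ?thesis using f(1) i by simp
  next
    case (Suc l')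
    then have "(f l', f l) \<in> H" using that f(3) by simp
    then show ?thesis using H by blast
  qed
  then have "set ?xs \<subseteq> V" by auto
  moreover have "successively (\<lambda>x y. {x, y} \<in> F) ?xs"
    using f(3) H by (auto simp: successively_conv_nth simp del: upt_Suc)
  ultimately have "walk V F (\<nu> i) ?xs (\<nu> j)"
    unfolding walk_def using f by (simp add: hd_map last_map del: upt_Suc)
  then show ?thesis by (intro exI[of _ ?xs]) simp
qed

text \<open>An infimum of extended naturals is a minimum unless the set is empty, and then it is
  infinite.\<close>

lemma gdist_attained:
  assumes "gdist V E u v \<noteq> \<infinity>"
  obtains xs where "walk V E u xs v" and "gdist V E u v = enat (length xs - 1)"
proof -
  let ?A = "(\<lambda>xs. enat (length xs - 1)) ` {xs. walk V E u xs v}"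
  have "?A \<noteq> {}"
  proof
    assume "?A = {}"
    then have "gdist V E u v = Inf {}" unfolding gdist_def by (simp only:)
    with assms show False by (simp add: top_enat_def)
  qed
  then have "Inf ?A \<in> ?A" unfolding Inf_enat_def by (auto intro: LeastI)
  then show thesis using that unfolding gdist_def by auto
qed

theorem theorem2:
  "\<exists>(prog :: com) (C :: real) (q :: nat poly).
     \<forall>(V :: 'a set) (E :: 'a set set) (P :: ('a \<times> 'a) set) (k :: nat) (\<nu> :: nat \<Rightarrow> 'a).
       ugraph V E \<and> P \<subseteq> V \<times> V \<and> k \<ge> 1 \<and> bij_betw \<nu> {..<card V} V \<longrightarrow>
       (\<exists>T t F.
          exec prog (input_store \<nu> V E P k) T t \<and>
          T \<le> poly q (card V) \<and>
          outputs_edges \<nu> V t F \<and>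
          pairwise_spanner 1 (4 * real k) P V E F \<and>
          real (card F) \<le>
            C * (real (card V) powr (1 + 1 / (2 * real k + 1)) *
                 sqrt ((4 * real k + 5) * real (card P)) powr (real k / (2 * real k + 1))))"
proof (intro exI[of _ "compile spanner_cmd 0"] exI[of _ "404::real"] exI[of _ "cost spanner_cmd"] allI impI)
  fix V :: "'a set" and E :: "'a set set" and P :: "('a \<times> 'a) set" and k :: nat and \<nu> :: "nat \<Rightarrow> 'a"
  assume asm: "ugraph V E \<and> P \<subseteq> V \<times> V \<and> k \<ge> 1 \<and> bij_betw \<nu> {..<card V} V"
  then have E: "ugraph V E" and P: "P \<subseteq> V \<times> V" and k: "k \<ge> 1" and \<nu>: "bij_betw \<nu> {..<card V} V" by auto
  define n where "n = card V"
  let ?s = "input_store \<nu> V E P k"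
  let ?bound = "real n powr (1 + 1 / (2 * real k + 1)) * sqrt ((4 * real k + 5) * real (card P)) powr (real k / (2 * real k + 1))"
  have \<nu>n: "bij_betw \<nu> {..<n} V" using \<nu> unfolding n_def .
  have \<nu>V: "\<nu> i \<in> V" if "i < n" for i using \<nu>n that by (auto simp: bij_betw_def)
  have inj: "\<nu> i = \<nu> j \<longleftrightarrow> i = j" if "i < n" "j < n" for i j using \<nu>n that by (auto simp: bij_betw_def inj_on_def)
  have size: "size_of ?s = n" by (simp add: input_store_def n_def)
  \<comment> \<open>The index array is 0 in the input store, so execution starts with the all-zero
    valuation.\<close>
  have "sim (\<lambda>_. 0) ?s ?s" by (simp add: sim_def input_store_def)
  from runs_compile[OF admissible_spanner_cmd this, of 0] obtain T t where
    exec: "exec (compile spanner_cmd 0) ?s T t" "T \<le> poly (cost spanner_cmd) n"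
    and sim: "sim (\<lambda>_. 0) (run spanner_cmd (\<lambda>_. 0) ?s) t"
    unfolding runs_def size by blast
  have tH: "t ''H'' = run spanner_cmd (\<lambda>_. 0) ?s ''H''" using sim by (simp add: sim_def reserved_def)
  define R where "R = {(i, j). i < n \<and> j < n \<and> {\<nu> i, \<nu> j} \<in> E}"
  define P' where "P' = {(i, j). i < n \<and> j < n \<and> (\<nu> i, \<nu> j) \<in> P}"
  have R: "R \<subseteq> {..<n} \<times> {..<n}" "sym R" by (auto simp: R_def sym_def insert_commute)
  have P': "P' \<subseteq> {..<n} \<times> {..<n}" by (auto simp: P'_def)
  have cardP: "card P' = card P"
  proof (rule bij_betw_same_card[of "map_prod \<nu> \<nu>"])
    have "inj_on (map_prod \<nu> \<nu>) P'" using inj by (auto simp: inj_on_def P'_def)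
    moreover have "map_prod \<nu> \<nu> ` P' = P"
    proof
      show "P \<subseteq> map_prod \<nu> \<nu> ` P'"
      proof
        fix x assume x: "x \<in> P"
        obtain a b where ab: "x = (a, b)" "a \<in> V" "b \<in> V" using x P by auto
        then obtain i j where "i < n" "j < n" "\<nu> i = a" "\<nu> j = b" using \<nu>n by (auto simp: bij_betw_def)
        with x ab show "x \<in> map_prod \<nu> \<nu> ` P'" by (force simp: P'_def)
      qed
    qed (auto simp: P'_def)
    ultimately show "bij_betw (map_prod \<nu> \<nu>) P' P" by (simp add: bij_betw_def)
  qed
  have input: "input n k R P' ?s"
    unfolding input_def by (simp add: input_store_def n_def R_def P'_def)
  show "\<exists>T t F. exec (compile spanner_cmd 0) ?s T t \<and> T \<le> poly (cost spanner_cmd) (card V) \<and>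
     outputs_edges \<nu> V t F \<and> pairwise_spanner 1 (4 * real k) P V E F \<and>
     real (card F) \<le> 404 * (real (card V) powr (1 + 1 / (2 * real k + 1)) *
                 sqrt ((4 * real k + 5) * real (card P)) powr (real k / (2 * real k + 1)))"
  proof (cases "n = 0")
    case True
    \<comment> \<open>Without nodes there is no candidate centre to choose, but the empty edge set
      is a valid answer.\<close>
    have "V = {}" using True \<nu>n by (auto simp: bij_betw_def)
    then have "pairwise_spanner 1 (4 * real k) P V E {}" using P by (auto simp: pairwise_spanner_def)
    moreover have "outputs_edges \<nu> V t {}" using True by (simp add: outputs_edges_def n_def)
    ultimately show ?thesis using exec unfolding n_def
      by (intro exI[of _ T] exI[of _ t] exI[of _ "{}"]) auto
  next
    case False
    have "?s ''S'' = (\<lambda>_ _. 0)" by (simp add: input_store_def fun_eq_iff)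
    then obtain H where H: "H \<subseteq> R" "sym H"
      "\<And>i j. i < n \<Longrightarrow> j < n \<Longrightarrow> run spanner_cmd (\<lambda>_. 0) ?s ''H'' i j = of_bool ((i, j) \<in> H)"
      "card H \<le> 404 * (n * iroot n (if k < 2 then 3 else 4) (card P'))"
      "\<And>u v m. (u, v) \<in> P' \<Longrightarrow> near R m u v \<Longrightarrow> near H (m + 4 + (if k < 2 then 0 else 2)) u v"
      using run_spanner[OF input _ R P'] False by blast
    define F where "F = (\<lambda>(i, j). {\<nu> i, \<nu> j}) ` H"
    \<comment> \<open>Symmetry of \<open>H\<close> makes the passage to unordered edges
      reversible.\<close>
    have FH: "{\<nu> i, \<nu> j} \<in> F \<longleftrightarrow> (i, j) \<in> H" if ij: "i < n" "j < n" for i j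
    proof
      assume "{\<nu> i, \<nu> j} \<in> F"
      then obtain a b where ab: "(a, b) \<in> H" "{\<nu> i, \<nu> j} = {\<nu> a, \<nu> b}" unfolding F_def by auto
      then have "a < n" "b < n" using H(1) R(1) by auto
      with ab(2) ij inj have "i = a \<and> j = b \<or> i = b \<and> j = a" by (auto simp: doubleton_eq_iff)
      with ab(1) H(2) show "(i, j) \<in> H" by (auto dest: symD)
    qed (auto simp: F_def)
    have "outputs_edges \<nu> V t F"
      unfolding outputs_edges_def tH using H(3) FH by (simp add: n_def)
    moreover have "pairwise_spanner 1 (4 * real k) P V E F"
      unfolding pairwise_spanner_def
    proof (intro conjI ballI, goal_cases)
      case 1
      show ?case using H(1) unfolding F_def R_def by auto
    next
      case (2 x)
      obtain a b where ab: "x = (a, b)" by (cases x)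
      then obtain i j where ij: "i < n" "j < n" "\<nu> i = a" "\<nu> j = b"
        using 2 P \<nu>n by (auto simp: bij_betw_def)
      have ijP: "(i, j) \<in> P'" using 2 ij ab by (simp add: P'_def)
      have "ereal_of_enat (gdist V F a b) \<le> ereal 1 * ereal_of_enat (gdist V E a b) + ereal (4 * real k)"
      proof (cases "gdist V E a b = \<infinity>")
        case True
        then show ?thesis by simp
      next
        case False
        then obtain xs where xs: "walk V E a xs b" "gdist V E a b = enat (length xs - 1)" by (rule gdist_attained)
        let ?m = "length xs - 1"
        have "(i, j) \<in> R ^^ ?m"
          unfolding R_def using xs(1) ij \<nu>n unfolding walk_def by (intro walk_relpow) auto
        then have "near R ?m i j" unfolding near_def by blast
        then have "near H (?m + 4 + (if k < 2 then 0 else 2)) i j" using ijP by (intro H(5))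
        \<comment> \<open>The error is \<open>4 = 4 k\<close> for \<open>k = 1\<close>, and
          \<open>6 \<le> 4 k\<close> for \<open>k \<ge> 2\<close>.\<close>
        then have "near H (?m + 4 * k) i j" by (rule near_mono) (use k in auto)
        then obtain l where l: "l \<le> ?m + 4 * k" "(i, j) \<in> H ^^ l" unfolding near_def by blast
        obtain ys where ys: "walk V F a ys b" "length ys = Suc l"
        proof -
          have *: "\<nu> a' \<in> V \<and> \<nu> b' \<in> V \<and> {\<nu> a', \<nu> b'} \<in> F" if "(a', b') \<in> H" for a' b'
          proof -
            have "a' < n" "b' < n" using that H(1) R(1) by auto
            then show ?thesis using \<nu>V FH that by blast
          qed
          show thesis using relpow_walk[where \<nu> = \<nu> and V = V and F = F, OF l(2) \<nu>V[OF ij(1)] *] that unfolding ij(3,4) by auto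
        qed
        have "gdist V F a b \<le> enat (length ys - 1)"
          unfolding gdist_def using ys(1) by (intro INF_lower) simp
        then have "gdist V F a b \<le> enat (?m + 4 * k)" using ys(2) l(1) by (simp add: order_trans)
        then have "ereal_of_enat (gdist V F a b) \<le> ereal_of_enat (enat (?m + 4 * k))"
          by (simp only: ereal_of_enat_le_iff)
        then show ?thesis using xs(2) by simp
      qed
      then show ?case using ab by simp
    qed
    moreover have "real (card F) \<le> 404 * ?bound"
    proof -
      let ?r = "iroot n (if k < 2 then 3 else 4) (card P')"
      have p: "card P' \<le> n ^ 2" using card_mono[OF _ P'] by (simp add: power2_eq_square)
      have "?r ^ (if k < 2 then 3 else 4) \<le> card P'" by (rule iroot_bounds(1)[OF p]) simp
      then have r: "real (n * ?r) \<le> ?bound" using root_size_bound[OF k p] unfolding cardP by blast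
      have "finite H" by (rule finite_subset[OF subset_trans[OF H(1) R(1)]]) simp
      then have "card F \<le> card H" unfolding F_def by (rule card_image_le)
      with H(4) have "card F \<le> 404 * (n * ?r)" by linarith
      then have "real (card F) \<le> real (404 * (n * ?r))" by (rule of_nat_mono)
      also have "\<dots> = 404 * real (n * ?r)" by simp
      also have "\<dots> \<le> 404 * ?bound" using r by (intro mult_left_mono) auto
      finally show ?thesis .
    qed
    ultimately show ?thesis using exec unfolding n_def by blast
  qed
qed

end
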